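(* Let $u$ be an infinite Blaschke product. Then $\mathcal S(\mathcal T_u(C))$ consists exactly of all sequences $(P_{u_n}(T_u(a)+K)P_{u_n}+G_n)_{n\ge1}$ with $a\in C(\mathbb T)$, $K$ a compact operator on $K^2_u$, and $(G_n)\in\mathcal G^{\mathcal P_u}$.
   Context: $\mathbb T$ is the unit circle, $H^2\subset L^2(\mathbb T)$ the Hardy space, $P$ the orthogonal projection onto $H^2$, $M_a$ multiplication by $a$. For an inner function $v$, $K^2_v:=H^2\ominus vH^2$ and $P_v=P-M_vPM_{\bar v}$ is the orthogonal projection onto $K^2_v$. For $a\in L^\infty(\mathbb T)$ the truncated Toeplitz operator is $T_u(a):=P_uM_a|_{K^2_u}$. Blaschke factors: $b_0(z)=z$, $b_\lambda(z)=\frac{\lambda-z}{1-\bar\lambda z}\frac{|\lambda|}{\lambda}$ for $\lambda\ne0$. An infinite Blaschke product is $u=\prod_{k\ge1}b_{\lambda_k}$ with $|\lambda_k|\le|\lambda_{k+1}|$ and $\sum_k(1-|\lambda_k|)<\infty$; $u_n:=\prod_{k=1}^nb_{\lambda_k}$, and $P_{u_n}$ (restricted to $K^2_u$) is the orthogonal projection onto $K^2_{u_n}\subseteq K^2_u$. The sequence $\mathcal P_u=(P_{u_n})$ is a filtration on $K^2_u$ (finite-rank orthogonal projections converging strongly to the identity). $\mathcal F^{\mathcal P_u}$ is the $C^*$-algebra (entrywise operations, supremum norm) of all sequences $(A_n)$ with $A_n:\operatorname{im}P_{u_n}\to\operatorname{im}P_{u_n}$ such that $A_nP_{u_n}$ converges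 $^*$-strongly on $K^2_u$; $\mathcal G^{\mathcal P_u}$ is its ideal of sequences with $\|A_n\|\to0$. $\mathcal S(\mathcal T_u(C))$ is the smallest closed subalgebra of $\mathcal F^{\mathcal P_u}$ containing all sequences $(P_{u_n}(T_u(a)+K)P_{u_n})_{n\ge1}$ with $a\in C(\mathbb T)$ and $K$ compact on $K^2_u$. *)

theory Defs
  imports "HOL-Analysis.Analysis"
begin

text \<open>Functions on the unit circle are represented as functions complex => complex
  (only values on sphere 0 1 matter); operators as maps between such functions.
  Equality of L2 functions is almost-everywhere equality.\<close>

type_synonym cfun = "complex \<Rightarrow> complex"
type_synonym cop = "cfun \<Rightarrow> cfun"

definition circ_param :: "real measure" where
  "circ_param = density (restrict_space lborel {0..2*pi}) (\<lambda>_. ennreal (1/(2*pi)))"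

definition Tmeas :: "complex measure" where
  "Tmeas = distr circ_param (restrict_space borel (sphere 0 1)) cis"

definition L2 :: "cfun set" where
  "L2 = {f. f \<in> borel_measurable Tmeas \<and> integrable Tmeas (\<lambda>z. (cmod (f z))\<^sup>2)}"

definition l2ip :: "cfun \<Rightarrow> cfun \<Rightarrow> complex" where
  "l2ip f g = (\<integral>z. f z * cnj (g z) \<partial>Tmeas)"

definition l2norm :: "cfun \<Rightarrow> real" where
  "l2norm f = sqrt (\<integral>z. (cmod (f z))\<^sup>2 \<partial>Tmeas)"

definition aeq :: "cfun \<Rightarrow> cfun \<Rightarrow> bool" where
  "aeq f g \<longleftrightarrow> (AE z in Tmeas. f z = g z)"

definition fcoef :: "cfun \<Rightarrow> int \<Rightarrow> complex" where
  "fcoef f n = (\<integral>z. f z * cnj (z powi n) \<partial>Tmeas)"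

definition H2 :: "cfun set" where
  "H2 = {f \<in> L2. \<forall>n::int. n < 0 \<longrightarrow> fcoef f n = 0}"

definition K2 :: "cfun \<Rightarrow> cfun set" where
  "K2 v = {f \<in> H2. \<forall>h\<in>H2. l2ip f (\<lambda>z. v z * h z) = 0}"

definition orth_proj :: "cfun set \<Rightarrow> cop" where
  "orth_proj V f = (SOME g. g \<in> V \<and> (\<forall>h\<in>V. l2ip (\<lambda>z. f z - g z) h = 0))"

definition mult_op :: "cfun \<Rightarrow> cop" where
  "mult_op a f = (\<lambda>z. a z * f z)"

definition ttoep :: "cfun \<Rightarrow> cfun \<Rightarrow> cop" where
  "ttoep u a f = orth_proj (K2 u) (mult_op a f)"

definition bounded_op :: "cfun set \<Rightarrow> cop \<Rightarrow> bool" where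
  "bounded_op V A \<longleftrightarrow>
     (\<forall>f\<in>V. A f \<in> V) \<and>
     (\<forall>f\<in>V. \<forall>g\<in>V. aeq f g \<longrightarrow> aeq (A f) (A g)) \<and>
     (\<forall>f\<in>V. \<forall>g\<in>V. \<forall>c::complex. aeq (A (\<lambda>z. f z + c * g z)) (\<lambda>z. A f z + c * A g z)) \<and>
     (\<exists>C. \<forall>f\<in>V. l2norm (A f) \<le> C * l2norm f)"

definition opnorm :: "cfun set \<Rightarrow> cop \<Rightarrow> real" where
  "opnorm V A = (SUP f\<in>{f\<in>V. l2norm f \<le> 1}. l2norm (A f))"

definition compact_op :: "cfun set \<Rightarrow> cop \<Rightarrow> bool" where
  "compact_op V K \<longleftrightarrow> bounded_op V K \<and>
     (\<forall>f::nat \<Rightarrow> cfun. (\<forall>k. f k \<in> V \<and> l2norm (f k) \<le> 1) \<longrightarrow>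
        (\<exists>\<sigma> g. strict_mono \<sigma> \<and> g \<in> V \<and>
           (\<lambda>k. l2norm (\<lambda>z. K (f (\<sigma> k)) z - g z)) \<longlonglongrightarrow> 0))"

definition adj :: "cfun set \<Rightarrow> cop \<Rightarrow> cop" where
  "adj V B g = (SOME h. h \<in> V \<and> (\<forall>f\<in>V. l2ip (B f) g = l2ip f h))"

definition strong_conv :: "cfun set \<Rightarrow> (nat \<Rightarrow> cop) \<Rightarrow> bool" where
  "strong_conv V B \<longleftrightarrow>
     (\<forall>f\<in>V. \<exists>g\<in>V. (\<lambda>n. l2norm (\<lambda>z. B n f z - g z)) \<longlonglongrightarrow> 0)"

definition star_strong_conv :: "cfun set \<Rightarrow> (nat \<Rightarrow> cop) \<Rightarrow> bool" where
  "star_strong_conv V B \<longleftrightarrow> strong_conv V B \<and> strong_conv V (\<lambda>n. adj V (B n))"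

definition bfac :: "complex \<Rightarrow> complex \<Rightarrow> complex" where
  "bfac l z = (if l = 0 then z else (l - z) / (1 - cnj l * z) * (of_real (cmod l) / l))"

definition blaschke_seq :: "(nat \<Rightarrow> complex) \<Rightarrow> bool" where
  "blaschke_seq lam \<longleftrightarrow> (\<forall>k. cmod (lam k) < 1) \<and>
     (\<forall>k. cmod (lam k) \<le> cmod (lam (Suc k))) \<and> summable (\<lambda>k. 1 - cmod (lam k))"

definition blaschke_disc :: "(nat \<Rightarrow> complex) \<Rightarrow> complex \<Rightarrow> complex" where
  "blaschke_disc lam w = (\<Prod>k. bfac (lam k) w)"

definition blaschke :: "(nat \<Rightarrow> complex) \<Rightarrow> cfun" where
  "blaschke lam z =
     (if \<exists>L. ((\<lambda>r::real. blaschke_disc lam (of_real r * z)) \<longlongrightarrow> L) (at_left 1)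
      then Lim (at_left 1) (\<lambda>r::real. blaschke_disc lam (of_real r * z)) else 0)"

text \<open>Partial products; index n here corresponds to u_{n+1} of the paper.\<close>
definition bpartial :: "(nat \<Rightarrow> complex) \<Rightarrow> nat \<Rightarrow> cfun" where
  "bpartial lam n z = (\<Prod>k\<le>n. bfac (lam k) z)"

definition Pn :: "(nat \<Rightarrow> complex) \<Rightarrow> nat \<Rightarrow> cop" where
  "Pn lam n = orth_proj (K2 (bpartial lam n))"

definition Falg :: "(nat \<Rightarrow> complex) \<Rightarrow> (nat \<Rightarrow> cop) set" where
  "Falg lam = {A. (\<forall>n. bounded_op (K2 (bpartial lam n)) (A n)) \<and>
       star_strong_conv (K2 (blaschke lam)) (\<lambda>n f. A n (Pn lam n f))}"

definition seqnorm :: "(nat \<Rightarrow> complex) \<Rightarrow> (nat \<Rightarrow> cop) \<Rightarrow> real" where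
  "seqnorm lam A = (SUP n. opnorm (K2 (bpartial lam n)) (A n))"

definition Galg :: "(nat \<Rightarrow> complex) \<Rightarrow> (nat \<Rightarrow> cop) set" where
  "Galg lam = {A \<in> Falg lam. (\<lambda>n. opnorm (K2 (bpartial lam n)) (A n)) \<longlonglongrightarrow> 0}"

definition seq_add :: "(nat \<Rightarrow> cop) \<Rightarrow> (nat \<Rightarrow> cop) \<Rightarrow> (nat \<Rightarrow> cop)" where
  "seq_add A B = (\<lambda>n f z. A n f z + B n f z)"

definition seq_smult :: "complex \<Rightarrow> (nat \<Rightarrow> cop) \<Rightarrow> (nat \<Rightarrow> cop)" where
  "seq_smult c A = (\<lambda>n f z. c * A n f z)"

definition seq_mult :: "(nat \<Rightarrow> cop) \<Rightarrow> (nat \<Rightarrow> cop) \<Rightarrow> (nat \<Rightarrow> cop)" where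
  "seq_mult A B = (\<lambda>n f. A n (B n f))"

definition closed_subalg :: "(nat \<Rightarrow> complex) \<Rightarrow> (nat \<Rightarrow> cop) set \<Rightarrow> bool" where
  "closed_subalg lam S \<longleftrightarrow> S \<subseteq> Falg lam \<and>
     (\<forall>A\<in>S. \<forall>B\<in>S. seq_add A B \<in> S) \<and>
     (\<forall>A\<in>S. \<forall>c. seq_smult c A \<in> S) \<and>
     (\<forall>A\<in>S. \<forall>B\<in>S. seq_mult A B \<in> S) \<and>
     (\<forall>A\<in>Falg lam. (\<forall>e>0. \<exists>B\<in>S. seqnorm lam (\<lambda>n f z. A n f z - B n f z) < e) \<longrightarrow> A \<in> S)"

definition gen_seq :: "(nat \<Rightarrow> complex) \<Rightarrow> cfun \<Rightarrow> cop \<Rightarrow> (nat \<Rightarrow> cop)" where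
  "gen_seq lam a K = (\<lambda>n f. Pn lam n
      (\<lambda>z. ttoep (blaschke lam) a (Pn lam n f) z + K (Pn lam n f) z))"

definition generators :: "(nat \<Rightarrow> complex) \<Rightarrow> (nat \<Rightarrow> cop) set" where
  "generators lam = {gen_seq lam a K | a K.
      continuous_on (sphere 0 1) a \<and> compact_op (K2 (blaschke lam)) K}"

definition S_TuC :: "(nat \<Rightarrow> complex) \<Rightarrow> (nat \<Rightarrow> cop) set" where
  "S_TuC lam = \<Inter>{S. closed_subalg lam S \<and> generators lam \<subseteq> S}"

end

theory Submission
  imports Defs "HOL-Probability.Probability" "HOL-Library.Diagonal_Subsequence"
begin

text \<open>
  The partial products \<open>u_n\<close> converge to \<open>u\<close> in \<open>L2\<close>; that the radial limits of \<open>u\<close> give the same function is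
  Fatou's theorem, obtained from the weak type estimate for the maximal function. The Takenaka-Malmquist vectors
  \<open>e k\<close> form an orthonormal basis of the model space of \<open>u\<close>, and \<open>P_{u_n}\<close> is the projection onto the first ones.

  Let \<open>J\<close> be the set of sequences \<open>P_n K P_n + G_n\<close> with \<open>K\<close> compact and \<open>G_n\<close> null. It is closed, and an ideal
  among the sequences \<open>P_n X P_n + G_n\<close>. For the symbols \<open>z\<close> and \<open>cnj z\<close> the semicommutators
  \<open>P_n T(a) P_n T(b) P_n - P_n T(ab) P_n\<close> have rank one, and they lie in \<open>J\<close> because \<open>u_n\<close> converges in norm;
  by Weierstrass approximation this holds for all continuous \<open>a\<close> and \<open>b\<close>. So the sequences in question form an algebra,
  and since a symbol can be truncated at the norm of its sequence modulo \<open>J\<close>, a telescoping series shows that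
  the algebra is closed. Conversely, a null sequence is a limit of sequences with finitely many nonzero entries,
  and these arise from products of sections of rank one operators, which detect whether \<open>e k\<close> is in the range of \<open>P_n\<close>.
\<close>

section \<open>Normalized arc length on the circle\<close>

text \<open>All objects are maps of functions with equality almost everywhere, so the work is done
  in the Hilbert space \<open>hil\<close> of classes; operators are carried there by
  \<open>lift\<close>, extended by zero, so that sections of all sizes live in one operator space.
  The values of a \<open>cop\<close> off its subspace are arbitrary, and the null part
  \<open>G\<close> of a decomposition absorbs them. Fatou's theorem is needed because
  \<open>blaschke\<close> is defined by limits along radii, on which convergence in the norm alone
  has no bearing. The main obstacle is closedness: a continuous symbol need not be determined by its
  sequence, so a convergent sequence of elements does not come with a convergent sequence of
  symbols. Symbols are therefore chosen anew for the successive differences, with sup norm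
  comparable to the norm of the difference, and then their series converges uniformly.\<close>

lemma space_Tmeas [simp]: "space Tmeas = sphere 0 1"
  by (simp add: Tmeas_def space_restrict_space)

lemma sets_Tmeas: "sets Tmeas = sets (restrict_space borel (sphere 0 1))"
  by (simp add: Tmeas_def)

lemma measurable_cis_circ: "cis \<in> measurable circ_param (restrict_space borel (sphere 0 1))"
proof (rule measurable_restrict_space2)
  have "cis \<in> borel_measurable borel"
    by (intro borel_measurable_continuous_onI continuous_intros)
  then show "cis \<in> borel_measurable circ_param"
    unfolding circ_param_def by (simp add: measurable_restrict_space1)
qed (auto simp: circ_param_def)

lemma emeasure_circ_param: "emeasure circ_param (space circ_param) = 1"
proof -
  have "emeasure circ_param (space circ_param) =
      (\<integral>\<^sup>+x. ennreal (1/(2*pi)) * indicator {0..2*pi} x \<partial>restrict_space lborel {0..2*pi})"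
    unfolding circ_param_def
    by (subst emeasure_density)
      (auto intro!: nn_integral_cong sets.top[of "restrict_space lborel {0..2*pi}", simplified space_restrict_space, simplified]
        simp: space_restrict_space split: split_indicator)
  also have "\<dots> = (\<integral>\<^sup>+x. ennreal (1/(2*pi)) * indicator {0..2*pi} x \<partial>lborel)"
    by (subst nn_integral_restrict_space) (auto intro!: nn_integral_cong split: split_indicator)
  also have "\<dots> = ennreal (1/(2*pi)) * ennreal (2*pi)"
    by (subst nn_integral_cmult_indicator) auto
  also have "\<dots> = 1"
    by (subst ennreal_mult[symmetric]) auto
  finally show ?thesis .
qed

interpretation Tm: prob_space Tmeas
  unfolding Tmeas_def
  by (rule prob_space.prob_space_distr[OF prob_spaceI[OF emeasure_circ_param] measurable_cis_circ])

lemma nn_integral_Tmeas: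
  assumes "f \<in> borel_measurable Tmeas"
  shows "(\<integral>\<^sup>+z. f z \<partial>Tmeas) =
    ennreal (1/(2*pi)) * (\<integral>\<^sup>+t. f (cis t) * indicator {0..2*pi} t \<partial>lborel)"
proof -
  have f: "f \<in> borel_measurable (restrict_space borel (sphere 0 1))"
    using assms by (simp add: measurable_cong_sets[OF sets_Tmeas refl])
  have fc: "(\<lambda>t. f (cis t)) \<in> borel_measurable circ_param"
    using measurable_compose[OF measurable_cis_circ f] .
  then have fc': "(\<lambda>t. f (cis t)) \<in> borel_measurable (restrict_space lborel {0..2*pi})"
    unfolding circ_param_def by simp
  have fc'': "(\<lambda>t. f (cis t) * indicator {0..2*pi} t) \<in> borel_measurable lborel"
    using borel_measurable_restrict_space_iff_ennreal[of "{0..2*pi}" lborel "\<lambda>t. f (cis t)"] fc'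
    by simp
  have "(\<integral>\<^sup>+z. f z \<partial>Tmeas) = (\<integral>\<^sup>+t. f (cis t) \<partial>circ_param)"
    unfolding Tmeas_def by (rule nn_integral_distr[OF measurable_cis_circ]) (use f in simp)
  also have "\<dots> = (\<integral>\<^sup>+t. ennreal (1/(2*pi)) * f (cis t) \<partial>restrict_space lborel {0..2*pi})"
    unfolding circ_param_def by (rule nn_integral_density) (use fc' in auto)
  also have "\<dots> = (\<integral>\<^sup>+t. ennreal (1/(2*pi)) * (f (cis t) * indicator {0..2*pi} t) \<partial>lborel)"
    by (subst nn_integral_restrict_space) (auto intro!: nn_integral_cong split: split_indicator)
  also have "\<dots> = ennreal (1/(2*pi)) * (\<integral>\<^sup>+t. f (cis t) * indicator {0..2*pi} t \<partial>lborel)"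
    by (rule nn_integral_cmult[OF fc''])
  finally show ?thesis .
qed

lemma integral_Tmeas:
  fixes f :: "complex \<Rightarrow> complex"
  assumes "f \<in> borel_measurable Tmeas"
  shows "(\<integral>z. f z \<partial>Tmeas) = (\<integral>t. indicator {0..2*pi} t *\<^sub>R f (cis t) \<partial>lborel) / (2*pi)"
proof -
  have f: "f \<in> borel_measurable (restrict_space borel (sphere 0 1))"
    using assms by (simp add: measurable_cong_sets[OF sets_Tmeas refl])
  have fc: "(\<lambda>t. f (cis t)) \<in> borel_measurable circ_param"
    using measurable_compose[OF measurable_cis_circ f] .
  then have fc': "(\<lambda>t. f (cis t)) \<in> borel_measurable (restrict_space lborel {0..2*pi})"
    unfolding circ_param_def by simp
  have "(\<integral>z. f z \<partial>Tmeas) = (\<integral>t. f (cis t) \<partial>circ_param)"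
    unfolding Tmeas_def by (rule integral_distr[OF measurable_cis_circ]) (use f in simp)
  also have "\<dots> = (\<integral>t. (1/(2*pi)) *\<^sub>R f (cis t) \<partial>restrict_space lborel {0..2*pi})"
    unfolding circ_param_def by (rule integral_density) (use fc' in auto)
  also have "\<dots> = (\<integral>t. indicator {0..2*pi} t *\<^sub>R ((1/(2*pi)) *\<^sub>R f (cis t)) \<partial>lborel)"
    by (rule integral_restrict_space) auto
  also have "\<dots> = (\<integral>t. (1/(2*pi)) *\<^sub>R (indicator {0..2*pi} t *\<^sub>R f (cis t)) \<partial>lborel)"
    by (simp add: mult.commute)
  also have "\<dots> = (1/(2*pi)) *\<^sub>R (\<integral>t. (indicator {0..2*pi} t *\<^sub>R f (cis t)) \<partial>lborel)"
    by (rule integral_scaleR_right)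
  finally show ?thesis by (simp add: scaleR_conv_of_real field_simps)
qed

lemma borel_measurable_Tmeas_cont:
  fixes f :: "complex \<Rightarrow> 'a::topological_space"
  assumes "continuous_on (sphere 0 1) f"
  shows "f \<in> borel_measurable Tmeas"
proof -
  have "f \<in> borel_measurable (restrict_space borel (sphere 0 1))"
    by (rule borel_measurable_continuous_on_restrict[OF assms])
  then show ?thesis by (simp add: measurable_cong_sets[OF sets_Tmeas refl])
qed

lemma borel_measurable_cnj [measurable (raw)]:
  "f \<in> borel_measurable M \<Longrightarrow> (\<lambda>x. cnj (f x)) \<in> borel_measurable M"
  by (rule measurable_compose[where g = cnj])
    (auto intro!: borel_measurable_continuous_onI continuous_intros)

text \<open>For nonzero \<open>n\<close> the primitive \<open>F\<close> of the pulled back function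
  takes the same value at 0 and at \<open>2 * pi\<close>, so the fundamental theorem of calculus
  gives 0.\<close>

lemma integral_powi_Tmeas: "(\<integral>z. z powi n \<partial>Tmeas) = (if n = 0 then 1 else 0)"
proof (cases "n = 0")
  case True
  then show ?thesis using Tm.prob_space by simp
next
  case False
  have m: "(\<lambda>z::complex. z powi n) \<in> borel_measurable Tmeas"
    by (intro borel_measurable_Tmeas_cont continuous_intros) auto
  define F where "F t = cis (of_int n * t) / (\<i> * of_int n)" for t
  have "(F has_vector_derivative cis t powi n) (at t within {0..2*pi})" for t
  proof -
    have "cis t powi n = cis (of_int n * t)"
      by (simp add: cis_power_int)
    moreover have "((\<lambda>t. cis (of_int n * t)) has_vector_derivative (of_int n) *\<^sub>R (\<i> * cis (of_int n * t))) (at t within {0..2*pi})"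
      by (auto intro!: derivative_eq_intros has_derivative_cis[THEN has_derivative_eq_rhs]
          simp: has_vector_derivative_def scaleR_conv_of_real algebra_simps)
    ultimately show ?thesis unfolding F_def using False
      by (auto intro!: derivative_eq_intros simp: scaleR_conv_of_real field_simps)
  qed
  then have "((\<lambda>t. cis t powi n) has_integral (F (2*pi) - F 0)) {0..2*pi}"
    by (intro fundamental_theorem_of_calculus) auto
  moreover have "F (2*pi) = F 0"
  proof -
    have "cis (of_int n * (2*pi)) = 1"
      using cis_multiple_2pi[of "of_int n"] by (simp add: mult_ac)
    then show ?thesis by (simp add: F_def)
  qed
  ultimately have hi: "((\<lambda>t. cis t powi n) has_integral 0) {0..2*pi}" by simp
  have "continuous_on {0..2*pi} (\<lambda>t. cis t powi n)"
    by (intro continuous_intros) auto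
  then have "set_integrable lborel {0..2*pi} (\<lambda>t. cis t powi n)"
    by (rule borel_integrable_atLeastAtMost')
  then have "(LINT t:{0..2*pi}|lborel. cis t powi n) = integral {0..2*pi} (\<lambda>t. cis t powi n)"
    by (rule set_borel_integral_eq_integral)
  also have "\<dots> = 0" using hi by (rule integral_unique)
  finally show ?thesis
    using False by (simp add: integral_Tmeas[OF m] set_lebesgue_integral_def)
qed

section \<open>The Hilbert space of almost everywhere classes\<close>

lemma L2_iff: "f \<in> L2 \<longleftrightarrow> f \<in> borel_measurable Tmeas \<and> integrable Tmeas (\<lambda>z. (cmod (f z))\<^sup>2)"
  by (simp add: L2_def)

lemma L2_measurable [measurable_dest]: "f \<in> L2 \<Longrightarrow> f \<in> borel_measurable Tmeas"
  by (simp add: L2_iff)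

lemma L2_sq_integrable: "f \<in> L2 \<Longrightarrow> integrable Tmeas (\<lambda>z. (cmod (f z))\<^sup>2)"
  by (simp add: L2_iff)

lemma L2_prod_integrable:
  assumes "f \<in> L2" "g \<in> L2"
  shows "integrable Tmeas (\<lambda>z. f z * cnj (g z))"
proof (rule Bochner_Integration.integrable_bound)
  show "integrable Tmeas (\<lambda>z. (cmod (f z))\<^sup>2 + (cmod (g z))\<^sup>2)"
    using assms by (intro Bochner_Integration.integrable_add L2_sq_integrable)
  show "AE z in Tmeas. norm (f z * cnj (g z)) \<le> norm ((cmod (f z))\<^sup>2 + (cmod (g z))\<^sup>2)"
  proof (rule AE_I2)
    fix z
    have "2 * (cmod (f z) * cmod (g z)) \<le> (cmod (f z))\<^sup>2 + (cmod (g z))\<^sup>2"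
      using sum_squares_bound[of "cmod (f z)" "cmod (g z)"] by simp
    moreover have "0 \<le> cmod (f z) * cmod (g z)" by simp
    ultimately have "cmod (f z) * cmod (g z) \<le> (cmod (f z))\<^sup>2 + (cmod (g z))\<^sup>2" by linarith
    then show "norm (f z * cnj (g z)) \<le> norm ((cmod (f z))\<^sup>2 + (cmod (g z))\<^sup>2)"
      by (simp add: norm_mult)
  qed
  show "(\<lambda>z. f z * cnj (g z)) \<in> borel_measurable Tmeas"
    using assms[THEN L2_measurable] by measurable
qed

lemma L2_zero: "(\<lambda>z. 0) \<in> L2"
  by (simp add: L2_iff)

lemma L2_scale: "f \<in> L2 \<Longrightarrow> (\<lambda>z. c * f z) \<in> L2"
  unfolding L2_iff by (auto simp: norm_mult power_mult_distrib)

lemma L2_add: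
  assumes "f \<in> L2" "g \<in> L2"
  shows "(\<lambda>z. f z + g z) \<in> L2"
  unfolding L2_iff
proof (intro conjI, goal_cases)
  case 1
  show ?case using assms[THEN L2_measurable] by measurable
next
  case 2
  show ?case
  proof (rule Bochner_Integration.integrable_bound)
    show "integrable Tmeas (\<lambda>z. 2 * (cmod (f z))\<^sup>2 + 2 * (cmod (g z))\<^sup>2)"
      using assms by (intro Bochner_Integration.integrable_add integrable_mult_right L2_sq_integrable)
    show "AE z in Tmeas. norm ((cmod (f z + g z))\<^sup>2) \<le> norm (2 * (cmod (f z))\<^sup>2 + 2 * (cmod (g z))\<^sup>2)"
    proof (rule AE_I2)
      fix z
      have "(cmod (f z + g z))\<^sup>2 \<le> (cmod (f z) + cmod (g z))\<^sup>2"
        by (intro power_mono norm_triangle_ineq) auto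
      also have "\<dots> \<le> 2 * (cmod (f z))\<^sup>2 + 2 * (cmod (g z))\<^sup>2"
        using sum_squares_bound[of "cmod (f z)" "cmod (g z)"] by (simp add: power2_sum)
      finally show "norm ((cmod (f z + g z))\<^sup>2) \<le> norm (2 * (cmod (f z))\<^sup>2 + 2 * (cmod (g z))\<^sup>2)"
        by simp
    qed
    show "(\<lambda>z. (cmod (f z + g z))\<^sup>2) \<in> borel_measurable Tmeas"
      using assms[THEN L2_measurable] by measurable
  qed
qed

lemma L2_diff: "f \<in> L2 \<Longrightarrow> g \<in> L2 \<Longrightarrow> (\<lambda>z. f z - g z) \<in> L2"
  using L2_add[of f "\<lambda>z. -1 * g z"] L2_scale[of g "-1"] by simp

lemma L2_uminus: "f \<in> L2 \<Longrightarrow> (\<lambda>z. - f z) \<in> L2"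
  using L2_scale[of f "-1"] by simp

lemma l2ip_cong_AE:
  assumes "f \<in> L2" "g \<in> L2" "f' \<in> L2" "g' \<in> L2" "aeq f f'" "aeq g g'"
  shows "l2ip f g = l2ip f' g'"
  unfolding l2ip_def
proof (rule integral_cong_AE)
  note [measurable] = assms(1-4)[THEN L2_measurable]
  show "AE z in Tmeas. f z * cnj (g z) = f' z * cnj (g' z)"
    using assms(5,6) unfolding aeq_def by eventually_elim simp
  show "(\<lambda>z. f z * cnj (g z)) \<in> borel_measurable Tmeas" by measurable
  show "(\<lambda>z. f' z * cnj (g' z)) \<in> borel_measurable Tmeas" by measurable
qed

text \<open>Deliberately partial: a function outside \<open>L2\<close> is not even related to
  itself, so the quotient below has classes of \<open>L2\<close> functions only.\<close>

definition l2rel :: "cfun \<Rightarrow> cfun \<Rightarrow> bool" where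
  "l2rel f g \<longleftrightarrow> f \<in> L2 \<and> g \<in> L2 \<and> aeq f g"

quotient_type hil = cfun / partial: l2rel
  morphisms rep_hil cl
proof (rule part_equivpI)
  show "\<exists>x. l2rel x x" by (rule exI[of _ "\<lambda>z. 0"]) (auto simp: l2rel_def L2_zero aeq_def)
  show "symp l2rel" by (auto simp: symp_def l2rel_def aeq_def elim: AE_mp)
  show "transp l2rel"
  proof (rule transpI)
    fix f g h assume "l2rel f g" "l2rel g h"
    then show "l2rel f h" unfolding l2rel_def aeq_def by auto
  qed
qed

instantiation hil :: "{zero, plus, minus, uminus}"
begin
lift_definition zero_hil :: hil is "\<lambda>z. 0" by (simp add: l2rel_def L2_zero aeq_def)
lift_definition plus_hil :: "hil \<Rightarrow> hil \<Rightarrow> hil" is "\<lambda>f g z. f z + g z"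
  unfolding l2rel_def aeq_def by (auto intro: L2_add)
lift_definition minus_hil :: "hil \<Rightarrow> hil \<Rightarrow> hil" is "\<lambda>f g z. f z - g z"
  unfolding l2rel_def aeq_def by (auto intro: L2_diff)
lift_definition uminus_hil :: "hil \<Rightarrow> hil" is "\<lambda>f z. - f z"
  unfolding l2rel_def aeq_def by (auto intro: L2_uminus)
instance ..
end

lift_definition scaleC :: "complex \<Rightarrow> hil \<Rightarrow> hil" (infixr "*\<^sub>C" 75) is "\<lambda>c f z. c * f z"
  unfolding l2rel_def aeq_def by (auto intro: L2_scale)

lift_definition cip :: "hil \<Rightarrow> hil \<Rightarrow> complex" is l2ip
  unfolding l2rel_def by (blast intro: l2ip_cong_AE)

lemma l2ip_add_left: "f \<in> L2 \<Longrightarrow> g \<in> L2 \<Longrightarrow> h \<in> L2 \<Longrightarrow> l2ip (\<lambda>z. f z + g z) h = l2ip f h + l2ip g h"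
  unfolding l2ip_def
  by (simp add: distrib_right Bochner_Integration.integral_add L2_prod_integrable)

lemma l2ip_scale_left: "l2ip (\<lambda>z. c * f z) h = c * l2ip f h"
  unfolding l2ip_def by (simp add: mult.assoc)

lemma l2ip_commute: "l2ip f g = cnj (l2ip g f)"
  using Bochner_Integration.integral_cnj[of Tmeas "\<lambda>z. g z * cnj (f z)"] unfolding l2ip_def by (simp add: mult.commute)

lemma l2ip_self: "l2ip f f = of_real ((l2norm f)\<^sup>2)"
proof -
  have "0 \<le> (\<integral>z. (cmod (f z))\<^sup>2 \<partial>Tmeas)" by simp
  then show ?thesis
  unfolding l2ip_def l2norm_def
  by (simp add: complex_norm_square[symmetric] del: of_real_power)
qed

text \<open>The class \<open>real_inner\<close> is about real spaces, so norm and topology come from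
  the real part of \<open>cip\<close>. The complex structure is kept beside it in
  \<open>scaleC\<close> and \<open>cip\<close>.\<close>

instantiation hil :: real_inner
begin
definition scaleR_hil :: "real \<Rightarrow> hil \<Rightarrow> hil" where "scaleR_hil r x = complex_of_real r *\<^sub>C x"
definition inner_hil :: "hil \<Rightarrow> hil \<Rightarrow> real" where "inner_hil x y = Re (cip x y)"
definition norm_hil :: "hil \<Rightarrow> real" where "norm_hil x = sqrt (inner x x)"
definition dist_hil :: "hil \<Rightarrow> hil \<Rightarrow> real" where "dist_hil x y = norm (x - y)"
definition sgn_hil :: "hil \<Rightarrow> hil" where "sgn_hil x = scaleR (inverse (norm x)) x"
definition uniformity_hil :: "(hil \<times> hil) filter" where
  "uniformity_hil = (INF e\<in>{0 <..}. principal {(x, y). dist x y < e})"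
definition open_hil :: "hil set \<Rightarrow> bool" where
  "open_hil U = (\<forall>x\<in>U. \<forall>\<^sub>F (x', y) in uniformity. x' = x \<longrightarrow> y \<in> U)"
instance
proof
  fix x y z :: hil and a b :: real
  show "x + y + z = x + (y + z)" by transfer (simp add: l2rel_def aeq_def add.assoc L2_add)
  show "x + y = y + x" by transfer (simp add: l2rel_def aeq_def add.commute L2_add)
  show "0 + x = x" by transfer (simp add: l2rel_def aeq_def L2_add)
  show "- x + x = 0" by transfer (simp add: l2rel_def aeq_def L2_zero)
  show "x - y = x + - y" by transfer (simp add: l2rel_def aeq_def L2_diff)
  show "a *\<^sub>R (x + y) = a *\<^sub>R x + a *\<^sub>R y" unfolding scaleR_hil_def
    by transfer (simp add: l2rel_def aeq_def distrib_left distrib_right mult.assoc L2_scale L2_add)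
  show "(a + b) *\<^sub>R x = a *\<^sub>R x + b *\<^sub>R x" unfolding scaleR_hil_def
    by transfer (simp add: l2rel_def aeq_def distrib_left distrib_right mult.assoc L2_scale L2_add)
  show "a *\<^sub>R b *\<^sub>R x = (a * b) *\<^sub>R x" unfolding scaleR_hil_def
    by transfer (simp add: l2rel_def aeq_def mult.assoc[symmetric] L2_scale)
  show "1 *\<^sub>R x = x" unfolding scaleR_hil_def
    by transfer (simp add: l2rel_def aeq_def)
  show "inner x y = inner y x" unfolding inner_hil_def
    by transfer (metis complex_cnj_cnj complex.sel(1) l2ip_commute cnj.simps(1))
  show "inner (x + y) z = inner x z + inner y z" unfolding inner_hil_def
    by transfer (simp add: l2rel_def l2ip_add_left)
  show "inner (a *\<^sub>R x) y = a * inner x y" unfolding inner_hil_def scaleR_hil_def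
    by transfer (simp add: l2ip_scale_left)
  show "0 \<le> inner x x" unfolding inner_hil_def
    by transfer (simp add: l2ip_self del: of_real_power)
  show "inner x x = 0 \<longleftrightarrow> x = 0" unfolding inner_hil_def
  proof transfer
    fix x assume "l2rel x x"
    then have x: "x \<in> L2" by (simp add: l2rel_def)
    have "Re (l2ip x x) = (\<integral>z. (cmod (x z))\<^sup>2 \<partial>Tmeas)"
      by (simp add: l2ip_self l2norm_def del: of_real_power)
    also have "\<dots> = 0 \<longleftrightarrow> (AE z in Tmeas. (cmod (x z))\<^sup>2 = 0)"
      by (rule integral_nonneg_eq_0_iff_AE) (use L2_sq_integrable[OF x] in auto)
    finally show "(Re (l2ip x x) = 0) = l2rel x (\<lambda>z. 0)"
      using x by (simp add: l2rel_def L2_zero aeq_def)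
  qed
qed (simp_all add: dist_hil_def sgn_hil_def uniformity_hil_def open_hil_def norm_hil_def)
end

lemma rep_hil_L2 [simp]: "rep_hil x \<in> L2"
  using Quotient3_rep_reflp[OF Quotient3_hil, of x] by (simp add: l2rel_def)

lemma cl_rep [simp]: "cl (rep_hil x) = x"
  using Quotient3_abs_rep[OF Quotient3_hil] .

lemma cl_eq_iff: "f \<in> L2 \<Longrightarrow> g \<in> L2 \<Longrightarrow> cl f = cl g \<longleftrightarrow> aeq f g"
  using Quotient3_rel[OF Quotient3_hil, of f g] by (auto simp: l2rel_def aeq_def)

lemma l2rel_refl: "f \<in> L2 \<Longrightarrow> l2rel f f"
  by (simp add: l2rel_def aeq_def)

lemma cl_add: "f \<in> L2 \<Longrightarrow> g \<in> L2 \<Longrightarrow> cl (\<lambda>z. f z + g z) = cl f + cl g"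
  by (simp add: plus_hil.abs_eq l2rel_refl)
lemma cl_diff: "f \<in> L2 \<Longrightarrow> g \<in> L2 \<Longrightarrow> cl (\<lambda>z. f z - g z) = cl f - cl g"
  by (simp add: minus_hil.abs_eq l2rel_refl)
lemma cl_scale: "f \<in> L2 \<Longrightarrow> cl (\<lambda>z. c * f z) = c *\<^sub>C cl f"
  by (simp add: scaleC.abs_eq l2rel_refl)
lemma cip_cl: "f \<in> L2 \<Longrightarrow> g \<in> L2 \<Longrightarrow> cip (cl f) (cl g) = l2ip f g"
  by (simp add: cip.abs_eq l2rel_refl)
lemma norm_cl: "f \<in> L2 \<Longrightarrow> norm (cl f) = l2norm f"
proof -
  assume "f \<in> L2"
  moreover have "0 \<le> l2norm f" by (simp add: l2norm_def)
  ultimately show ?thesis by (simp add: norm_hil_def inner_hil_def cip_cl l2ip_self del: of_real_power)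
qed

lemma cip_commute: "cip x y = cnj (cip y x)"
  by transfer (rule l2ip_commute)
lemma cip_add_left: "cip (x + y) z = cip x z + cip y z"
  by transfer (simp add: l2rel_def l2ip_add_left)
lemma cip_scale_left [simp]: "cip (c *\<^sub>C x) y = c * cip x y"
  by transfer (simp add: l2ip_scale_left)
lemma cip_scale_right [simp]: "cip x (c *\<^sub>C y) = cnj c * cip x y"
  by (subst (1 2) cip_commute) simp
lemma cip_add_right: "cip x (y + z) = cip x y + cip x z"
  by (subst (1 2 3) cip_commute) (simp add: cip_add_left)
lemma cip_self: "cip x x = of_real ((norm x)\<^sup>2)"
  by (metis cip_cl cl_rep l2ip_self norm_cl rep_hil_L2)

lemma scaleC_right_distrib: "c *\<^sub>C (x + y) = c *\<^sub>C x + c *\<^sub>C y"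
  by transfer (simp add: l2rel_def aeq_def distrib_left distrib_right mult.assoc L2_scale L2_add)
lemma scaleC_left_distrib: "(c + d) *\<^sub>C x = c *\<^sub>C x + d *\<^sub>C x"
  by transfer (simp add: l2rel_def aeq_def distrib_left distrib_right mult.assoc L2_scale L2_add)
lemma scaleC_scaleC [simp]: "c *\<^sub>C d *\<^sub>C x = (c * d) *\<^sub>C x"
  by transfer (simp add: l2rel_def aeq_def mult.assoc[symmetric] L2_scale)
lemma scaleC_one [simp]: "1 *\<^sub>C x = x"
  by transfer (simp add: l2rel_def aeq_def)
lemma norm_scaleC [simp]: "norm (c *\<^sub>C x) = cmod c * norm x"
proof -
  have "complex_of_real ((norm (c *\<^sub>C x))\<^sup>2) = of_real ((cmod c * norm x)\<^sup>2)"
    using cip_self[of "c *\<^sub>C x"] cip_self[of x]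
    unfolding of_real_power of_real_mult power_mult_distrib complex_norm_square[symmetric, of c]
    using complex_norm_square[of c] by (simp add: mult_ac)
  then have "(norm (c *\<^sub>C x))\<^sup>2 = (cmod c * norm x)\<^sup>2" by (simp only: of_real_eq_iff)
  then show ?thesis by (rule power2_eq_imp_eq) auto
qed
lemma scaleC_zero_left [simp]: "0 *\<^sub>C x = 0"
  using scaleC_left_distrib[of 0 0 x] by simp
lemma scaleC_minus_one: "(-1) *\<^sub>C x = - x"
  using scaleC_left_distrib[of "-1" 1 x] by (simp add: eq_neg_iff_add_eq_0)
lemma scaleC_minus_left: "(- c) *\<^sub>C x = - (c *\<^sub>C x)"
  using scaleC_scaleC[of "-1" c x] by (simp add: scaleC_minus_one del: scaleC_scaleC)
lemma scaleC_of_real: "complex_of_real r *\<^sub>C x = r *\<^sub>R x"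
  by (simp add: scaleR_hil_def)
lemma bounded_linear_scaleC: "bounded_linear (\<lambda>x. c *\<^sub>C x)"
  by (rule bounded_linear_intro[of _ "cmod c"])
    (auto simp: scaleC_right_distrib scaleR_hil_def mult.commute)
lemmas scaleC_zero = linear_0[OF bounded_linear.linear[OF bounded_linear_scaleC]]
lemmas scaleC_diff = linear_diff[OF bounded_linear.linear[OF bounded_linear_scaleC]]
lemmas scaleC_minus = linear_neg[OF bounded_linear.linear[OF bounded_linear_scaleC]]
lemmas scaleC_sum = linear_sum[OF bounded_linear.linear[OF bounded_linear_scaleC]]
lemmas scaleC_tendsto = bounded_linear.tendsto[OF bounded_linear_scaleC]
lemma scaleC_diff_left: "(c - d) *\<^sub>C x = c *\<^sub>C x - d *\<^sub>C x"
  using scaleC_left_distrib[of c "-d" x] by (simp add: scaleC_minus_left)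

lemma cip_scaleR_left: "cip (r *\<^sub>R x) y = of_real r * cip x y"
  by (simp add: scaleR_hil_def)
lemma cip_scaleR_right: "cip x (r *\<^sub>R y) = of_real r * cip x y"
  by (simp add: scaleR_hil_def)

text \<open>Multiplying \<open>x\<close> by a unimodular \<open>u\<close> makes the product real and
  nonnegative; then the real Cauchy-Schwarz inequality applies.\<close>

lemma cip_cauchy: "cmod (cip x y) \<le> norm x * norm y"
proof (cases "cip x y = 0")
  case False
  define u where "u = cnj (sgn (cip x y))"
  have "u * cip x y = of_real (cmod (cip x y))"
    unfolding u_def sgn_eq
    using complex_norm_square[of "cip x y"] False
    by (simp add: field_simps power2_eq_square)
  then have "cmod (cip x y) = inner (u *\<^sub>C x) y"
    by (simp add: inner_hil_def)
  also have "\<dots> \<le> norm (u *\<^sub>C x) * norm y" by (rule norm_cauchy_schwarz)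
  also have "\<dots> = norm x * norm y" using False by (simp add: u_def norm_sgn)
  finally show ?thesis .
qed simp

lemma bounded_linear_cip_left: "bounded_linear (\<lambda>x. cip x y)"
  by (rule bounded_linear_intro[of _ "norm y"])
    (auto simp: cip_add_left cip_scaleR_left scaleR_conv_of_real cip_cauchy)
lemma bounded_linear_cip_right: "bounded_linear (\<lambda>y. cip x y)"
  by (rule bounded_linear_intro[of _ "norm x"])
    (auto simp: cip_add_right cip_scaleR_right scaleR_conv_of_real cip_cauchy mult.commute[of _ "norm x"])
lemmas cip_left_zero = linear_0[OF bounded_linear.linear[OF bounded_linear_cip_left]]
lemmas cip_left_diff = linear_diff[OF bounded_linear.linear[OF bounded_linear_cip_left]]
lemmas cip_left_sum = linear_sum[OF bounded_linear.linear[OF bounded_linear_cip_left]]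
lemmas cip_left_scaleR = linear_scale[OF bounded_linear.linear[OF bounded_linear_cip_left]]
lemmas cip_left_tendsto = bounded_linear.tendsto[OF bounded_linear_cip_left]
lemmas cip_right_zero = linear_0[OF bounded_linear.linear[OF bounded_linear_cip_right]]
lemmas cip_right_diff = linear_diff[OF bounded_linear.linear[OF bounded_linear_cip_right]]
lemmas cip_right_sum = linear_sum[OF bounded_linear.linear[OF bounded_linear_cip_right]]
lemmas cip_right_scaleR = linear_scale[OF bounded_linear.linear[OF bounded_linear_cip_right]]
lemmas cip_right_tendsto = bounded_linear.tendsto[OF bounded_linear_cip_right]
declare scaleC_zero [simp] cip_left_zero [simp] cip_right_zero [simp] cip_left_scaleR [simp] cip_right_scaleR [simp]

lemma pythagoras: "cip x y = 0 \<Longrightarrow> (norm (x + y))\<^sup>2 = (norm x)\<^sup>2 + (norm y)\<^sup>2"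
proof -
  assume "cip x y = 0"
  then have "inner x y = 0" by (simp add: inner_hil_def)
  then show ?thesis by (rule norm_add_Pythagorean[unfolded orthogonal_def])
qed

lemma cip_eq_0_imp: "(\<And>y. cip x y = 0) \<Longrightarrow> x = 0"
  by (metis cip_self norm_eq_zero of_real_eq_0_iff power_eq_0_iff)

lemma L2_cmod: "f \<in> L2 \<Longrightarrow> (\<lambda>z. complex_of_real (cmod (f z))) \<in> L2"
  unfolding L2_iff by auto

lemma L2_const: "(\<lambda>z. c) \<in> L2"
  unfolding L2_iff by auto

lemma l2norm_nonneg [simp]: "0 \<le> l2norm f"
  by (simp add: l2norm_def)

lemma L2_integrable_cmod: "f \<in> L2 \<Longrightarrow> integrable Tmeas (\<lambda>z. cmod (f z))"
  using L2_prod_integrable[OF L2_cmod L2_const[of 1], of f, THEN integrable_norm] by simp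

text \<open>Cauchy-Schwarz against the constant 1, which has norm 1 because arc length is
  normalized.\<close>

lemma L1_le_l2norm:
  assumes "f \<in> L2"
  shows "(\<integral>z. cmod (f z) \<partial>Tmeas) \<le> l2norm f"
proof -
  have "complex_of_real (\<integral>z. cmod (f z) \<partial>Tmeas) = l2ip (\<lambda>z. of_real (cmod (f z))) (\<lambda>z. 1)"
    by (simp add: l2ip_def)
  also have "\<dots> = cip (cl (\<lambda>z. of_real (cmod (f z)))) (cl (\<lambda>z. 1))"
    by (simp add: cip_cl L2_cmod L2_const assms)
  finally have "cmod (complex_of_real (\<integral>z. cmod (f z) \<partial>Tmeas))
      \<le> norm (cl (\<lambda>z. of_real (cmod (f z)))) * norm (cl (\<lambda>z. 1))"
    using cip_cauchy by metis
  also have "\<dots> = l2norm f * 1"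
    using Tm.prob_space by (simp add: norm_cl L2_cmod L2_const assms) (simp add: l2norm_def)
  finally show ?thesis by simp
qed

lemma l2norm_bound_nn:
  assumes "f \<in> borel_measurable Tmeas" "(\<integral>\<^sup>+z. ennreal ((cmod (f z))\<^sup>2) \<partial>Tmeas) \<le> ennreal (c\<^sup>2)" "0 \<le> c"
  shows "f \<in> L2" "l2norm f \<le> c"
proof -
  have i: "integrable Tmeas (\<lambda>z. (cmod (f z))\<^sup>2)"
  proof (rule integrableI_nonneg)
    show "(\<integral>\<^sup>+z. ennreal ((cmod (f z))\<^sup>2) \<partial>Tmeas) < \<infinity>"
      using assms(2) by (rule le_less_trans) simp
  qed (use assms(1) in auto)
  then show "f \<in> L2" using assms(1) by (simp add: L2_iff)
  have "(\<integral>z. (cmod (f z))\<^sup>2 \<partial>Tmeas) \<le> c\<^sup>2"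
    using assms(2) nn_integral_eq_integral[OF i] by simp
  then show "l2norm f \<le> c" unfolding l2norm_def using assms(3) by (simp add: real_le_lsqrt)
qed

lemma nn_integral_cmod_sq: "f \<in> L2 \<Longrightarrow> (\<integral>\<^sup>+z. ennreal ((cmod (f z))\<^sup>2) \<partial>Tmeas) = ennreal ((l2norm f)\<^sup>2)"
  by (simp add: nn_integral_eq_integral L2_sq_integrable l2norm_def)

text \<open>Riesz-Fischer. Along a subsequence with steps below \<open>(1/2)^n\<close> the sum of
  the steps has finite integral, so representatives converge almost everywhere; Fatou's lemma turns
  this into convergence in norm.\<close>

instance hil :: complete_space
proof
  fix X :: "nat \<Rightarrow> hil"
  assume X: "Cauchy X"
  obtain s where s: "\<And>n. (\<forall>m\<ge>s n. \<forall>m'\<ge>s n. dist (X m) (X m') < (1/2)^n) \<and> s n < s (Suc n)"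
  proof -
    have "\<exists>s. \<forall>n. (\<forall>m\<ge>s n. \<forall>m'\<ge>s n. dist (X m) (X m') < (1/2)^n) \<and> s n < s (Suc n)"
    proof (rule dependent_nat_choice)
      show "\<exists>x. \<forall>m\<ge>x. \<forall>m'\<ge>x. dist (X m) (X m') < (1/2)^0"
        using X unfolding Cauchy_def by (metis power_0 zero_less_one)
    next
      fix x n
      obtain M where M: "\<forall>m\<ge>M. \<forall>m'\<ge>M. dist (X m) (X m') < (1/2)^(Suc n)"
        using X unfolding Cauchy_def by (metis half_gt_zero_iff zero_less_power zero_less_one)
      show "\<exists>y. (\<forall>m\<ge>y. \<forall>m'\<ge>y. dist (X m) (X m') < (1/2)^(Suc n)) \<and> x < y"
        by (rule exI[of _ "max M (Suc x)"]) (use M in auto)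
    qed
    then show ?thesis using that by blast
  qed
  have sm: "strict_mono s" using s by (auto simp: strict_mono_Suc_iff)
  define f where "f k = rep_hil (X (s k))" for k
  have fL: "f k \<in> L2" for k by (simp add: f_def)
  note [measurable] = L2_measurable[OF fL]
  have clf: "cl (f k) = X (s k)" for k by (simp add: f_def)
  have df: "l2norm (\<lambda>z. f j z - f k z) \<le> (1/2)^k" if "k \<le> j" for j k
  proof -
    have "s k \<le> s j" using that sm by (simp add: strict_mono_less_eq)
    then have "dist (X (s j)) (X (s k)) < (1/2)^k" using s[of k] by auto
    then show ?thesis by (simp add: norm_cl[symmetric] L2_diff fL cl_diff clf dist_norm)
  qed
  have dL1: "(\<integral>\<^sup>+z. ennreal (cmod (f (Suc k) z - f k z)) \<partial>Tmeas) \<le> ennreal ((1/2)^k)" for k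
    using L1_le_l2norm[OF L2_diff[OF fL fL], of "Suc k" k] df[of k "Suc k"]
    by (subst nn_integral_eq_integral) (auto intro!: L2_integrable_cmod L2_diff fL)
  have "(\<integral>\<^sup>+z. (\<Sum>k. ennreal (cmod (f (Suc k) z - f k z))) \<partial>Tmeas)
      = (\<Sum>k. (\<integral>\<^sup>+z. ennreal (cmod (f (Suc k) z - f k z)) \<partial>Tmeas))"
    by (rule nn_integral_suminf) measurable
  also have "\<dots> \<le> (\<Sum>k. ennreal ((1/2)^k))"
    by (intro suminf_le dL1) auto
  also have "\<dots> = ennreal (\<Sum>k. (1/2)^k)"
    by (rule suminf_ennreal2) auto
  also have "\<dots> < \<infinity>" by simp
  finally have fin: "(\<integral>\<^sup>+z. (\<Sum>k. ennreal (cmod (f (Suc k) z - f k z))) \<partial>Tmeas) \<noteq> \<infinity>" by simp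
  have "AE z in Tmeas. (\<Sum>k. ennreal (cmod (f (Suc k) z - f k z))) \<noteq> \<infinity>"
    by (rule nn_integral_PInf_AE[OF _ fin]) measurable
  then have conv: "AE z in Tmeas. convergent (\<lambda>k. f k z)"
  proof eventually_elim
    case (elim z)
    then have "summable (\<lambda>k. cmod (f (Suc k) z - f k z))"
      by (intro summable_suminf_not_top) auto
    then have "summable (\<lambda>k. f (Suc k) z - f k z)" by (rule summable_norm_cancel)
    moreover have "(\<Sum>k<n. f (Suc k) z - f k z) = f n z - f 0 z" for n
      by (rule sum_lessThan_telescope)
    ultimately have "convergent (\<lambda>n. f n z - f 0 z)"
      by (simp add: summable_iff_convergent)
    then have "convergent (\<lambda>n. (f n z - f 0 z) + f 0 z)"
      by (intro convergent_add convergent_const)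
    then show ?case by simp
  qed
  define F where "F z = lim (\<lambda>k. f k z)" for z
  have [measurable]: "F \<in> borel_measurable Tmeas"
    unfolding F_def by (rule borel_measurable_lim_metric) measurable
  have key: "(\<integral>\<^sup>+z. ennreal ((cmod (F z - f k z))\<^sup>2) \<partial>Tmeas) \<le> ennreal (((1/2)^k)\<^sup>2)" for k
  proof -
    have "(\<integral>\<^sup>+z. ennreal ((cmod (F z - f k z))\<^sup>2) \<partial>Tmeas)
       = (\<integral>\<^sup>+z. liminf (\<lambda>j. ennreal ((cmod (f j z - f k z))\<^sup>2)) \<partial>Tmeas)"
    proof (rule nn_integral_cong_AE, use conv in eventually_elim)
      case (elim z)
      then have "(\<lambda>j. f j z) \<longlonglongrightarrow> F z" unfolding F_def by (simp add: convergent_LIMSEQ_iff)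
      then have "(\<lambda>j. ennreal ((cmod (f j z - f k z))\<^sup>2)) \<longlonglongrightarrow> ennreal ((cmod (F z - f k z))\<^sup>2)"
        by (intro tendsto_intros)
      from lim_imp_Liminf[OF sequentially_bot this] show ?case ..
    qed
    also have "\<dots> \<le> liminf (\<lambda>j. (\<integral>\<^sup>+z. ennreal ((cmod (f j z - f k z))\<^sup>2) \<partial>Tmeas))"
      by (rule nn_integral_liminf) measurable
    also have "\<dots> \<le> liminf (\<lambda>j::nat. ennreal (((1/2)^k)\<^sup>2))"
    proof (rule Liminf_mono, rule eventually_sequentiallyI[of k])
      fix j assume "k \<le> j"
      then show "(\<integral>\<^sup>+z. ennreal ((cmod (f j z - f k z))\<^sup>2) \<partial>Tmeas) \<le> ennreal (((1/2)^k)\<^sup>2)"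
        by (subst nn_integral_cmod_sq) (auto intro!: L2_diff fL ennreal_leI power_mono df)
    qed
    finally show ?thesis by (simp add: Liminf_const)
  qed
  have dF: "(\<lambda>z. F z - f k z) \<in> L2" "l2norm (\<lambda>z. F z - f k z) \<le> (1/2)^k" for k
    by (rule l2norm_bound_nn[OF _ key]; simp)+
  have FL: "F \<in> L2" using L2_add[OF dF(1)[of 0] fL[of 0]] by simp
  have "norm (X (s k) - cl F) \<le> (1/2)^k" for k
  proof -
    have "norm (X (s k) - cl F) = norm (cl F - cl (f k))" by (simp only: clf norm_minus_commute)
    also have "\<dots> = l2norm (\<lambda>z. F z - f k z)"
      by (simp only: cl_diff[OF FL fL, symmetric] norm_cl[OF dF(1)])
    finally show ?thesis using dF(2)[of k] by simp
  qed
  then have "(\<lambda>k. X (s k) - cl F) \<longlonglongrightarrow> 0"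
    by (rule Lim_null_comparison[OF always_eventually[OF allI] LIMSEQ_power_zero[of "1/2::real"]]) simp_all
  then have "(X \<circ> s) \<longlonglongrightarrow> cl F" by (simp add: LIM_zero_iff o_def)
  with X sm have "X \<longlonglongrightarrow> cl F" by (rule Cauchy_converges_subseq)
  then show "convergent X" by (auto simp: convergent_def)
qed

instance hil :: banach ..

section \<open>Multiplication by bounded symbols\<close>

text \<open>The bound is asked for at every point of the circle. This is available for continuous
  symbols by compactness and for \<open>blaschke lam\<close> because radial limits inherit the bound
  1 and the default value is 0.\<close>

definition bdd_sym :: "cfun \<Rightarrow> bool" where
  "bdd_sym a \<longleftrightarrow> a \<in> borel_measurable Tmeas \<and> (\<exists>C. \<forall>z. cmod z = 1 \<longrightarrow> cmod (a z) \<le> C)"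

lemma bmI: "a \<in> borel_measurable Tmeas \<Longrightarrow> (\<And>z. cmod z = 1 \<Longrightarrow> cmod (a z) \<le> C) \<Longrightarrow> bdd_sym a"
  unfolding bdd_sym_def by blast
lemma bdd_sym_measurable: "bdd_sym a \<Longrightarrow> a \<in> borel_measurable Tmeas" by (simp add: bdd_sym_def)

lemma bdd_sym_cont:
  assumes "continuous_on (sphere 0 1) a" shows "bdd_sym a"
proof -
  have "compact (a ` sphere 0 1)" by (rule compact_continuous_image[OF assms]) simp
  then obtain C where "\<forall>x\<in>a ` sphere 0 1. cmod x \<le> C"
    using compact_imp_bounded bounded_iff by metis
  then show ?thesis
    by (intro bmI[of a C] borel_measurable_Tmeas_cont assms) auto
qed

lemma bdd_sym_mult: "bdd_sym a \<Longrightarrow> bdd_sym b \<Longrightarrow> bdd_sym (\<lambda>z. a z * b z)"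
proof -
  assume a: "bdd_sym a" "bdd_sym b"
  then obtain C D where C: "\<And>z. cmod z = 1 \<Longrightarrow> cmod (a z) \<le> C" "\<And>z. cmod z = 1 \<Longrightarrow> cmod (b z) \<le> D"
    by (auto simp: bdd_sym_def)
  note [measurable] = a[THEN bdd_sym_measurable]
  show ?thesis
  proof (rule bmI[of _ "C * D"])
    fix z :: complex assume z: "cmod z = 1"
    then show "cmod (a z * b z) \<le> C * D"
      using C[OF z] unfolding norm_mult
      by (intro mult_mono) (auto intro: order_trans[OF norm_ge_zero])
  qed measurable
qed
lemma bdd_sym_cnj: "bdd_sym a \<Longrightarrow> bdd_sym (\<lambda>z. cnj (a z))"
  by (auto simp: bdd_sym_def)

lemma L2_bdd_sym_mult:
  assumes "bdd_sym a" "f \<in> L2" shows "(\<lambda>z. a z * f z) \<in> L2"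
proof -
  obtain C where C: "\<And>z. cmod z = 1 \<Longrightarrow> cmod (a z) \<le> C" using assms(1) by (auto simp: bdd_sym_def)
  note [measurable] = bdd_sym_measurable[OF assms(1)] L2_measurable[OF assms(2)]
  show ?thesis unfolding L2_iff
  proof (intro conjI, measurable, rule Bochner_Integration.integrable_bound)
    show "integrable Tmeas (\<lambda>z. C\<^sup>2 * (cmod (f z))\<^sup>2)" using L2_sq_integrable[OF assms(2)] by simp
    show "AE z in Tmeas. norm ((cmod (a z * f z))\<^sup>2) \<le> norm (C\<^sup>2 * (cmod (f z))\<^sup>2)"
      by (rule AE_I2) (auto simp: norm_mult power_mult_distrib intro!: mult_right_mono power_mono C)
  qed measurable
qed

text \<open>The value 0 for other symbols keeps the map well defined on classes and makes
  \<open>bounded_linear_mulop\<close> unconditional.\<close>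

lift_definition mulop :: "cfun \<Rightarrow> hil \<Rightarrow> hil" is "\<lambda>a f. if bdd_sym a then (\<lambda>z. a z * f z) else (\<lambda>z. 0)"
  unfolding l2rel_def aeq_def by (auto intro: L2_bdd_sym_mult L2_zero)

lemma mulop_cl: "bdd_sym a \<Longrightarrow> f \<in> L2 \<Longrightarrow> mulop a (cl f) = cl (\<lambda>z. a z * f z)"
  by (simp add: mulop.abs_eq l2rel_refl)

lemma cl_exhaust: obtains f where "x = cl f" "f \<in> L2"
  by (metis cl_rep rep_hil_L2)

lemma mulop_add: "mulop a (x + y) = mulop a x + mulop a y"
  by transfer (simp add: l2rel_def aeq_def distrib_left L2_bdd_sym_mult L2_add L2_zero)
lemma mulop_scaleC: "mulop a (c *\<^sub>C x) = c *\<^sub>C mulop a x"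
  by transfer (simp add: l2rel_def aeq_def mult.left_commute L2_bdd_sym_mult L2_scale L2_zero)
lemma mulop_mulop: "bdd_sym a \<Longrightarrow> bdd_sym b \<Longrightarrow> mulop a (mulop b x) = mulop (\<lambda>z. a z * b z) x"
  by transfer (simp add: l2rel_def aeq_def mult.assoc L2_bdd_sym_mult bdd_sym_mult)
lemma mulop_one: "mulop (\<lambda>z. 1) x = x"
  by (rule cl_exhaust[of x]) (simp add: mulop_cl bdd_sym_cont)
lemma mulop_cong:
  assumes "bdd_sym a" "bdd_sym b" "AE z in Tmeas. a z = b z"
  shows "mulop a x = mulop b x"
  using assms(3) by (rule_tac cl_exhaust[of x])
    (simp add: mulop_cl assms(1,2) cl_eq_iff L2_bdd_sym_mult aeq_def, elim AE_mp, auto)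
lemma mulop_cong':
  assumes "bdd_sym a" "\<And>z. cmod z = 1 \<Longrightarrow> a z = b z"
  shows "mulop a x = mulop b x"
proof (rule mulop_cong)
  show "bdd_sym b" using assms measurable_cong[of Tmeas a b borel] by (auto simp: bdd_sym_def)
  show "AE z in Tmeas. a z = b z" by (rule AE_I2) (auto intro: assms)
qed (rule assms)
lemma mulop_add_symbol: "bdd_sym a \<Longrightarrow> bdd_sym b \<Longrightarrow> bdd_sym (\<lambda>z. a z + b z) \<Longrightarrow> mulop (\<lambda>z. a z + b z) x = mulop a x + mulop b x"
  by transfer (simp add: l2rel_def aeq_def algebra_simps L2_bdd_sym_mult L2_add)
lemma mulop_scale_symbol: "bdd_sym a \<Longrightarrow> bdd_sym (\<lambda>z. c * a z) \<Longrightarrow> mulop (\<lambda>z. c * a z) x = c *\<^sub>C mulop a x"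
  by transfer (simp add: l2rel_def aeq_def algebra_simps L2_bdd_sym_mult L2_scale)

lemma l2norm_mult_le:
  assumes "f \<in> L2" "a \<in> borel_measurable Tmeas" "\<And>z. cmod z = 1 \<Longrightarrow> cmod (a z) \<le> C" "0 \<le> C"
  shows "l2norm (\<lambda>z. a z * f z) \<le> C * l2norm f"
proof (rule l2norm_bound_nn(2))
  note [measurable] = assms(2) L2_measurable[OF assms(1)]
  show "(\<lambda>z. a z * f z) \<in> borel_measurable Tmeas" by measurable
  have "(\<integral>\<^sup>+z. ennreal ((cmod (a z * f z))\<^sup>2) \<partial>Tmeas) \<le> (\<integral>\<^sup>+z. ennreal (C\<^sup>2) * ennreal ((cmod (f z))\<^sup>2) \<partial>Tmeas)"
    by (rule nn_integral_mono)
      (auto simp: norm_mult power_mult_distrib ennreal_mult[symmetric] intro!: ennreal_leI mult_right_mono power_mono assms)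
  also have "\<dots> = ennreal (C\<^sup>2) * ennreal ((l2norm f)\<^sup>2)"
    by (subst nn_integral_cmult) (simp_all add: nn_integral_cmod_sq assms(1))
  finally show "(\<integral>\<^sup>+z. ennreal ((cmod (a z * f z))\<^sup>2) \<partial>Tmeas) \<le> ennreal ((C * l2norm f)\<^sup>2)"
    by (simp add: ennreal_mult[symmetric] power_mult_distrib)
qed (simp add: assms)

lemma norm_mulop:
  assumes "\<And>z. cmod z = 1 \<Longrightarrow> cmod (a z) \<le> C"
  shows "norm (mulop a x) \<le> C * norm x"
proof -
  have C: "0 \<le> C" using assms[of 1] by (auto intro: order_trans[OF norm_ge_zero])
  show ?thesis
  proof (cases "bdd_sym a")
    case True
    show ?thesis by (rule cl_exhaust[of x])
      (use assms C True in \<open>simp add: mulop_cl norm_cl L2_bdd_sym_mult l2norm_mult_le bdd_sym_measurable\<close>)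
  next
    case False
    then have "mulop a x = 0" by transfer (simp add: l2rel_def L2_zero aeq_def)
    then show ?thesis using C by simp
  qed
qed

lemma bounded_linear_mulop: "bounded_linear (mulop a)"
proof (cases "bdd_sym a")
  case True
  then obtain C where "\<And>z. cmod z = 1 \<Longrightarrow> cmod (a z) \<le> C" by (auto simp: bdd_sym_def)
  from norm_mulop[of a, OF this] show ?thesis
    by (intro bounded_linear_intro[of _ C])
      (auto simp: mulop_add mulop_scaleC scaleR_hil_def mult.commute)
next
  case False
  then have "mulop a x = 0" for x by transfer (simp add: l2rel_def L2_zero aeq_def)
  then have "mulop a = (\<lambda>x. 0)" by (simp add: fun_eq_iff)
  then show ?thesis by simp
qed
lemmas mulop_zero = linear_0[OF bounded_linear.linear[OF bounded_linear_mulop]]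
lemmas mulop_diff = linear_diff[OF bounded_linear.linear[OF bounded_linear_mulop]]
lemmas mulop_tendsto = bounded_linear.tendsto[OF bounded_linear_mulop]
declare mulop_zero [simp]

lemma cip_mulop: "bdd_sym a \<Longrightarrow> cip (mulop a x) y = cip x (mulop (\<lambda>z. cnj (a z)) y)"
  by transfer (simp add: l2rel_def bdd_sym_cnj l2ip_def mult_ac)

section \<open>The Hardy space\<close>

definition zpow :: "int \<Rightarrow> hil" where "zpow n = cl (\<lambda>z. z powi n)"

definition Hardy :: "hil set" where "Hardy = {x. \<forall>n<0. cip x (zpow n) = 0}"

lemma L2_bdd_sym: "bdd_sym a \<Longrightarrow> a \<in> L2"
  using L2_bdd_sym_mult[OF _ L2_const[of 1], of a] by simp

lemma cont_powi: "continuous_on (sphere 0 1) (\<lambda>z::complex. z powi n)"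
  by (intro continuous_intros) auto

lemma bdd_sym_powi: "bdd_sym (\<lambda>z. z powi n)"
  by (intro bdd_sym_cont cont_powi)

lemma powi_L2: "(\<lambda>z. z powi n) \<in> L2"
  by (intro L2_bdd_sym bdd_sym_powi)

lemma bdd_sym_id: "bdd_sym (\<lambda>z. z)" by (intro bdd_sym_cont continuous_intros)
lemma bdd_sym_const: "bdd_sym (\<lambda>z. c)" by (intro bdd_sym_cont continuous_intros)

lemma cnj_circle: "cmod z = 1 \<Longrightarrow> cnj z = inverse z"
  by (metis complex_norm_square inverse_unique mult.commute of_real_1 power_one)

lemma cnj_mult_circle: "cmod z = 1 \<Longrightarrow> cnj z * z = 1" "cmod z = 1 \<Longrightarrow> z * cnj z = 1"
  by (simp_all add: complex_norm_square[symmetric] mult.commute[of "cnj z"])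

lemma mulop_powi_zpow: "mulop (\<lambda>z. z powi m) (zpow n) = zpow (m + n)"
  unfolding zpow_def mulop_cl[OF bdd_sym_powi powi_L2]
  by (subst cl_eq_iff) (auto simp: L2_bdd_sym_mult bdd_sym_powi powi_L2 aeq_def intro!: AE_I2 power_int_add[symmetric])

lemma cip_mulop_powi: "cip (mulop (\<lambda>z. z powi m) x) (zpow n) = cip x (zpow (n - m))"
proof -
  have "mulop (\<lambda>z. cnj (z powi m)) (zpow n) = mulop (\<lambda>z. z powi (-m)) (zpow n)"
    by (rule mulop_cong'[OF bdd_sym_cnj[OF bdd_sym_powi]])
      (simp add: cnj_circle power_int_minus power_int_inverse)
  then show ?thesis by (simp add: cip_mulop bdd_sym_powi mulop_powi_zpow)
qed

lemma cip_mulop_z: "cip (mulop (\<lambda>z. z) x) (zpow n) = cip x (zpow (n - 1))"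
  using cip_mulop_powi[of 1 x n] by simp

lemma cip_zpow: "cip (zpow m) (zpow n) = (if m = n then 1 else 0)"
proof -
  have "cip (zpow m) (zpow n) = (\<integral>z. z powi m * cnj (z powi n) \<partial>Tmeas)"
    by (simp add: zpow_def cip_cl powi_L2 l2ip_def)
  also have "\<dots> = (\<integral>z. z powi (m - n) \<partial>Tmeas)"
  proof (rule Bochner_Integration.integral_cong)
    fix z assume "z \<in> space Tmeas"
    then have "cmod z = 1" "z \<noteq> 0" by auto
    then show "z powi m * cnj (z powi n) = z powi (m - n)"
      by (simp add: cnj_circle power_int_diff power_int_inverse field_simps)
  qed simp
  also have "\<dots> = (if m = n then 1 else 0)" by (simp add: integral_powi_Tmeas)
  finally show ?thesis .
qed

lemma norm_zpow: "norm (zpow n) = 1"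
  using cip_self[of "zpow n"] by (simp add: cip_zpow) (metis norm_ge_zero of_real_eq_1_iff of_real_power power2_eq_1_iff abs_of_nonneg abs_1 abs_minus_cancel)

lemma Hardy_add: "x \<in> Hardy \<Longrightarrow> y \<in> Hardy \<Longrightarrow> x + y \<in> Hardy"
  by (simp add: Hardy_def cip_add_left)
lemma Hardy_scale: "x \<in> Hardy \<Longrightarrow> c *\<^sub>C x \<in> Hardy"
  by (simp add: Hardy_def)
lemma Hardy_diff: "x \<in> Hardy \<Longrightarrow> y \<in> Hardy \<Longrightarrow> x - y \<in> Hardy"
  by (simp add: Hardy_def cip_left_diff)
lemma Hardy_zero: "0 \<in> Hardy" by (simp add: Hardy_def)
lemma Hardy_closed: assumes "\<And>n. X n \<in> Hardy" "X \<longlonglongrightarrow> x" shows "x \<in> Hardy"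
proof -
  have "cip x (zpow n) = 0" if "n < 0" for n
  proof -
    have "(\<lambda>k. cip (X k) (zpow n)) \<longlonglongrightarrow> cip x (zpow n)" by (intro cip_left_tendsto assms)
    moreover have "cip (X k) (zpow n) = 0" for k using assms(1) that by (auto simp: Hardy_def)
    ultimately show ?thesis by (simp add: LIMSEQ_const_iff)
  qed
  then show ?thesis by (simp add: Hardy_def)
qed
lemma Hardy_zpow: "0 \<le> n \<Longrightarrow> zpow n \<in> Hardy"
  by (auto simp: Hardy_def cip_zpow)
lemma Hardy_z: "x \<in> Hardy \<Longrightarrow> mulop (\<lambda>z. z) x \<in> Hardy"
  by (simp add: Hardy_def cip_mulop_z)

section \<open>The Szego kernel\<close>

definition szego :: "complex \<Rightarrow> complex \<Rightarrow> complex" where "szego w z = 1 / (1 - cnj w * z)"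
definition kvec :: "complex \<Rightarrow> hil" where "kvec w = cl (szego w)"

lemma szego_denom: "cmod w < 1 \<Longrightarrow> cmod z \<le> 1 \<Longrightarrow> 1 - cnj w * z \<noteq> 0"
proof
  assume a: "cmod w < 1" "cmod z \<le> 1" "1 - cnj w * z = 0"
  then have "cmod w * cmod z = 1" by (metis complex_mod_cnj eq_iff_diff_eq_0 norm_mult norm_one)
  moreover have "cmod w * cmod z \<le> cmod w * 1" using a by (intro mult_left_mono) auto
  ultimately show False using a by simp
qed

lemma cont_szego: "cmod w < 1 \<Longrightarrow> continuous_on (cball 0 1) (szego w)"
  unfolding szego_def[abs_def] by (intro continuous_intros) (use szego_denom in auto)

lemma bdd_sym_szego: "cmod w < 1 \<Longrightarrow> bdd_sym (szego w)"
  by (intro bdd_sym_cont continuous_on_subset[OF cont_szego]) auto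

lemma szego_L2: "cmod w < 1 \<Longrightarrow> szego w \<in> L2" by (intro L2_bdd_sym bdd_sym_szego)

text \<open>Multiplication by \<open>szego w\<close> inverts multiplication by
  \<open>1 - cnj w * z\<close>. Later facts about the kernel come from this identity, without a
  power series.\<close>

lemma mulop_szego_cancel:
  assumes "cmod w < 1"
  shows "mulop (szego w) x - cnj w *\<^sub>C mulop (\<lambda>z. z) (mulop (szego w) x) = x"
proof -
  note bms = bdd_sym_mult bdd_sym_id bdd_sym_const bdd_sym_szego[OF assms]
  have "cnj w *\<^sub>C mulop (\<lambda>z. z) (mulop (szego w) x) = mulop (\<lambda>z. cnj w * (z * szego w z)) x"
    by (simp add: mulop_mulop mulop_scale_symbol bms)
  moreover have "mulop (szego w) x = mulop (\<lambda>z. 1 + cnj w * (z * szego w z)) x"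
    by (rule mulop_cong') (use szego_denom[OF assms] in \<open>auto simp: bms szego_def field_simps\<close>)
  moreover have "bdd_sym (\<lambda>z. 1 + cnj w * (z * szego w z))"
    by (intro bdd_sym_cont continuous_intros continuous_on_subset[OF cont_szego[OF assms]]) auto
  then have "mulop (\<lambda>z. 1 + cnj w * (z * szego w z)) x = x + mulop (\<lambda>z. cnj w * (z * szego w z)) x"
    by (subst mulop_add_symbol) (auto simp: bms mulop_one)
  ultimately show ?thesis by simp
qed

text \<open>The cancellation identity makes each coefficient of negative index \<open>cnj w\<close>
  times the preceding one. Iterating \<open>m\<close> times bounds it by
  \<open>cmod w ^ m * norm y\<close>, which tends to 0.\<close>

lemma Hardy_szego:
  assumes w: "cmod w < 1" and x: "x \<in> Hardy"
  shows "mulop (szego w) x \<in> Hardy"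
proof -
  define y where "y = mulop (szego w) x"
  have rec: "cip y (zpow n) = cnj w * cip y (zpow (n - 1))" if "n < 0" for n
  proof -
    have "cip x (zpow n) = cip y (zpow n) - cnj w * cip y (zpow (n - 1))"
      using mulop_szego_cancel[OF w, of x] unfolding y_def
      by (metis cip_left_diff cip_scale_left cip_mulop_z)
    then show ?thesis using x that by (simp add: Hardy_def)
  qed
  have "cip y (zpow n) = 0" if "n < 0" for n
  proof -
    have "cip y (zpow n) = cnj w ^ m * cip y (zpow (n - int m))" for m
    proof (induction m)
      case (Suc m)
      then show ?case using rec[of "n - int m"] that by (simp add: algebra_simps)
    qed simp
    then have le: "cmod (cip y (zpow n)) \<le> cmod w ^ m * norm y" for m
      using cip_cauchy[of y "zpow (n - int m)"] norm_zpow
      by (metis complex_mod_cnj mult.right_neutral mult_left_mono norm_ge_zero norm_mult norm_power zero_le_power)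
    have "(\<lambda>m. cmod w ^ m * norm y) \<longlonglongrightarrow> 0"
      using w by (intro tendsto_mult_left_zero LIMSEQ_power_zero) auto
    then have "cmod (cip y (zpow n)) \<le> 0"
      by (rule LIMSEQ_le_const) (use le in auto)
    then show ?thesis by simp
  qed
  then show ?thesis by (simp add: Hardy_def y_def)
qed

lemma kvec_Hardy: "cmod w < 1 \<Longrightarrow> kvec w \<in> Hardy"
  using Hardy_szego[of w "zpow 0"] Hardy_zpow[of 0]
  by (simp add: zpow_def kvec_def mulop_cl bdd_sym_szego L2_const)

lemma kvec_eq: "cmod w < 1 \<Longrightarrow> kvec w = zpow 0 + cnj w *\<^sub>C mulop (\<lambda>z. z) (kvec w)"
  using mulop_szego_cancel[of w "zpow 0"]
  by (simp add: zpow_def kvec_def mulop_cl bdd_sym_szego L2_const algebra_simps)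

lemma cip_mulop_isometry:
  assumes "bdd_sym a" "\<And>z. cmod z = 1 \<Longrightarrow> cmod (a z) = 1"
  shows "cip (mulop a x) (mulop a y) = cip x y"
proof -
  have "mulop (\<lambda>z. cnj (a z) * a z) y = mulop (\<lambda>z. 1) y"
    by (rule mulop_cong') (auto simp: assms bdd_sym_mult bdd_sym_cnj cnj_mult_circle)
  then show ?thesis by (simp add: cip_mulop assms mulop_mulop bdd_sym_cnj mulop_one)
qed

text \<open>Pairing with the kernel is evaluation at the point of the disc.\<close>

lemma kvec_z:
  assumes "cmod w < 1" "y \<in> Hardy"
  shows "cip (mulop (\<lambda>z. z) y) (kvec w) = w * cip y (kvec w)"
proof -
  have "cip (mulop (\<lambda>z. z) y) (zpow 0) = 0" using assms by (simp add: cip_mulop_z Hardy_def)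
  moreover have "cip (mulop (\<lambda>z. z) y) (mulop (\<lambda>z. z) (kvec w)) = cip y (kvec w)"
    by (rule cip_mulop_isometry) (auto simp: bdd_sym_id)
  ultimately show ?thesis
    by (subst kvec_eq[OF assms(1)]) (simp add: cip_add_right)
qed

section \<open>Blaschke factors\<close>

text \<open>At \<open>l = 0\<close> the expression \<open>(l - z) * szego l z\<close> equals
  \<open>- z\<close>; the constant -1 restores the convention that this factor is
  \<open>z\<close>.\<close>

definition bfac_const :: "complex \<Rightarrow> complex" where "bfac_const l = (if l = 0 then -1 else of_real (cmod l) / l)"

lemma bfac_eq: "bfac l z = bfac_const l * ((l - z) * szego l z)"
  by (simp add: bfac_def bfac_const_def szego_def mult_ac)

lemma cmod_bfac_const: "cmod (bfac_const l) = 1"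
  by (simp add: bfac_const_def norm_divide)

lemma cont_bfac: "cmod l < 1 \<Longrightarrow> continuous_on (cball 0 1) (bfac l)"
  unfolding bfac_eq[abs_def] by (intro continuous_intros cont_szego)

lemma bdd_sym_bfac: "cmod l < 1 \<Longrightarrow> bdd_sym (bfac l)"
  by (intro bdd_sym_cont continuous_on_subset[OF cont_bfac]) auto

lemma cmod_bfac:
  assumes "cmod l < 1" "cmod z = 1"
  shows "cmod (bfac l z) = 1"
proof -
  have "1 - cnj l * z = z * cnj (z - l)"
    using cnj_mult_circle(2)[OF assms(2)] by (simp add: algebra_simps)
  then have "cmod (1 - cnj l * z) = cmod (l - z)"
    using assms(2) by (metis complex_mod_cnj mult_1 norm_minus_commute norm_mult)
  moreover have "cmod (1 - cnj l * z) \<noteq> 0" using assms szego_denom[of l z] by simp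
  ultimately show ?thesis by (simp add: bfac_eq cmod_bfac_const szego_def norm_mult norm_divide)
qed

lemma mulop_bfac:
  assumes l: "cmod l < 1"
  shows "mulop (bfac l) x = bfac_const l *\<^sub>C (l *\<^sub>C mulop (szego l) x - mulop (\<lambda>z. z) (mulop (szego l) x))"
proof -
  note bms = bdd_sym_mult bdd_sym_id bdd_sym_const bdd_sym_szego[OF l]
  have b: "bdd_sym (\<lambda>z. l * szego l z + (-1) * (z * szego l z))"
    by (intro bdd_sym_cont continuous_intros continuous_on_subset[OF cont_szego[OF l]]) auto
  have "mulop (bfac l) x = mulop (\<lambda>z. bfac_const l * (l * szego l z + (-1) * (z * szego l z))) x"
    by (rule mulop_cong'[OF bdd_sym_bfac[OF l]]) (simp add: bfac_eq algebra_simps)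
  also have "\<dots> = bfac_const l *\<^sub>C mulop (\<lambda>z. l * szego l z + (-1) * (z * szego l z)) x"
    by (rule mulop_scale_symbol[OF b bdd_sym_mult[OF bdd_sym_const b]])
  also have "mulop (\<lambda>z. l * szego l z + (-1) * (z * szego l z)) x
    = mulop (\<lambda>z. l * szego l z) x + mulop (\<lambda>z. (-1) * (z * szego l z)) x"
    by (rule mulop_add_symbol[OF _ _ b]) (intro bms)+
  also have "mulop (\<lambda>z. l * szego l z) x = l *\<^sub>C mulop (szego l) x"
    by (rule mulop_scale_symbol) (intro bms)+
  also have "mulop (\<lambda>z. (-1) * (z * szego l z)) x = (-1) *\<^sub>C mulop (\<lambda>z. z * szego l z) x"
    by (rule mulop_scale_symbol) (intro bms)+
  also have "mulop (\<lambda>z. z * szego l z) x = mulop (\<lambda>z. z) (mulop (szego l) x)"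
    by (rule mulop_mulop[symmetric]) (intro bms)+
  finally show ?thesis by (simp only: scaleC_minus_one) simp
qed

lemma Hardy_bfac: "cmod l < 1 \<Longrightarrow> x \<in> Hardy \<Longrightarrow> mulop (bfac l) x \<in> Hardy"
  unfolding mulop_bfac by (intro Hardy_scale Hardy_diff Hardy_z Hardy_szego)

lemma kvec_bfac_zero: "cmod l < 1 \<Longrightarrow> x \<in> Hardy \<Longrightarrow> cip (mulop (bfac l) x) (kvec l) = 0"
  by (simp add: mulop_bfac cip_left_diff kvec_z Hardy_szego)

lemma mulop_bfac_cnj: "cmod l < 1 \<Longrightarrow> mulop (bfac l) (mulop (\<lambda>z. cnj (bfac l z)) x) = x"
proof -
  assume l: "cmod l < 1"
  have "mulop (\<lambda>z. bfac l z * cnj (bfac l z)) x = mulop (\<lambda>z. 1) x"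
    by (rule mulop_cong') (auto simp: l bdd_sym_bfac bdd_sym_mult bdd_sym_cnj cnj_mult_circle cmod_bfac)
  then show ?thesis by (simp add: l mulop_mulop bdd_sym_bfac bdd_sym_cnj mulop_one)
qed

text \<open>Division of a Hardy function by a Blaschke factor at one of its zeros: on the circle
  \<open>cnj (bfac l z)\<close> is the inverse of \<open>bfac l z\<close>. The coefficients of
  negative index satisfy a recursion whose initial value is 0.\<close>

lemma zero_removal:
  assumes l: "cmod l < 1" and x: "x \<in> Hardy" and z: "cip x (kvec l) = 0"
  shows "mulop (\<lambda>z. cnj (bfac l z)) x \<in> Hardy"
proof -
  define g where "g = mulop (\<lambda>z. cnj (bfac l z)) x"
  have bb: "bdd_sym (\<lambda>z. cnj (bfac l z))" by (intro bdd_sym_cnj bdd_sym_bfac l)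
  \<comment> \<open>On the circle \<open>(z - l) * cnj (bfac l z)\<close> is a constant times
    \<open>cnj l * z - 1\<close>, so \<open>(z - l) * g\<close> lies in \<open>Hardy\<close>; its
    vanishing coefficients are the recursion.\<close>
  have rec: "cip g (zpow (n - 1)) = l * cip g (zpow n)" if n: "n < 0" for n
  proof -
    have b2: "bdd_sym (\<lambda>z. z * cnj (bfac l z) + (- l) * cnj (bfac l z))"
      by (intro bdd_sym_cont continuous_intros continuous_on_subset[OF cont_bfac[OF l]]) auto
    have b3: "bdd_sym (\<lambda>z. cnj l * z + (-1))"
      by (intro bdd_sym_cont continuous_intros)
    have "mulop (\<lambda>z. z) g + (- l) *\<^sub>C g = mulop (\<lambda>z. z * cnj (bfac l z) + (- l) * cnj (bfac l z)) x"
      unfolding g_def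
      by (subst mulop_add_symbol[OF _ _ b2])
         (auto simp only: mulop_mulop[OF bdd_sym_id bb] mulop_scale_symbol[OF bb bdd_sym_mult[OF bdd_sym_const bb]] intro!: bdd_sym_mult bdd_sym_id bdd_sym_const bb)
    also have "\<dots> = mulop (\<lambda>z. cnj (bfac_const l) * (cnj l * z + (-1))) x"
    proof (rule mulop_cong'[OF b2])
      fix z :: complex assume z1: "cmod z = 1"
      have zc: "z * cnj z = 1" using cnj_mult_circle(2)[OF z1] .
      have nz: "1 - l * cnj z \<noteq> 0"
        using szego_denom[of l z] l z1 by (metis complex_cnj_cnj complex_cnj_diff complex_cnj_mult complex_cnj_one complex_cnj_zero order_refl)
      have "z - l = z * (1 - l * cnj z)" using zc by (simp add: algebra_simps)
      then have "z * cnj (bfac l z) + (- l) * cnj (bfac l z) = z * (1 - l * cnj z) * cnj (bfac l z)"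
        by (metis add_uminus_conv_diff left_diff_distrib mult_minus_left)
      also have "\<dots> = cnj (bfac_const l) * (z * (cnj l - cnj z))"
        using nz by (simp add: bfac_eq szego_def)
      also have "z * (cnj l - cnj z) = cnj l * z + (-1)" using zc by (simp add: algebra_simps)
      finally show "z * cnj (bfac l z) + (- l) * cnj (bfac l z) = cnj (bfac_const l) * (cnj l * z + (-1))" .
    qed
    also have "\<dots> = cnj (bfac_const l) *\<^sub>C (mulop (\<lambda>z. cnj l * z) x + mulop (\<lambda>z. -1) x)"
      by (subst mulop_scale_symbol[OF b3 bdd_sym_mult[OF bdd_sym_const b3]], subst mulop_add_symbol[OF _ _ b3])
        (auto intro!: bdd_sym_mult bdd_sym_id bdd_sym_const)
    also have "mulop (\<lambda>z. -1) x = (-1) *\<^sub>C x"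
      using mulop_scale_symbol[OF bdd_sym_const[of 1] bdd_sym_const, of "-1" x] by (simp add: mulop_one)
    also have "mulop (\<lambda>z. cnj l * z) x = cnj l *\<^sub>C mulop (\<lambda>z. z) x"
      by (rule mulop_scale_symbol) (intro bdd_sym_id bdd_sym_mult bdd_sym_const)+
    finally have "mulop (\<lambda>z. z) g + (- l) *\<^sub>C g \<in> Hardy"
      using x by (simp only:) (intro Hardy_scale Hardy_add Hardy_z)
    then have "cip (mulop (\<lambda>z. z) g + (- l) *\<^sub>C g) (zpow n) = 0" using n by (simp add: Hardy_def)
    then show ?thesis by (simp add: cip_add_left cip_mulop_z del: scaleC_minus)
  qed
  \<comment> \<open>\<open>bfac l z * z powi (-1)\<close> is a combination of
    \<open>z powi (-1)\<close> and the kernel at \<open>l\<close>, and \<open>x\<close> is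
    orthogonal to both; here the zero at \<open>l\<close> is used.\<close>
  have base: "cip g (zpow (-1)) = 0"
  proof -
    have "mulop (bfac l) (zpow (-1)) = cl (\<lambda>z. bfac l z * z powi (-1))"
      by (simp add: zpow_def mulop_cl bdd_sym_bfac l powi_L2 del: power_int_minus1_right)
    also have "\<dots> = cl (\<lambda>z. bfac_const l * (l * z powi (-1) + (l * cnj l - 1) * szego l z))"
    proof (subst cl_eq_iff)
      show "aeq (\<lambda>z. bfac l z * z powi (-1)) (\<lambda>z. bfac_const l * (l * z powi (-1) + (l * cnj l - 1) * szego l z))"
        unfolding aeq_def
      proof (rule AE_I2)
        fix z assume "z \<in> space Tmeas"
        then have "cmod z = 1" "z \<noteq> 0" by auto
        then show "bfac l z * z powi (-1) = bfac_const l * (l * z powi (-1) + (l * cnj l - 1) * szego l z)"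
          using szego_denom[OF l, of z] by (simp add: bfac_eq szego_def field_simps)
      qed
    qed (auto intro!: L2_bdd_sym_mult bdd_sym_bfac l powi_L2 L2_scale L2_add szego_L2 simp del: power_int_minus1_right)
    also have "\<dots> = bfac_const l *\<^sub>C (l *\<^sub>C zpow (-1) + (l * cnj l - 1) *\<^sub>C kvec l)"
      unfolding zpow_def kvec_def
      by (simp add: cl_scale cl_add L2_scale L2_add szego_L2 l powi_L2 del: power_int_minus1_right)
    finally have "mulop (bfac l) (zpow (-1)) = bfac_const l *\<^sub>C (l *\<^sub>C zpow (-1) + (l * cnj l - 1) *\<^sub>C kvec l)" .
    moreover have "cip x (zpow (-1)) = 0" using x by (simp add: Hardy_def)
    moreover have "cip g (zpow (-1)) = cip x (mulop (bfac l) (zpow (-1)))"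
      unfolding g_def by (simp add: cip_mulop bb)
    ultimately show ?thesis using z by (simp add: cip_add_right)
  qed
  have "cip g (zpow (- 1 - int m)) = 0" for m
  proof (induction m)
    case 0 then show ?case using base by simp
  next
    case (Suc m) then show ?case using rec[of "- 1 - int m"] by (simp add: algebra_simps)
  qed
  moreover have "\<exists>m. n = - 1 - int m" if "n < 0" for n
    using that by (intro exI[of _ "nat (- 1 - n)"]) auto
  ultimately have "\<forall>n<0. cip g (zpow n) = 0" by metis
  then show ?thesis by (simp add: Hardy_def g_def)
qed

section \<open>Compact operators and orthonormal sequences\<close>

text \<open>Bounded linear functions are linear over the reals only, so complex homogeneity has to
  be recorded separately.\<close>

definition clin :: "(hil \<Rightarrow>\<^sub>L hil) \<Rightarrow> bool" where
  "clin X \<longleftrightarrow> (\<forall>c x. X (c *\<^sub>C x) = c *\<^sub>C X x)"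

lemma clinD: "clin X \<Longrightarrow> blinfun_apply X (c *\<^sub>C x) = c *\<^sub>C X x" by (simp add: clin_def)
lemma clin_add: "clin X \<Longrightarrow> clin Y \<Longrightarrow> clin (X + Y)"
  by (simp add: clin_def blinfun.add_left scaleC_right_distrib)
lemma clin_compose: "clin X \<Longrightarrow> clin Y \<Longrightarrow> clin (X o\<^sub>L Y)"
  by (simp add: clin_def)
lemma clin_zero: "clin 0" by (simp add: clin_def)

lemma clin_limit:
  assumes "\<And>n. clin (X n)" "X \<longlonglongrightarrow> Y" shows "clin Y"
  unfolding clin_def
proof (intro allI)
  fix c x
  have l: "(\<lambda>n. X n y) \<longlonglongrightarrow> Y y" for y
    using assms(2) by (intro blinfun.tendsto tendsto_const)
  have "(\<lambda>n. X n (c *\<^sub>C x)) \<longlonglongrightarrow> c *\<^sub>C Y x"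
    using assms(1) by (simp add: clinD scaleC_tendsto l)
  then show "Y (c *\<^sub>C x) = c *\<^sub>C Y x" using l LIMSEQ_unique by blast
qed

definition cmul :: "complex \<Rightarrow> (hil \<Rightarrow>\<^sub>L hil) \<Rightarrow> (hil \<Rightarrow>\<^sub>L hil)" where
  "cmul c X = Blinfun (\<lambda>x. c *\<^sub>C X x)"

lemma cmul_apply [simp]: "cmul c X x = c *\<^sub>C X x"
  unfolding cmul_def
  by (subst bounded_linear_Blinfun_apply)
    (simp_all add: bounded_linear_compose[OF bounded_linear_scaleC] blinfun.bounded_linear_right)
lemma clin_cmul: "clin X \<Longrightarrow> clin (cmul c X)" by (simp add: clin_def mult.commute)
lemma norm_cmul: "norm (cmul c X) \<le> cmod c * norm X"
  by (rule norm_blinfun_bound) (auto simp: mult.assoc intro!: mult_left_mono norm_blinfun)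

definition rk1 :: "hil \<Rightarrow> hil \<Rightarrow> (hil \<Rightarrow>\<^sub>L hil)" where
  "rk1 a b = Blinfun (\<lambda>x. cip x b *\<^sub>C a)"

lemma rk1_apply [simp]: "rk1 a b x = cip x b *\<^sub>C a"
proof -
  have "bounded_linear (\<lambda>x. cip x b *\<^sub>C a)"
    by (rule bounded_linear_intro[of _ "norm b * norm a"])
      (auto simp: cip_add_left scaleC_left_distrib scaleR_hil_def mult.assoc[symmetric] intro!: mult_right_mono cip_cauchy)
  then show ?thesis by (simp add: rk1_def bounded_linear_Blinfun_apply)
qed
lemma clin_rk1: "clin (rk1 a b)" by (simp add: clin_def)
lemma norm_rk1: "norm (rk1 a b) \<le> norm a * norm b"
proof (rule norm_blinfun_bound)
  fix x
  have "cmod (cip x b) * norm a \<le> (norm x * norm b) * norm a" by (intro mult_right_mono cip_cauchy) simp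
  then show "norm (rk1 a b x) \<le> norm a * norm b * norm x" by (simp add: mult_ac)
qed simp

definition cpt :: "(hil \<Rightarrow>\<^sub>L hil) \<Rightarrow> bool" where
  "cpt X \<longleftrightarrow> (\<forall>x::nat \<Rightarrow> hil. (\<forall>k. norm (x k) \<le> 1) \<longrightarrow> (\<exists>\<sigma>. strict_mono \<sigma> \<and> convergent (\<lambda>k. X (x (\<sigma> k)))))"

lemma cptD:
  assumes "cpt X" "\<And>k. norm (x k) \<le> C"
  obtains \<sigma> where "strict_mono (\<sigma>::nat\<Rightarrow>nat)" "convergent (\<lambda>k. X (x (\<sigma> k)))"
proof -
  define D where "D = max C 1"
  have D: "norm (x k) \<le> D" "D > 0" for k using assms(2)[of k] by (auto simp: D_def)
  have "norm ((1/D) *\<^sub>R x k) \<le> 1" for k using D(1)[of k] D(2) by (simp add: field_simps)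
  then obtain \<sigma> where s: "strict_mono \<sigma>" "convergent (\<lambda>k. X ((1/D) *\<^sub>R x (\<sigma> k)))"
    using assms(1) unfolding cpt_def by meson
  then obtain l where "(\<lambda>k. X ((1/D) *\<^sub>R x (\<sigma> k))) \<longlonglongrightarrow> l" by (auto simp: convergent_def)
  then have "(\<lambda>k. D *\<^sub>R X ((1/D) *\<^sub>R x (\<sigma> k))) \<longlonglongrightarrow> D *\<^sub>R l" by (intro tendsto_intros)
  then have "convergent (\<lambda>k. X (x (\<sigma> k)))" using D by (auto simp: blinfun.scaleR_right convergent_def)
  with s that show ?thesis by blast
qed

lemma cpt_compose_left: "cpt X \<Longrightarrow> cpt (T o\<^sub>L X)"
  unfolding cpt_def convergent_def
  by simp (metis blinfun.tendsto[OF tendsto_const])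

lemma cpt_compose_right:
  assumes "cpt X" shows "cpt (X o\<^sub>L T)"
  unfolding cpt_def
proof (intro allI impI)
  fix x :: "nat \<Rightarrow> hil" assume x: "\<forall>k. norm (x k) \<le> 1"
  have b: "norm (T (x k)) \<le> norm T" for k
    using norm_blinfun[of T "x k"] x[rule_format, of k] by (meson mult_left_le norm_ge_zero order_trans)
  show "\<exists>\<sigma>. strict_mono \<sigma> \<and> convergent (\<lambda>k. (X o\<^sub>L T) (x (\<sigma> k)))"
    by (rule cptD[OF assms b]) auto
qed

lemma cpt_add:
  assumes "cpt X" "cpt Y" shows "cpt (X + Y)"
  unfolding cpt_def
proof (intro allI impI)
  fix x :: "nat \<Rightarrow> hil" assume x: "\<forall>k. norm (x k) \<le> 1"
  obtain \<sigma> where s: "strict_mono \<sigma>" "convergent (\<lambda>k. X (x (\<sigma> k)))"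
    using cptD[OF assms(1), of x 1] x by blast
  obtain \<tau> where t: "strict_mono \<tau>" "convergent (\<lambda>k. Y (x (\<sigma> (\<tau> k))))"
    using cptD[OF assms(2), of "\<lambda>k. x (\<sigma> k)" 1] x by blast
  have "convergent (\<lambda>k. X (x (\<sigma> (\<tau> k))))"
    using convergent_subseq_convergent[OF s(2) t(1)] by (simp add: o_def)
  then show "\<exists>\<sigma>. strict_mono \<sigma> \<and> convergent (\<lambda>k. (X + Y) (x (\<sigma> k)))"
    using s(1) t by (intro exI[of _ "\<sigma> \<circ> \<tau>"])
      (auto simp: strict_mono_o blinfun.add_left intro!: convergent_add)
qed

lemma cpt_cmul: "cpt X \<Longrightarrow> cpt (cmul c X)"
proof -
  assume "cpt X"
  moreover have "cmul c X = Blinfun (\<lambda>x. c *\<^sub>C x) o\<^sub>L X"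
    by (rule blinfun_eqI) (simp add: bounded_linear_Blinfun_apply bounded_linear_scaleC)
  ultimately show ?thesis using cpt_compose_left by metis
qed

lemma cpt_rk1: "cpt (rk1 a b)"
  unfolding cpt_def
proof (intro allI impI)
  fix x :: "nat \<Rightarrow> hil" assume x: "\<forall>k. norm (x k) \<le> 1"
  have "cmod (cip (x k) b) \<le> norm b" for k
    using cip_cauchy[of "x k" b] x[rule_format, of k] by (meson mult_left_le_one_le norm_ge_zero order_trans)
  then have "bounded (range (\<lambda>k. cip (x k) b))" by (auto simp: bounded_iff)
  then obtain l \<sigma> where s: "strict_mono \<sigma>" "((\<lambda>k. cip (x k) b) \<circ> \<sigma>) \<longlonglongrightarrow> l"
    using bounded_imp_convergent_subsequence by blast
  have bl: "bounded_linear (\<lambda>c. c *\<^sub>C a)"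
    by (rule bounded_linear_intro[of _ "norm a"])
      (auto simp: scaleC_left_distrib scaleR_hil_def scaleR_conv_of_real)
  have "(\<lambda>k. cip (x (\<sigma> k)) b *\<^sub>C a) \<longlonglongrightarrow> l *\<^sub>C a"
    using bounded_linear.tendsto[OF bl s(2)] by (simp add: o_def)
  then show "\<exists>\<sigma>. strict_mono \<sigma> \<and> convergent (\<lambda>k. (rk1 a b) (x (\<sigma> k)))"
    using s(1) by (auto simp: convergent_def)
qed

lemma cpt_zero: "cpt 0"
  unfolding cpt_def by (auto intro!: exI[of _ id] simp: convergent_const strict_mono_id)

text \<open>A diagonal subsequence makes all images under the approximants \<open>Y j\<close>
  converge at once; an \<open>e / 3\<close> argument makes the images under \<open>X\<close>
  Cauchy.\<close>

lemma cpt_limit: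
  assumes "\<And>e. e > 0 \<Longrightarrow> \<exists>Y. cpt Y \<and> norm (X - Y) \<le> e"
  shows "cpt X"
  unfolding cpt_def
proof (intro allI impI)
  fix x :: "nat \<Rightarrow> hil" assume x: "\<forall>k. norm (x k) \<le> 1"
  have "\<forall>j. \<exists>Y. cpt Y \<and> norm (X - Y) \<le> 1 / Suc j" using assms by simp
  then obtain Y where Y: "\<And>j. cpt (Y j)" "\<And>j. norm (X - Y j) \<le> 1 / Suc j" by metis
  define P where "P j s = convergent (\<lambda>k. Y j (x (s k)))" for j and s :: "nat \<Rightarrow> nat"
  interpret subseqs P
  proof
    fix n and s :: "nat \<Rightarrow> nat" assume "strict_mono s"
    show "\<exists>r'. strict_mono r' \<and> P n (s \<circ> r')"
      using cptD[OF Y(1)[of n], of "\<lambda>k. x (s k)" 1] x by (auto simp: P_def)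
  qed
  have cv: "convergent (\<lambda>k. Y j (x (diagseq k)))" for j
  proof -
    have "P j (diagseq \<circ> ((+) (Suc j)))"
    proof (rule diagseq_holds)
      fix r s :: "nat \<Rightarrow> nat" and n assume "strict_mono r" "P n s"
      then show "P n (s \<circ> r)" unfolding P_def
        using convergent_subseq_convergent[of "\<lambda>k. Y n (x (s k))" r] by (simp add: o_def)
    qed
    then have "convergent (\<lambda>k. Y j (x (diagseq (k + Suc j))))"
      by (simp add: P_def add.commute)
    then show ?thesis by (subst (asm) convergent_ignore_initial_segment)
  qed
  have "Cauchy (\<lambda>k. X (x (diagseq k)))"
  proof (rule metric_CauchyI)
    fix e :: real assume e: "e > 0"
    obtain j :: nat where j: "1 / Suc j < e / 3" using e by (meson zero_less_divide_iff nat_approx_posE zero_less_numeral)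
    have "Cauchy (\<lambda>k. Y j (x (diagseq k)))" using cv by (rule convergent_Cauchy)
    then obtain M where M: "\<And>m n. m \<ge> M \<Longrightarrow> n \<ge> M \<Longrightarrow> dist (Y j (x (diagseq m))) (Y j (x (diagseq n))) < e / 3"
      using e unfolding Cauchy_def by (meson zero_less_divide_iff zero_less_numeral)
    have ap: "dist (X (x k)) (Y j (x k)) < e / 3" for k
    proof -
      have "dist (X (x k)) (Y j (x k)) = norm ((X - Y j) (x k))" by (simp add: dist_norm blinfun.diff_left)
      also have "\<dots> \<le> norm (X - Y j) * norm (x k)" by (rule norm_blinfun)
      also have "\<dots> \<le> norm (X - Y j)" using x by (simp add: mult_left_le)
      also have "\<dots> < e / 3" using Y(2)[of j] j by simp
      finally show ?thesis .
    qed
    have "dist (X (x (diagseq m))) (X (x (diagseq n))) < e" if "m \<ge> M" "n \<ge> M" for m n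
    proof -
      have "dist (X (x (diagseq m))) (X (x (diagseq n))) \<le>
         dist (X (x (diagseq m))) (Y j (x (diagseq m))) + dist (Y j (x (diagseq m))) (Y j (x (diagseq n)))
         + dist (X (x (diagseq n))) (Y j (x (diagseq n)))"
        by metric
      then show ?thesis using M[OF that] ap[of "diagseq m"] ap[of "diagseq n"] by linarith
    qed
    then show "\<exists>M. \<forall>m\<ge>M. \<forall>n\<ge>M. dist (X (x (diagseq m))) (X (x (diagseq n))) < e" by blast
  qed
  then show "\<exists>\<sigma>. strict_mono \<sigma> \<and> convergent (\<lambda>k. X (x (\<sigma> k)))"
    using subseq_diagseq Cauchy_convergent_iff by blast
qed

section \<open>Projections along an orthonormal sequence\<close>

locale ons =
  fixes e :: "nat \<Rightarrow> hil"
  assumes on: "cip (e i) (e j) = (if i = j then 1 else 0)"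
begin

definition pr :: "nat \<Rightarrow> hil \<Rightarrow> hil" where "pr n x = (\<Sum>j<n. cip x (e j) *\<^sub>C e j)"

lemma cip_sum_e: "cip (\<Sum>j\<in>A. c j *\<^sub>C e j) (e i) = (if i \<in> A then c i else 0)" if "finite A"
proof -
  have "cip (\<Sum>j\<in>A. c j *\<^sub>C e j) (e i) = (\<Sum>j\<in>A. if j = i then c i else 0)"
    by (auto simp: cip_left_sum on intro!: sum.cong)
  then show ?thesis using that by simp
qed

lemma norm_sum_e: "finite A \<Longrightarrow> (norm (\<Sum>j\<in>A. c j *\<^sub>C e j))\<^sup>2 = (\<Sum>j\<in>A. (cmod (c j))\<^sup>2)"
proof -
  assume A: "finite A"
  have "complex_of_real ((norm (\<Sum>j\<in>A. c j *\<^sub>C e j))\<^sup>2) = (\<Sum>j\<in>A. cnj (c j) * c j)"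
    unfolding cip_self[symmetric]
    by (subst cip_right_sum) (simp add: cip_sum_e A)
  also have "\<dots> = complex_of_real (\<Sum>j\<in>A. (cmod (c j))\<^sup>2)"
    unfolding of_real_sum complex_norm_square by (simp add: mult.commute)
  finally show ?thesis by (simp only: of_real_eq_iff)
qed

lemma cip_pr_e: "cip (pr n x) (e j) = (if j < n then cip x (e j) else 0)"
  by (simp add: pr_def cip_sum_e)

lemma pr_self_adjoint: "cip (pr n x) y = cip x (pr n y)"
  by (simp add: pr_def cip_left_sum cip_right_sum cip_commute[of "e _" y] mult.commute)

lemma pr_pr: "pr m (pr n x) = pr (min m n) x"
proof -
  have "pr m (pr n x) = (\<Sum>j<m. if j < n then cip x (e j) *\<^sub>C e j else 0)"
    unfolding pr_def[of m] by (intro sum.cong) (auto simp: cip_pr_e)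
  also have "\<dots> = (\<Sum>j\<in>{..<m} \<inter> {j. j < n}. cip x (e j) *\<^sub>C e j)"
    by (simp add: sum.If_cases)
  also have "{..<m} \<inter> {j. j < n} = {..<min m n}" by auto
  finally show ?thesis by (simp add: pr_def)
qed

lemma norm_pr: "norm (pr n x) \<le> norm x"
proof -
  have "(norm (pr n x + (x - pr n x)))\<^sup>2 = (norm (pr n x))\<^sup>2 + (norm (x - pr n x))\<^sup>2"
    by (rule pythagoras) (simp add: cip_right_diff pr_self_adjoint pr_pr)
  then have "(norm (pr n x))\<^sup>2 \<le> (norm x)\<^sup>2" by simp
  then show ?thesis by (rule power2_le_imp_le) simp
qed

lemma pr_add: "pr n (x + y) = pr n x + pr n y"
  by (simp add: pr_def cip_add_left scaleC_left_distrib sum.distrib)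
lemma pr_scaleC: "pr n (c *\<^sub>C x) = c *\<^sub>C pr n x"
  by (simp add: pr_def scaleC_sum)
lemma bounded_linear_pr: "bounded_linear (pr n)"
  by (rule bounded_linear_intro[of _ 1]) (auto simp: pr_add pr_scaleC norm_pr scaleR_hil_def)

lemma series_convergent:
  assumes "\<And>n. (\<Sum>j<n. (cmod (c j))\<^sup>2) \<le> C"
  shows "convergent (\<lambda>n. \<Sum>j<n. c j *\<^sub>C e j)"
proof -
  have "summable (\<lambda>j. (cmod (c j))\<^sup>2)"
    by (rule bounded_imp_summable[of _ C]) (use assms[of "Suc _"] in \<open>auto simp: lessThan_Suc_atMost\<close>)
  then have "Cauchy (\<lambda>n. \<Sum>j<n. (cmod (c j))\<^sup>2)"
    by (simp add: summable_iff_convergent convergent_Cauchy)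
  have "Cauchy (\<lambda>n. \<Sum>j<n. c j *\<^sub>C e j)"
  proof (rule metric_CauchyI)
    fix r :: real assume r: "r > 0"
    then obtain M where M: "\<And>m n. m \<ge> M \<Longrightarrow> n \<ge> M \<Longrightarrow> dist (\<Sum>j<m. (cmod (c j))\<^sup>2) (\<Sum>j<n. (cmod (c j))\<^sup>2) < r\<^sup>2"
      using \<open>Cauchy (\<lambda>n. \<Sum>j<n. (cmod (c j))\<^sup>2)\<close> unfolding Cauchy_def by (meson zero_less_power)
    have *: "dist (\<Sum>j<m. c j *\<^sub>C e j) (\<Sum>j<n. c j *\<^sub>C e j) < r" if "M \<le> m" "m \<le> n" for m n
    proof -
      have d: "(\<Sum>j<n. f j) - (\<Sum>j<m. f j) = (\<Sum>j\<in>{m..<n}. f j)" for f :: "nat \<Rightarrow> 'b::ab_group_add"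
        using sum_diff_nat_ivl[of 0 m n f] that by (simp add: lessThan_atLeast0)
      have "(norm ((\<Sum>j<n. c j *\<^sub>C e j) - (\<Sum>j<m. c j *\<^sub>C e j)))\<^sup>2 = (\<Sum>j<n. (cmod (c j))\<^sup>2) - (\<Sum>j<m. (cmod (c j))\<^sup>2)"
        unfolding d by (rule norm_sum_e) simp
      also have "\<dots> < r\<^sup>2" using M[of n m] that by (auto simp: dist_real_def)
      finally show ?thesis using r by (simp add: dist_norm norm_minus_commute power_less_imp_less_base)
    qed
    show "\<exists>M. \<forall>m\<ge>M. \<forall>n\<ge>M. dist (\<Sum>j<m. c j *\<^sub>C e j) (\<Sum>j<n. c j *\<^sub>C e j) < r"
      by (rule exI[of _ M]) (metis * dist_commute nle_le)
  qed
  then show ?thesis by (rule Cauchy_convergent)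
qed

text \<open>The orthogonal projection onto the closed span of all \<open>e j\<close>. For the basis
  built from the zeros its range is the model space, see \<open>KV_blaschke\<close>.\<close>

definition pu :: "hil \<Rightarrow> hil" where "pu x = lim (\<lambda>n. pr n x)"

lemma pr_tendsto: "(\<lambda>n. pr n x) \<longlonglongrightarrow> pu x"
proof -
  have "(\<Sum>j<n. (cmod (cip x (e j)))\<^sup>2) \<le> (norm x)\<^sup>2" for n
    using norm_sum_e[of "{..<n}" "\<lambda>j. cip x (e j)"] power_mono[OF norm_pr[of n x] norm_ge_zero, of 2] by (simp add: pr_def[symmetric])
  from series_convergent[OF this] show ?thesis
    by (simp add: pu_def pr_def convergent_LIMSEQ_iff)
qed

lemma pu_unique: "(\<lambda>n. pr n x) \<longlonglongrightarrow> y \<Longrightarrow> pu x = y"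
  using pr_tendsto LIMSEQ_unique by blast

lemma pu_add: "pu (x + y) = pu x + pu y"
  by (rule pu_unique) (simp add: pr_add tendsto_add pr_tendsto)
lemma pu_scaleC: "pu (c *\<^sub>C x) = c *\<^sub>C pu x"
  by (rule pu_unique) (simp add: pr_scaleC scaleC_tendsto pr_tendsto)
lemma norm_pu: "norm (pu x) \<le> norm x"
  by (rule LIMSEQ_le_const2[OF tendsto_norm[OF pr_tendsto]]) (auto simp: norm_pr)
lemma bounded_linear_pu: "bounded_linear pu"
  by (rule bounded_linear_intro[of _ 1]) (auto simp: pu_add pu_scaleC norm_pu scaleR_hil_def)
lemma pu_self_adjoint: "cip (pu x) y = cip x (pu y)"
proof -
  have "(\<lambda>n. cip (pr n x) y) \<longlonglongrightarrow> cip (pu x) y" by (intro cip_left_tendsto pr_tendsto)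
  moreover have "(\<lambda>n. cip (pr n x) y) \<longlonglongrightarrow> cip x (pu y)"
    unfolding pr_self_adjoint by (intro cip_right_tendsto pr_tendsto)
  ultimately show ?thesis by (rule LIMSEQ_unique)
qed
lemma pr_pu: "pr n (pu x) = pr n x"
proof -
  have "(\<lambda>m. pr n (pr m x)) \<longlonglongrightarrow> pr n (pu x)"
    by (rule bounded_linear.tendsto[OF bounded_linear_pr pr_tendsto])
  moreover have "(\<lambda>m. pr n (pr m x)) \<longlonglongrightarrow> pr n x"
    by (rule tendsto_eventually, rule eventually_sequentiallyI[of n]) (simp add: pr_pr min_absorb1)
  ultimately show ?thesis by (rule LIMSEQ_unique)
qed
lemma pu_pr: "pu (pr n x) = pr n x"
  by (rule pu_unique, rule tendsto_eventually, rule eventually_sequentiallyI[of n]) (simp add: pr_pr min_absorb2)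
lemma pu_pu: "pu (pu x) = pu x"
  by (rule pu_unique) (simp add: pr_pu pr_tendsto)

definition P :: "nat \<Rightarrow> hil \<Rightarrow>\<^sub>L hil" where "P n = Blinfun (pr n)"
definition PU :: "hil \<Rightarrow>\<^sub>L hil" where "PU = Blinfun pu"

lemma P_apply [simp]: "blinfun_apply (P n) = pr n"
  by (simp add: P_def bounded_linear_Blinfun_apply bounded_linear_pr)
lemma PU_apply [simp]: "blinfun_apply PU = pu"
  by (simp add: PU_def bounded_linear_Blinfun_apply bounded_linear_pu)
lemma clin_P: "clin (P n)" and clin_PU: "clin PU"
  by (simp_all add: clin_def pr_scaleC pu_scaleC)
lemma norm_P: "norm (P n) \<le> 1" by (rule norm_blinfun_bound) (auto simp: norm_pr)

text \<open>Operators on the range of \<open>pu\<close>, extended by zero to the orthogonal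
  complement.\<close>

definition onV :: "(hil \<Rightarrow>\<^sub>L hil) \<Rightarrow> bool" where
  "onV X \<longleftrightarrow> clin X \<and> (\<forall>x. X (pu x) = X x) \<and> (\<forall>x. pu (X x) = X x)"

text \<open>The value of the adjoint at \<open>g\<close> is written down by its coefficients
  \<open>cip g (X (e j))\<close>. They are square summable: testing \<open>X\<close> on the partial
  sum \<open>h\<close> of this very series gives \<open>norm h <= norm g * norm X\<close>.\<close>

lemma onV_adjoint:
  assumes X: "onV X"
  obtains Y where "onV Y" "\<And>x y. cip (X x) y = cip x (Y y)"
proof -
  have lin: "X (c *\<^sub>C x) = c *\<^sub>C X x" for c x using X by (simp add: onV_def clinD)
  have "\<exists>h. pu h = h \<and> (\<forall>f. cip (X f) g = cip f h)" for g
  proof -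
    define c where "c j = cip g (X (e j))" for j
    have "(\<Sum>j<n. (cmod (c j))\<^sup>2) \<le> (norm g * norm X)\<^sup>2" for n
    proof -
      define h where "h = (\<Sum>j<n. c j *\<^sub>C e j)"
      have h2: "(norm h)\<^sup>2 = (\<Sum>j<n. (cmod (c j))\<^sup>2)" unfolding h_def by (rule norm_sum_e) simp
      have "cip g (X h) = (\<Sum>j<n. cnj (c j) * c j)"
        unfolding h_def by (simp add: blinfun.sum_right lin cip_right_sum c_def)
      also have "\<dots> = of_real ((norm h)\<^sup>2)"
        unfolding h2 of_real_sum complex_norm_square by (simp add: mult.commute)
      finally have "(norm h)\<^sup>2 = cmod (cip g (X h))" by (simp add: norm_power)
      also have "\<dots> \<le> norm g * norm (X h)" by (rule cip_cauchy)
      also have "\<dots> \<le> norm g * (norm X * norm h)" by (intro mult_left_mono norm_blinfun) simp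
      finally have "norm h * norm h \<le> (norm g * norm X) * norm h" by (simp add: power2_eq_square mult.assoc)
      then have "norm h \<le> norm g * norm X" by (metis mult_nonneg_nonneg mult_right_le_imp_le norm_ge_zero not_le order_le_less)
      then have "(norm h)\<^sup>2 \<le> (norm g * norm X)\<^sup>2" by (intro power_mono) auto
      then show ?thesis by (simp add: h2)
    qed
    from series_convergent[OF this] obtain h where h: "(\<lambda>n. \<Sum>j<n. c j *\<^sub>C e j) \<longlonglongrightarrow> h"
      by (auto simp: convergent_def)
    have "cip (X f) g = cip f h" for f
    proof -
      have "(\<lambda>n. cip (X (pr n f)) g) \<longlonglongrightarrow> cip (X (pu f)) g"
        by (intro cip_left_tendsto blinfun.tendsto tendsto_const pr_tendsto)
      moreover have "cip (X (pr n f)) g = cip f (\<Sum>j<n. c j *\<^sub>C e j)" for n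
        by (simp add: pr_def blinfun.sum_right lin cip_left_sum cip_right_sum c_def cip_commute[of g] mult.commute)
      ultimately have "(\<lambda>n. cip f (\<Sum>j<n. c j *\<^sub>C e j)) \<longlonglongrightarrow> cip (X f) g"
        using X by (simp add: onV_def)
      moreover have "(\<lambda>n. cip f (\<Sum>j<n. c j *\<^sub>C e j)) \<longlonglongrightarrow> cip f h"
        by (intro cip_right_tendsto h)
      ultimately show ?thesis by (rule LIMSEQ_unique)
    qed
    then show ?thesis using X
      by (intro exI[of _ "pu h"]) (simp add: pu_pu pu_self_adjoint[symmetric] onV_def, metis)
  qed
  then obtain A where A: "\<And>g. pu (A g) = A g" "\<And>f g. cip (X f) g = cip f (A g)" by metis
  have uq: "x = y" if "\<And>f. cip f x = cip f y" for x y
    using cip_eq_0_imp[of "x - y"] that by (metis cip_commute cip_left_diff complex_cnj_zero eq_iff_diff_eq_0 cip_right_diff)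
  have "bounded_linear A"
  proof (rule bounded_linear_intro[of _ "norm X"])
    show "A (x + y) = A x + A y" for x y by (rule uq) (simp add: A(2)[symmetric] cip_add_right)
    show "A (r *\<^sub>R x) = r *\<^sub>R A x" for r x by (rule uq) (simp add: A(2)[symmetric] cip_scaleR_right)
    show "norm (A x) \<le> norm x * norm X" for x
    proof -
      have "(norm (A x))\<^sup>2 = cmod (cip (X (A x)) x)" by (simp add: A(2) cip_self norm_power)
      also have "\<dots> \<le> norm (X (A x)) * norm x" by (rule cip_cauchy)
      also have "\<dots> \<le> (norm X * norm (A x)) * norm x" by (intro mult_right_mono norm_blinfun) simp
      finally have "norm (A x) * norm (A x) \<le> (norm x * norm X) * norm (A x)" by (simp add: power2_eq_square mult_ac)
      then show ?thesis by (metis mult_nonneg_nonneg mult_right_le_imp_le norm_ge_zero not_le order_le_less)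
    qed
  qed
  then have ap: "blinfun_apply (Blinfun A) = A" by (rule bounded_linear_Blinfun_apply)
  have "onV (Blinfun A)" unfolding onV_def clin_def ap
  proof (intro conjI allI)
    show "A (c *\<^sub>C x) = c *\<^sub>C A x" for c x by (rule uq) (simp add: A(2)[symmetric])
    show "A (pu x) = A x" for x
      by (rule uq) (use X in \<open>simp add: A(2)[symmetric] pu_self_adjoint[symmetric] onV_def\<close>)
    show "pu (A x) = A x" for x by (rule A)
  qed
  then show ?thesis using A(2) ap that by metis
qed

lemma not_tendsto_0_subseq:
  fixes f :: "nat \<Rightarrow> real"
  assumes "\<not> f \<longlonglongrightarrow> 0" "\<And>n. 0 \<le> f n"
  obtains r d where "d > 0" "strict_mono (r::nat\<Rightarrow>nat)" "\<And>k. f (r k) \<ge> d"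
proof -
  obtain d where d: "d > 0" "\<forall>N. \<exists>n\<ge>N. f n \<ge> d"
    using assms unfolding LIMSEQ_iff by (auto simp: not_less)
  have "infinite {n. f n \<ge> d}"
    using d(2) by (auto simp: infinite_nat_iff_unbounded_le)
  from infinite_enumerate[OF this] obtain r :: "nat \<Rightarrow> nat" where r: "strict_mono r" "\<forall>k. r k \<in> {n. f n \<ge> d}"
    by auto
  show ?thesis by (rule that[OF d(1) r(1)]) (use r(2) in auto)
qed

lemma norm_ge_witness:
  fixes X :: "hil \<Rightarrow>\<^sub>L hil"
  assumes "norm X \<ge> d" "d > 0"
  shows "\<exists>x. norm x \<le> 1 \<and> norm (X x) > d / 2"
proof (rule ccontr)
  assume w: "\<not> ?thesis"
  then have *: "norm (X x) \<le> d / 2" if "norm x \<le> 1" for x using that w not_le by blast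
  have "norm X \<le> d / 2"
  proof (rule norm_blinfun_bound)
    fix x
    show "norm (X x) \<le> d / 2 * norm x"
    proof (cases "x = 0")
      case False
      have "norm (X ((1 / norm x) *\<^sub>R x)) \<le> d / 2" by (rule *) (simp add: False)
      then show ?thesis using False by (simp add: blinfun.scaleR_right field_simps)
    qed simp
  qed (use assms in simp)
  then show False using assms by simp
qed

lemma norm_tail: "norm ((PU - P n) x) \<le> 2 * norm x"
  using norm_triangle_ineq4[of "pu x" "pr n x"] norm_pu[of x] norm_pr[of n x]
  by (simp add: blinfun.diff_left)

lemma tail_tendsto: "(\<lambda>n. (PU - P n) x) \<longlonglongrightarrow> 0"
  using tendsto_diff[OF tendsto_const[of "pu x"] pr_tendsto[of x]] by (simp add: blinfun.diff_left)

text \<open>Otherwise unit vectors \<open>x k\<close> have tails of \<open>X (x k)\<close> above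
  \<open>d / 2\<close>. Compactness provides a limit \<open>l\<close> of a subsequence of the
  images; the tails of \<open>l\<close> tend to 0, and those of the differences are at most twice
  their norms.\<close>

lemma cpt_tail_left:
  assumes "cpt X"
  shows "(\<lambda>n. norm ((PU - P n) o\<^sub>L X)) \<longlonglongrightarrow> 0"
proof (rule ccontr)
  assume "\<not> ?thesis"
  then obtain r d where r: "d > 0" "strict_mono (r::nat\<Rightarrow>nat)" "\<And>k. norm ((PU - P (r k)) o\<^sub>L X) \<ge> d"
    by (rule not_tendsto_0_subseq) auto
  have "\<forall>k. \<exists>x. norm x \<le> 1 \<and> norm (((PU - P (r k)) o\<^sub>L X) x) > d / 2"
    using norm_ge_witness[OF r(3) r(1)] by metis
  then obtain x where x: "\<And>k. norm (x k) \<le> 1" "\<And>k. norm ((PU - P (r k)) (X (x k))) > d / 2"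
    by (metis blinfun_apply_blinfun_compose)
  obtain \<sigma> where s: "strict_mono \<sigma>" "convergent (\<lambda>k. X (x (\<sigma> k)))" by (rule cptD[OF assms x(1)])
  then obtain l where l: "(\<lambda>k. X (x (\<sigma> k))) \<longlonglongrightarrow> l" by (auto simp: convergent_def)
  have t1: "(\<lambda>k. (PU - P (r (\<sigma> k))) l) \<longlonglongrightarrow> 0"
    using LIMSEQ_subseq_LIMSEQ[OF tail_tendsto[of l] strict_mono_o[OF r(2) s(1)]] by (simp add: o_def)
  have t2: "(\<lambda>k. (PU - P (r (\<sigma> k))) (X (x (\<sigma> k)) - l)) \<longlonglongrightarrow> 0"
  proof (rule Lim_null_comparison[OF always_eventually[OF allI[OF norm_tail]]])
    show "(\<lambda>k. 2 * norm (X (x (\<sigma> k)) - l)) \<longlonglongrightarrow> 0"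
      using l by (intro tendsto_mult_right_zero tendsto_norm_zero) (simp add: LIM_zero_iff)
  qed
  have "(\<lambda>k. norm ((PU - P (r (\<sigma> k))) (X (x (\<sigma> k))))) \<longlonglongrightarrow> 0"
    using tendsto_norm_zero[OF tendsto_add_zero[OF t1 t2]] by (simp add: blinfun.diff_right)
  then have "d / 2 \<le> 0" by (rule LIMSEQ_le_const) (use x(2) in \<open>auto intro: less_imp_le\<close>)
  then show False using r(1) by simp
qed

text \<open>The vectors \<open>(PU - P n) x\<close> tend weakly to 0, as is seen by moving to the
  adjoint. Compactness makes a subsequence of their images under \<open>X\<close> converge in norm,
  and the limit has to be the weak limit 0.\<close>

lemma cpt_tail_right:
  assumes "cpt X" "onV X"
  shows "(\<lambda>n. norm (X o\<^sub>L (PU - P n))) \<longlonglongrightarrow> 0"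
proof (rule ccontr)
  assume "\<not> ?thesis"
  then obtain r d where r: "d > 0" "strict_mono (r::nat\<Rightarrow>nat)" "\<And>k. norm (X o\<^sub>L (PU - P (r k))) \<ge> d"
    by (rule not_tendsto_0_subseq) auto
  obtain Y where Y: "\<And>x y. cip (X x) y = cip x (Y y)" using onV_adjoint[OF assms(2)] by metis
  have "\<forall>k. \<exists>x. norm x \<le> 1 \<and> norm ((X o\<^sub>L (PU - P (r k))) x) > d / 2"
    using norm_ge_witness[OF r(3) r(1)] by metis
  then obtain x where x: "\<And>k. norm (x k) \<le> 1" "\<And>k. norm (X ((PU - P (r k)) (x k))) > d / 2"
    by (metis blinfun_apply_blinfun_compose)
  have b: "norm ((PU - P (r k)) (x k)) \<le> 2" for k
    using norm_tail[of "r k" "x k"] x(1)[of k] by linarith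
  obtain \<sigma> where s: "strict_mono \<sigma>" "convergent (\<lambda>k. X ((PU - P (r (\<sigma> k))) (x (\<sigma> k))))"
    by (rule cptD[OF assms(1) b])
  then obtain l where l: "(\<lambda>k. X ((PU - P (r (\<sigma> k))) (x (\<sigma> k)))) \<longlonglongrightarrow> l" by (auto simp: convergent_def)
  have "cip l h = 0" for h
  proof -
    have "(\<lambda>k. cip (X ((PU - P (r (\<sigma> k))) (x (\<sigma> k)))) h) \<longlonglongrightarrow> cip l h"
      by (intro cip_left_tendsto l)
    moreover have "(\<lambda>k. cip (X ((PU - P (r (\<sigma> k))) (x (\<sigma> k)))) h) \<longlonglongrightarrow> 0"
    proof (rule Lim_null_comparison)
      have "cmod (cip (X ((PU - P (r (\<sigma> k))) (x (\<sigma> k)))) h) \<le> norm ((PU - P (r (\<sigma> k))) (Y h))" for k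
      proof -
        have "cip (X ((PU - P (r (\<sigma> k))) (x (\<sigma> k)))) h = cip (x (\<sigma> k)) ((PU - P (r (\<sigma> k))) (Y h))"
          by (simp add: Y blinfun.diff_left cip_left_diff cip_right_diff pu_self_adjoint pr_self_adjoint)
        then show ?thesis using cip_cauchy[of "x (\<sigma> k)" "(PU - P (r (\<sigma> k))) (Y h)"] x(1)[of "\<sigma> k"]
          by (metis mult_left_le_one_le norm_ge_zero order_trans)
      qed
      then show "\<forall>\<^sub>F k in sequentially. cmod (cip (X ((PU - P (r (\<sigma> k))) (x (\<sigma> k)))) h) \<le> norm ((PU - P (r (\<sigma> k))) (Y h))"
        by (intro always_eventually allI)
      show "(\<lambda>k. norm ((PU - P (r (\<sigma> k))) (Y h))) \<longlonglongrightarrow> 0"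
        using tendsto_norm_zero[OF LIMSEQ_subseq_LIMSEQ[OF tail_tendsto[of "Y h"] strict_mono_o[OF r(2) s(1)]]] by (simp add: o_def)
    qed
    ultimately show ?thesis by (rule LIMSEQ_unique)
  qed
  then have "l = 0" by (rule cip_eq_0_imp)
  then have "(\<lambda>k. norm (X ((PU - P (r (\<sigma> k))) (x (\<sigma> k))))) \<longlonglongrightarrow> 0"
    using tendsto_norm_zero l by blast
  then have "d / 2 \<le> 0" by (rule LIMSEQ_le_const) (use x(2) in \<open>auto intro: less_imp_le\<close>)
  then show False using r(1) by simp
qed

end

section \<open>Finite Blaschke products and the Takenaka-Malmquist basis\<close>

definition KV :: "cfun \<Rightarrow> hil set" where
  "KV v = {x \<in> Hardy. \<forall>y\<in>Hardy. cip x (mulop v y) = 0}"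

lemma kvec_0: "kvec 0 = zpow 0"
  by (simp add: kvec_def szego_def[abs_def] zpow_def)

lemma cip_one_kvec: "cmod w < 1 \<Longrightarrow> cip (zpow 0) (kvec w) = 1"
  by (subst kvec_eq)
    (auto simp: cip_add_right cip_zpow cip_commute[of "zpow 0"] cip_mulop_z kvec_Hardy[unfolded Hardy_def, simplified])

lemma cip_szego_kvec:
  assumes "cmod l < 1" "cmod w < 1" "x \<in> Hardy"
  shows "cip (mulop (szego l) x) (kvec w) = szego l w * cip x (kvec w)"
proof -
  have "cip x (kvec w) = cip (mulop (szego l) x) (kvec w) - cnj l * (w * cip (mulop (szego l) x) (kvec w))"
    by (subst mulop_szego_cancel[OF assms(1), of x, symmetric])
      (simp add: cip_left_diff kvec_z assms Hardy_szego)
  moreover have "1 - cnj l * w \<noteq> 0" using szego_denom[of l w] assms by simp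
  ultimately show ?thesis by (simp add: szego_def field_simps)
qed

lemma cip_bfac_kvec:
  assumes "cmod l < 1" "cmod w < 1" "x \<in> Hardy"
  shows "cip (mulop (bfac l) x) (kvec w) = bfac l w * cip x (kvec w)"
  using assms
  by (simp add: mulop_bfac cip_left_diff kvec_z Hardy_szego cip_szego_kvec bfac_eq algebra_simps)

lemma cmod_bfac_le:
  assumes "cmod l < 1" "cmod z \<le> 1"
  shows "cmod (bfac l z) \<le> 1"
proof -
  have "(cmod (1 - cnj l * z))\<^sup>2 - (cmod (l - z))\<^sup>2 = (1 - (cmod l)\<^sup>2) * (1 - (cmod z)\<^sup>2)"
    unfolding cmod_power2 by (simp add: power2_eq_square algebra_simps)
  also have "\<dots> \<ge> 0" using assms by (intro mult_nonneg_nonneg) (auto simp: power_le_one)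
  finally have "(cmod (l - z))\<^sup>2 \<le> (cmod (1 - cnj l * z))\<^sup>2" by simp
  then have "cmod (l - z) \<le> cmod (1 - cnj l * z)" by (rule power2_le_imp_le) simp
  moreover have "cmod (1 - cnj l * z) > 0" using szego_denom[OF assms] by simp
  ultimately show ?thesis by (simp add: bfac_eq szego_def norm_mult norm_divide cmod_bfac_const)
qed

lemma one_minus_prod_le:
  fixes a :: "nat \<Rightarrow> real"
  assumes "finite S" "\<And>k. 0 \<le> a k" "\<And>k. a k \<le> 1"
  shows "1 - (\<Prod>k\<in>S. a k) \<le> (\<Sum>k\<in>S. 1 - a k)"
  using assms(1)
proof induction
  case (insert k S)
  have "(\<Prod>k\<in>S. a k) \<le> 1" by (intro prod_le_1) (auto simp: assms)
  then have "0 \<le> (1 - a k) * (1 - (\<Prod>k\<in>S. a k))" using assms by simp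
  with insert show ?case by (simp add: algebra_simps)
qed simp

lemma norm_diff_sq: "(norm (x - y))\<^sup>2 = (norm x)\<^sup>2 + (norm y)\<^sup>2 - 2 * Re (cip x y)"
  by (simp add: power2_norm_eq_inner inner_diff inner_commute) (simp add: inner_hil_def)

locale bzeros =
  fixes lam :: "nat \<Rightarrow> complex"
  assumes bs: "blaschke_seq lam"
begin

lemma lam1: "cmod (lam k) < 1" using bs by (simp add: blaschke_seq_def)

text \<open>Products over arbitrary index sets make the quotients of two partial products available
  as \<open>bl {n..<m}\<close>.\<close>

definition bl :: "nat set \<Rightarrow> cfun" where "bl S z = (\<Prod>k\<in>S. bfac (lam k) z)"

lemma cont_bl: "continuous_on (cball 0 1) (bl S)"
  unfolding bl_def[abs_def] by (intro continuous_on_prod cont_bfac lam1)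

lemma cont_bl_sphere: "continuous_on (sphere 0 1) (bl S)"
  by (rule continuous_on_subset[OF cont_bl]) auto

lemma bdd_sym_bl: "bdd_sym (bl S)" by (intro bdd_sym_cont cont_bl_sphere)

lemma cmod_bl: "cmod z = 1 \<Longrightarrow> cmod (bl S z) = 1"
  by (simp add: bl_def prod_norm[symmetric] cmod_bfac lam1)

lemma cmod_bl_le: "cmod z \<le> 1 \<Longrightarrow> cmod (bl S z) \<le> 1"
  unfolding bl_def prod_norm[symmetric] by (intro prod_le_1) (auto simp: cmod_bfac_le lam1)

lemma mulop_bl_Un:
  assumes "finite S" "finite T" "S \<inter> T = {}"
  shows "mulop (bl (S \<union> T)) x = mulop (bl S) (mulop (bl T) x)"
proof -
  have "bl (S \<union> T) = (\<lambda>z. bl S z * bl T z)"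
    by (simp add: bl_def fun_eq_iff prod.union_disjoint assms)
  then show ?thesis by (simp add: mulop_mulop bdd_sym_bl)
qed

lemma bl_single: "bl {k} = bfac (lam k)" by (simp add: bl_def fun_eq_iff)
lemma bl_empty: "bl {} = (\<lambda>z. 1)" by (simp add: bl_def fun_eq_iff)

lemma mulop_bl_insert:
  "finite S \<Longrightarrow> k \<notin> S \<Longrightarrow> mulop (bl (insert k S)) x = mulop (bfac (lam k)) (mulop (bl S) x)"
  using mulop_bl_Un[of "{k}" S x] by (simp add: bl_single)

lemma mulop_bl_split: "n \<le> m \<Longrightarrow> mulop (bl {..<m}) x = mulop (bl {..<n}) (mulop (bl {n..<m}) x)"
  using mulop_bl_Un[of "{..<n}" "{n..<m}" x] by (simp add: ivl_disj_un_one(2) ivl_disj_int_one)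

lemma mulop_bl_Suc: "mulop (bl {..<Suc n}) x = mulop (bl {..<n}) (mulop (bfac (lam n)) x)"
  using mulop_bl_split[of n "Suc n" x] by (simp add: bl_single)

lemma Hardy_bl: "finite S \<Longrightarrow> x \<in> Hardy \<Longrightarrow> mulop (bl S) x \<in> Hardy"
  by (induction S rule: finite_induct) (simp_all add: bl_empty mulop_one mulop_bl_insert Hardy_bfac lam1)

lemma cip_bl_kvec:
  assumes "cmod w < 1" "x \<in> Hardy" "finite S"
  shows "cip (mulop (bl S) x) (kvec w) = bl S w * cip x (kvec w)"
  using assms(3)
proof induction
  case (insert k S)
  then show ?case using assms(1,2)
    by (simp add: mulop_bl_insert cip_bfac_kvec lam1 Hardy_bl) (simp add: bl_def)
qed (simp add: bl_empty mulop_one)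

lemma cip_bl_isometry: "cip (mulop (bl S) x) (mulop (bl S) y) = cip x y"
  by (intro cip_mulop_isometry bdd_sym_bl cmod_bl)

text \<open>The Takenaka-Malmquist vectors. The kernel at \<open>lam n\<close> is multiplied by all
  earlier factors, so repeated zeros need no separate treatment.\<close>

definition e :: "nat \<Rightarrow> hil" where
  "e n = complex_of_real (1 / norm (kvec (lam n))) *\<^sub>C mulop (bl {..<n}) (kvec (lam n))"

lemma kvec_nonzero: "norm (kvec (lam n)) \<noteq> 0"
  using cip_one_kvec[OF lam1, of n] by auto

text \<open>Both vectors contain the factor \<open>bl {..<i}\<close>, which acts isometrically and
  can be removed. What is left of \<open>e j\<close> has the factor vanishing at
  \<open>lam i\<close> and is paired with the kernel at \<open>lam i\<close>.\<close>

lemma e_orth_lt: "i < j \<Longrightarrow> cip (e j) (e i) = 0"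
proof -
  assume "i < j"
  define h where "h = mulop (bl {Suc i..<j}) (kvec (lam j))"
  have h: "h \<in> Hardy" unfolding h_def by (intro Hardy_bl kvec_Hardy lam1) simp
  have "mulop (bl {..<j}) (kvec (lam j)) = mulop (bl {..<i}) (mulop (bfac (lam i)) h)"
    using \<open>i < j\<close> by (simp add: h_def mulop_bl_split[of "Suc i" j] mulop_bl_Suc)
  then have "cip (mulop (bl {..<j}) (kvec (lam j))) (mulop (bl {..<i}) (kvec (lam i))) = 0"
    by (simp add: cip_bl_isometry kvec_bfac_zero lam1 h)
  then show ?thesis by (simp add: e_def)
qed

sublocale ons e
proof
  fix i j
  show "cip (e i) (e j) = (if i = j then 1 else 0)"
  proof (cases "i = j")
    case True
    then show ?thesis
      using kvec_nonzero[of j]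
      by (simp add: e_def cip_bl_isometry) (simp add: cip_self power2_eq_square)
  next
    case False
    then have "i < j \<or> j < i" by auto
    then show ?thesis using e_orth_lt cip_commute[of "e i" "e j"] by auto
  qed
qed

lemma e_Hardy: "e j \<in> Hardy" unfolding e_def by (intro Hardy_scale Hardy_bl kvec_Hardy lam1) simp

lemma e_KV: "j < n \<Longrightarrow> e j \<in> KV (bl {..<n})"
proof -
  assume "j < n"
  have "cip (e j) (mulop (bl {..<n}) y) = 0" if "y \<in> Hardy" for y
  proof -
    define h where "h = mulop (bl {Suc j..<n}) y"
    have h: "h \<in> Hardy" unfolding h_def using that by (intro Hardy_bl) simp
    have "mulop (bl {..<n}) y = mulop (bl {..<j}) (mulop (bfac (lam j)) h)"
      using \<open>j < n\<close> by (simp add: h_def mulop_bl_split[of "Suc j" n] mulop_bl_Suc)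
    moreover have "cip (kvec (lam j)) (mulop (bfac (lam j)) h) = 0"
      using kvec_bfac_zero[OF lam1 h] by (subst cip_commute) simp
    ultimately show ?thesis by (simp add: e_def cip_bl_isometry)
  qed
  then show ?thesis by (simp add: KV_def e_Hardy)
qed

text \<open>Zeros are divided out one at a time: once \<open>x = bl {..<n} * h\<close>,
  orthogonality to \<open>e n\<close> says that \<open>h\<close> vanishes at \<open>lam n\<close>,
  and \<open>zero_removal\<close> applies.\<close>

lemma orth_e_factor:
  assumes "x \<in> Hardy" "\<And>j. j < n \<Longrightarrow> cip x (e j) = 0"
  shows "\<exists>h\<in>Hardy. x = mulop (bl {..<n}) h"
  using assms(2)
proof (induction n)
  case 0
  then show ?case using assms(1) by (auto simp: bl_empty mulop_one)
next
  case (Suc n)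
  then obtain h where h: "h \<in> Hardy" "x = mulop (bl {..<n}) h" by auto
  have "cip x (e n) = 0" using Suc by simp
  then have "cip h (kvec (lam n)) = 0"
    using kvec_nonzero[of n] unfolding h(2) e_def by (simp add: cip_bl_isometry)
  then have "mulop (\<lambda>z. cnj (bfac (lam n) z)) h \<in> Hardy" by (intro zero_removal lam1 h)
  moreover have "x = mulop (bl {..<Suc n}) (mulop (\<lambda>z. cnj (bfac (lam n) z)) h)"
    by (simp add: mulop_bl_Suc mulop_bfac_cnj lam1 h(2))
  ultimately show ?case by blast
qed

lemma KV_add: "x \<in> KV v \<Longrightarrow> y \<in> KV v \<Longrightarrow> x + y \<in> KV v"
  by (simp add: KV_def Hardy_add cip_add_left)
lemma KV_scale: "x \<in> KV v \<Longrightarrow> c *\<^sub>C x \<in> KV v"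
  by (simp add: KV_def Hardy_scale)
lemma KV_zero: "0 \<in> KV v"
  by (simp add: KV_def Hardy_zero)
lemma KV_diff: "x \<in> KV v \<Longrightarrow> y \<in> KV v \<Longrightarrow> x - y \<in> KV v"
  by (simp add: KV_def Hardy_diff cip_left_diff)
lemma KV_sum: "(\<And>j. j \<in> A \<Longrightarrow> f j \<in> KV v) \<Longrightarrow> (\<Sum>j\<in>A. f j) \<in> KV v"
proof (induction A rule: infinite_finite_induct)
  case (insert a A)
  then have "f a + sum f A \<in> KV v" by (intro KV_add) simp_all
  with insert.hyps show ?case by simp
qed (simp_all add: KV_zero)
lemma KV_closed: assumes "\<And>n. X n \<in> KV v" "X \<longlonglongrightarrow> x" shows "x \<in> KV v"
  unfolding KV_def
proof (intro CollectI conjI ballI)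
  show "x \<in> Hardy" by (rule Hardy_closed[OF _ assms(2)]) (use assms(1) in \<open>simp add: KV_def\<close>)
  fix y assume "y \<in> Hardy"
  have "(\<lambda>k. cip (X k) (mulop v y)) \<longlonglongrightarrow> cip x (mulop v y)" by (intro cip_left_tendsto assms)
  moreover have "cip (X k) (mulop v y) = 0" for k using assms(1) \<open>y \<in> Hardy\<close> by (auto simp: KV_def)
  ultimately show "cip x (mulop v y) = 0" by (simp add: LIMSEQ_const_iff)
qed

lemma pr_KV: "pr n x \<in> KV (bl {..<n})"
  unfolding pr_def by (intro KV_sum KV_scale e_KV) simp

text \<open>The rest \<open>g\<close> of \<open>x\<close> after projection lies in the model space
  and is orthogonal to the first \<open>n\<close> basis vectors, hence a multiple of
  \<open>bl {..<n}\<close>. So \<open>g\<close> is orthogonal to itself.\<close>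

lemma KV_bl: "KV (bl {..<n}) = {x. pr n x = x}"
proof (intro set_eqI iffI CollectI)
  fix x assume x: "x \<in> KV (bl {..<n})"
  define g where "g = x - pr n x"
  have g: "g \<in> KV (bl {..<n})" unfolding g_def by (intro KV_diff x pr_KV)
  have "\<exists>h\<in>Hardy. g = mulop (bl {..<n}) h"
    by (rule orth_e_factor) (use g in \<open>auto simp: KV_def g_def cip_left_diff cip_pr_e\<close>)
  then have "cip g g = 0" using g by (auto simp: KV_def)
  then have "g = 0" by (simp add: cip_self)
  then show "pr n x = x" by (simp add: g_def)
next
  fix x assume "x \<in> {x. pr n x = x}" then show "x \<in> KV (bl {..<n})" using pr_KV[of n x] by simp
qed

section \<open>Norm convergence of the partial products\<close>

definition U :: "nat \<Rightarrow> hil" where "U n = cl (bl {..<n})"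

lemma bl_L2: "bl S \<in> L2" by (intro L2_bdd_sym bdd_sym_bl)

lemma cl_bl: "cl (bl S) = mulop (bl S) (zpow 0)"
  by (simp add: zpow_def mulop_cl bdd_sym_bl L2_const)

text \<open>For unit vectors only the inner product matters. Removing the common isometric factor
  turns it into the value of the quotient product at 0, which is the product of the moduli of the
  zeros.\<close>

lemma U_dist:
  assumes "n \<le> m"
  shows "(norm (U m - U n))\<^sup>2 \<le> 2 * (\<Sum>k\<in>{n..<m}. 1 - cmod (lam k))"
proof -
  have n1: "norm (U k) = 1" for k
    using cip_bl_isometry[of "{..<k}" "zpow 0" "zpow 0"] cip_self[of "U k"]
    by (simp add: U_def cl_bl cip_zpow) (metis norm_ge_zero of_real_eq_1_iff of_real_power power2_eq_1_iff abs_of_nonneg abs_1 abs_minus_cancel)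
  have b0: "bfac l 0 = of_real (cmod l)" for l by (simp add: bfac_def)
  \<comment> \<open>\<open>kvec 0\<close> is the constant 1, so the pairing becomes evaluation at
    0.\<close>
  have "cip (U m) (U n) = cip (mulop (bl {n..<m}) (zpow 0)) (kvec 0)"
    using assms by (simp add: U_def cl_bl mulop_bl_split[of n m] cip_bl_isometry kvec_0)
  also have "\<dots> = bl {n..<m} 0 * cip (zpow 0) (kvec 0)"
    by (rule cip_bl_kvec) (auto simp: Hardy_zpow)
  also have "\<dots> = of_real (\<Prod>k\<in>{n..<m}. cmod (lam k))"
    by (simp add: kvec_0 cip_zpow bl_def b0)
  finally have "(norm (U m - U n))\<^sup>2 = 2 * (1 - (\<Prod>k\<in>{n..<m}. cmod (lam k)))"
    by (simp only: norm_diff_sq n1 Re_complex_of_real) simp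
  also have "\<dots> \<le> 2 * (\<Sum>k\<in>{n..<m}. 1 - cmod (lam k))"
    using lam1 by (intro mult_left_mono one_minus_prod_le) (auto intro: less_imp_le)
  finally show ?thesis .
qed

lemma U_Cauchy: "Cauchy U"
proof (rule metric_CauchyI)
  fix r :: real assume r: "r > 0"
  have s: "summable (\<lambda>k. 1 - cmod (lam k))" using bs by (simp add: blaschke_seq_def)
  then obtain N where N: "\<And>m n. m \<ge> N \<Longrightarrow> norm (\<Sum>k\<in>{m..<n}. 1 - cmod (lam k)) < r\<^sup>2 / 2"
    using r unfolding summable_Cauchy by (metis half_gt_zero zero_less_power)
  have *: "dist (U m) (U n) < r" if "N \<le> n" "n \<le> m" for m n
  proof -
    have "(norm (U m - U n))\<^sup>2 < r\<^sup>2"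
      using U_dist[OF that(2)] N[OF that(1), of m] by auto
    then show ?thesis using r by (simp add: dist_norm power_less_imp_less_base)
  qed
  show "\<exists>M. \<forall>m\<ge>M. \<forall>n\<ge>M. dist (U m) (U n) < r"
    by (rule exI[of _ N]) (metis * dist_commute nle_le)
qed

end

section \<open>The maximal function on the circle\<close>

text \<open>Jordan's inequality, from the concavity of the sine between 0 and
  \<open>pi / 2\<close>.\<close>

lemma sin_ge_linear:
  assumes "0 \<le> x" "x \<le> pi/2"
  shows "2 / pi * x \<le> sin x"
proof -
  have "convex_on {0..pi} (\<lambda>x. - sin x)"
  proof (rule f''_ge0_imp_convex[where f' = "\<lambda>x. - cos x" and f'' = sin])
    show "((\<lambda>x. - sin x) has_real_derivative - cos x) (at x)" for x
      by (auto intro!: derivative_eq_intros)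
    show "((\<lambda>x. - cos x) has_real_derivative sin x) (at x)" for x
      by (auto intro!: derivative_eq_intros)
  qed (auto intro: sin_ge_zero)
  then have "- sin ((1 - 2/pi*x) *\<^sub>R 0 + (2/pi*x) *\<^sub>R (pi/2)) \<le> (1 - 2/pi*x) * (- sin 0) + (2/pi*x) * (- sin (pi/2))"
    by (rule convex_onD) (use assms in \<open>auto simp: field_simps\<close>)
  then show ?thesis by simp
qed

lemma dist_cis: "dist (cis s) (cis t) = 2 * \<bar>sin ((s - t)/2)\<bar>"
proof -
  have "(dist (cis s) (cis t))\<^sup>2 = (cos s - cos t)\<^sup>2 + (sin s - sin t)\<^sup>2"
    by (simp add: dist_norm cmod_power2)
  also have "\<dots> = 2 - 2 * cos (s - t)"
    using sin_cos_squared_add3[of s] sin_cos_squared_add3[of t]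
    by (simp add: power2_eq_square cos_diff algebra_simps)
  also have "cos (s - t) = 1 - 2 * (sin ((s - t)/2))\<^sup>2"
  proof -
    have "s - t = 2 * ((s - t)/2)" by simp
    then show ?thesis using cos_double_sin[of "(s - t)/2"] by metis
  qed
  finally have "(dist (cis s) (cis t))\<^sup>2 = (2 * \<bar>sin ((s - t)/2)\<bar>)\<^sup>2" by (simp add: power_mult_distrib)
  then show ?thesis by (rule power2_eq_imp_eq) auto
qed

lemma dist_cis_le: "dist (cis s) (cis t) \<le> \<bar>s - t\<bar>"
  unfolding dist_cis using abs_sin_x_le_abs_x[of "(s - t)/2"] by simp

lemma dist_cis_ge:
  assumes "\<bar>s - t\<bar> \<le> pi"
  shows "2 / pi * \<bar>s - t\<bar> \<le> dist (cis s) (cis t)"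
proof -
  have "2 / pi * \<bar>(s - t)/2\<bar> \<le> sin \<bar>(s - t)/2\<bar>" by (rule sin_ge_linear) (use assms in auto)
  also have "\<dots> \<le> \<bar>sin ((s - t)/2)\<bar>" by (cases "s \<ge> t") (auto simp: abs_if)
  finally show ?thesis unfolding dist_cis by simp
qed

text \<open>Arcs are cut out by Euclidean balls of the plane so that the Vitali covering lemma for
  balls applies. Radius 3 already gives the whole circle, whose diameter is 2.\<close>

abbreviation arc :: "complex \<Rightarrow> real \<Rightarrow> complex set" where "arc \<zeta> r \<equiv> ball \<zeta> r \<inter> sphere 0 1"

lemma arc_sets [measurable]: "arc \<zeta> r \<in> sets Tmeas"
proof -
  have "arc \<zeta> r = sphere 0 1 \<inter> ball \<zeta> r" by auto
  moreover have "\<dots> \<in> sets (restrict_space borel (sphere 0 1))"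
    unfolding sets_restrict_space by (rule imageI) simp
  ultimately show ?thesis by (simp add: sets_Tmeas)
qed

lemma arc_param_sets: "{t\<in>{0..2*pi}. dist (cis t) \<zeta> < r} \<in> sets borel"
proof -
  have "open {t. dist (cis t) \<zeta> < r}" by (intro open_Collect_less continuous_intros)
  then have "{0..2*pi} \<inter> {t. dist (cis t) \<zeta> < r} \<in> sets borel" by (intro sets.Int) auto
  moreover have "{0..2*pi} \<inter> {t. dist (cis t) \<zeta> < r} = {t\<in>{0..2*pi}. dist (cis t) \<zeta> < r}" by auto
  ultimately show ?thesis by simp
qed

lemma emeasure_arc:
  "emeasure Tmeas (arc \<zeta> r) = ennreal (1/(2*pi)) * emeasure lborel {t\<in>{0..2*pi}. dist (cis t) \<zeta> < r}"
proof -
  note o = arc_param_sets[of \<zeta> r]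
  have "emeasure Tmeas (arc \<zeta> r) = (\<integral>\<^sup>+z. indicator (arc \<zeta> r) z \<partial>Tmeas)"
    by (rule nn_integral_indicator[symmetric]) simp
  also have "\<dots> = ennreal (1/(2*pi)) * (\<integral>\<^sup>+t. indicator (arc \<zeta> r) (cis t) * indicator {0..2*pi} t \<partial>lborel)"
    by (rule nn_integral_Tmeas) simp
  also have "(\<integral>\<^sup>+t. indicator (arc \<zeta> r) (cis t) * indicator {0..2*pi} t \<partial>lborel)
     = (\<integral>\<^sup>+t. indicator {t\<in>{0..2*pi}. dist (cis t) \<zeta> < r} t \<partial>lborel)"
    by (rule nn_integral_cong) (auto split: split_indicator simp: dist_commute)
  also have "\<dots> = emeasure lborel {t\<in>{0..2*pi}. dist (cis t) \<zeta> < r}"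
    by (rule nn_integral_indicator) (use o in simp)
  finally show ?thesis .
qed

lemma circle_cis: "cmod \<zeta> = 1 \<Longrightarrow> \<exists>t\<in>{0..2*pi}. \<zeta> = cis t"
  using Arg2pi_eq[of \<zeta>] Arg2pi_ge_0[of \<zeta>] Arg2pi_lt_2pi[of \<zeta>]
  by (intro bexI[of _ "Arg2pi \<zeta>"]) (auto simp: cis_conv_exp)

lemma emeasure_arc_ge:
  assumes "cmod \<zeta> = 1" "0 < r" "r \<le> 3"
  shows "emeasure Tmeas (arc \<zeta> r) \<ge> ennreal (r / (2*pi))"
proof -
  obtain s where s: "s \<in> {0..2*pi}" "\<zeta> = cis s" using circle_cis[OF assms(1)] by auto
  have r: "r \<le> pi" using assms(3) pi_gt3 by simp
  \<comment> \<open>The half of the arc that points into \<open>{0..2*pi}\<close> is enough for a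
    lower bound and avoids wrapping around; it fits because \<open>r <= 3 < pi\<close>.\<close>
  define I where "I = (if s \<le> pi then {s<..<s + r} else {s - r<..<s})"
  have "I \<subseteq> {t\<in>{0..2*pi}. dist (cis t) \<zeta> < r}"
  proof
    fix t assume t: "t \<in> I"
    then have "\<bar>t - s\<bar> < r" by (auto simp: I_def split: if_splits)
    then have "dist (cis t) \<zeta> < r" using dist_cis_le[of t s] s by simp
    then show "t \<in> {t\<in>{0..2*pi}. dist (cis t) \<zeta> < r}" using t s r by (auto simp: I_def split: if_splits)
  qed
  then have "emeasure lborel I \<le> emeasure lborel {t\<in>{0..2*pi}. dist (cis t) \<zeta> < r}"
    by (rule emeasure_mono) (use arc_param_sets in simp)
  moreover have "emeasure lborel I = ennreal r" using assms by (simp add: I_def)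
  ultimately have "ennreal (1/(2*pi)) * ennreal r \<le> emeasure Tmeas (arc \<zeta> r)"
    unfolding emeasure_arc by (intro mult_left_mono) auto
  then show ?thesis using assms by (simp add: ennreal_mult[symmetric])
qed

lemma emeasure_arc_le:
  assumes "cmod \<zeta> = 1" "0 < r"
  shows "emeasure Tmeas (arc \<zeta> r) \<le> ennreal (2 * r)"
proof -
  obtain s where s: "s \<in> {0..2*pi}" "\<zeta> = cis s" using circle_cis[OF assms(1)] by auto
  \<comment> \<open>By Jordan's inequality a chord shorter than \<open>r\<close> belongs to an angle
    of at most \<open>pi / 2 * r\<close>.\<close>
  define h where "h = pi/2 * r"
  have h: "0 < h" using assms by (simp add: h_def)
  have near: "\<bar>t - s\<bar> \<le> h" if "dist (cis t) (cis s) < r" "\<bar>t - s\<bar> \<le> pi" for t s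
  proof -
    have "2 / pi * \<bar>t - s\<bar> \<le> r" using dist_cis_ge[OF that(2)] that(1) by simp
    then show ?thesis by (simp add: h_def field_simps)
  qed
  have per: "cis (s + 2*pi) = cis s" "cis (s - 2*pi) = cis s"
    by (simp_all add: cis_mult[symmetric] cis_divide[symmetric])
  \<comment> \<open>The second and third interval catch parameters that are near \<open>s\<close>
    only modulo \<open>2 * pi\<close>. The lengths add up to \<open>4 * h = 2 * pi * r\<close>, so
    the normalized measure is at most \<open>r\<close>; the stated bound has slack.\<close>
  have "{t\<in>{0..2*pi}. dist (cis t) \<zeta> < r} \<subseteq> {s - h..s + h} \<union> {s + 2*pi - h..s + 2*pi} \<union> {s - 2*pi..s - 2*pi + h}"
  proof
    fix t assume t: "t \<in> {t\<in>{0..2*pi}. dist (cis t) \<zeta> < r}"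
    then have d: "dist (cis t) (cis s) < r" "dist (cis t) (cis (s + 2*pi)) < r" "dist (cis t) (cis (s - 2*pi)) < r"
      using s by (simp_all add: per)
    consider "\<bar>t - s\<bar> \<le> pi" | "t - s > pi" | "t - s < - pi" by linarith
    then show "t \<in> {s - h..s + h} \<union> {s + 2*pi - h..s + 2*pi} \<union> {s - 2*pi..s - 2*pi + h}"
    proof cases
      case 1 then show ?thesis using near[OF d(1)] by auto
    next
      case 2 then have "\<bar>t - (s + 2*pi)\<bar> \<le> pi" using t s by auto
      from near[OF d(2) this] show ?thesis using t s by auto
    next
      case 3 then have "\<bar>t - (s - 2*pi)\<bar> \<le> pi" using t s by auto
      from near[OF d(3) this] show ?thesis using t s by auto
    qed
  qed
  then have "emeasure lborel {t\<in>{0..2*pi}. dist (cis t) \<zeta> < r}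
    \<le> emeasure lborel ({s - h..s + h} \<union> {s + 2*pi - h..s + 2*pi} \<union> {s - 2*pi..s - 2*pi + h})"
    by (rule emeasure_mono) simp
  also have "\<dots> \<le> emeasure lborel {s - h..s + h} + emeasure lborel {s + 2*pi - h..s + 2*pi} + emeasure lborel {s - 2*pi..s - 2*pi + h}"
    by (rule order_trans[OF emeasure_subadditive add_mono[OF emeasure_subadditive order_refl]]) auto
  also have "\<dots> = ennreal (4 * h)" using h by (simp add: ennreal_plus[symmetric] del: ennreal_plus)
  finally have "ennreal (1/(2*pi)) * emeasure lborel {t\<in>{0..2*pi}. dist (cis t) \<zeta> < r} \<le> ennreal (1/(2*pi)) * ennreal (4 * h)"
    by (rule mult_left_mono) simp
  also have "\<dots> = ennreal r" using h by (simp add: ennreal_mult[symmetric] h_def)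
  also have "\<dots> \<le> ennreal (2 * r)" using assms by (intro ennreal_leI) simp
  finally show ?thesis unfolding emeasure_arc .
qed

text \<open>The dilation by 5 comes from the Vitali lemma; \<open>20 * pi\<close> is the quotient of
  the upper bound \<open>2 * (5 * r)\<close> and the lower bound
  \<open>r / (2 * pi)\<close>.\<close>

lemma arc_doubling:
  assumes "cmod \<zeta> = 1" "0 < r" "r \<le> 3"
  shows "emeasure Tmeas (arc \<zeta> (5 * r)) \<le> ennreal (20 * pi) * emeasure Tmeas (arc \<zeta> r)"
proof -
  have "emeasure Tmeas (arc \<zeta> (5 * r)) \<le> ennreal (2 * (5 * r))"
    using assms by (intro emeasure_arc_le) auto
  also have "\<dots> = ennreal (20 * pi) * ennreal (r / (2 * pi))"
    using assms by (subst ennreal_mult[symmetric]) auto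
  also have "\<dots> \<le> ennreal (20 * pi) * emeasure Tmeas (arc \<zeta> r)"
    by (intro mult_left_mono emeasure_arc_ge assms) simp
  finally show ?thesis .
qed

text \<open>The weak type inequality of Hardy and Littlewood, stated through a measurable
  exceptional set \<open>A\<close>, so that measurability of a maximal function does not arise.
  Among the arcs with large mean, whose radii are bounded by 3, Vitali's lemma selects countably
  many disjoint ones whose fivefold dilates cover the rest.\<close>

lemma weak_type_maximal:
  fixes g :: "complex \<Rightarrow> ennreal"
  assumes [measurable]: "g \<in> borel_measurable Tmeas" and d: "d > 0"
  obtains A where "A \<in> sets Tmeas" "emeasure Tmeas A \<le> ennreal (20 * pi / d) * (\<integral>\<^sup>+z. g z \<partial>Tmeas)"
    "\<And>\<zeta> r. \<lbrakk>cmod \<zeta> = 1; \<zeta> \<notin> A; 0 < r; r \<le> 3\<rbrakk> \<Longrightarrow>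
       (\<integral>\<^sup>+z. g z * indicator (arc \<zeta> r) z \<partial>Tmeas) \<le> ennreal d * emeasure Tmeas (arc \<zeta> r)"
proof -
  define K where "K = {(\<zeta>, r). cmod \<zeta> = 1 \<and> 0 < r \<and> r \<le> 3 \<and>
       ennreal d * emeasure Tmeas (arc \<zeta> r) < (\<integral>\<^sup>+z. g z * indicator (arc \<zeta> r) z \<partial>Tmeas)}"
  have Kr: "\<And>i. i \<in> K \<Longrightarrow> 0 < snd i \<and> snd i \<le> 3" by (auto simp: K_def)
  obtain C where C: "countable C" "C \<subseteq> K"
    "pairwise (\<lambda>i j. disjnt (ball (fst i) (snd i)) (ball (fst j) (snd j))) C"
    "(\<Union>i\<in>K. ball (fst i) (snd i)) \<subseteq> (\<Union>i\<in>C. ball (fst i) (5 * snd i))"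
    by (rule Vitali_covering_lemma_balls[OF order_refl Kr]) blast
  define A where "A = (\<Union>i\<in>C. arc (fst i) (5 * snd i))"
  have "A \<in> sets Tmeas" unfolding A_def by (intro sets.countable_UN' C(1)) auto
  moreover have "emeasure Tmeas A \<le> ennreal (20 * pi / d) * (\<integral>\<^sup>+z. g z \<partial>Tmeas)"
  proof -
    \<comment> \<open>Sums over the countable family \<open>C\<close> are integrals for the counting
      measure, which allows exchanging them with integrals over the circle.\<close>
    have "emeasure Tmeas A \<le> (\<integral>\<^sup>+i. emeasure Tmeas (arc (fst i) (5 * snd i)) \<partial>count_space C)"
    proof -
      have "emeasure Tmeas A = (\<integral>\<^sup>+z. indicator A z \<partial>Tmeas)"
        using \<open>A \<in> sets Tmeas\<close> by simp
      also have "\<dots> \<le> (\<integral>\<^sup>+z. (\<integral>\<^sup>+i. indicator (arc (fst i) (5 * snd i)) z \<partial>count_space C) \<partial>Tmeas)"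
      proof (rule nn_integral_mono)
        fix z
        show "indicator A z \<le> (\<integral>\<^sup>+i. indicator (arc (fst i) (5 * snd i)) z \<partial>count_space C)"
        proof (cases "z \<in> A")
          case True
          then obtain i where i: "i \<in> C" "z \<in> arc (fst i) (5 * snd i)" unfolding A_def by blast
          have "indicator (arc (fst i) (5 * snd i)) z \<le> (\<integral>\<^sup>+i. indicator (arc (fst i) (5 * snd i)) z \<partial>count_space C)"
            by (rule nn_integral_ge_point[OF i(1)])
          then show ?thesis using True i by simp
        qed simp
      qed
      also have "\<dots> = (\<integral>\<^sup>+i. (\<integral>\<^sup>+z. indicator (arc (fst i) (5 * snd i)) z \<partial>Tmeas) \<partial>count_space C)"
        by (rule nn_integral_count_space_nn_integral[OF C(1), where f = "\<lambda>i z. indicator (arc (fst i) (5 * snd i)) z"]) measurable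
      finally show ?thesis by simp
    qed
    also have "\<dots> \<le> (\<integral>\<^sup>+i. ennreal (20 * pi / d) * (\<integral>\<^sup>+z. g z * indicator (arc (fst i) (snd i)) z \<partial>Tmeas) \<partial>count_space C)"
    proof (rule nn_integral_mono)
      fix i assume "i \<in> space (count_space C)"
      then have "i \<in> K" using C by auto
      then have i: "cmod (fst i) = 1" "0 < snd i" "snd i \<le> 3"
        "ennreal d * emeasure Tmeas (arc (fst i) (snd i)) < (\<integral>\<^sup>+z. g z * indicator (arc (fst i) (snd i)) z \<partial>Tmeas)"
        by (auto simp: K_def case_prod_unfold)
      have "emeasure Tmeas (arc (fst i) (5 * snd i)) \<le> ennreal (20 * pi) * emeasure Tmeas (arc (fst i) (snd i))"
        by (intro arc_doubling i)
      also have "\<dots> = ennreal (20 * pi / d) * (ennreal d * emeasure Tmeas (arc (fst i) (snd i)))"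
        using d by (simp add: mult.assoc[symmetric] ennreal_mult[symmetric])
      also have "\<dots> \<le> ennreal (20 * pi / d) * (\<integral>\<^sup>+z. g z * indicator (arc (fst i) (snd i)) z \<partial>Tmeas)"
        by (rule mult_left_mono[OF less_imp_le[OF i(4)]]) simp
      finally show "emeasure Tmeas (arc (fst i) (5 * snd i)) \<le> ennreal (20 * pi / d) * (\<integral>\<^sup>+z. g z * indicator (arc (fst i) (snd i)) z \<partial>Tmeas)" .
    qed
    also have "\<dots> = ennreal (20 * pi / d) * (\<integral>\<^sup>+i. (\<integral>\<^sup>+z. g z * indicator (arc (fst i) (snd i)) z \<partial>Tmeas) \<partial>count_space C)"
      by (rule nn_integral_cmult) simp
    also have "(\<integral>\<^sup>+i. (\<integral>\<^sup>+z. g z * indicator (arc (fst i) (snd i)) z \<partial>Tmeas) \<partial>count_space C)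
        = (\<integral>\<^sup>+z. (\<integral>\<^sup>+i. g z * indicator (arc (fst i) (snd i)) z \<partial>count_space C) \<partial>Tmeas)"
      by (rule nn_integral_count_space_nn_integral[OF C(1), symmetric, where f = "\<lambda>i z. g z * indicator (arc (fst i) (snd i)) z"]) measurable
    \<comment> \<open>The selected balls are disjoint, so at most one term of the inner integral is
      nonzero.\<close>
    also have "\<dots> \<le> (\<integral>\<^sup>+z. g z \<partial>Tmeas)"
    proof (rule nn_integral_mono)
      fix z
      show "(\<integral>\<^sup>+i. g z * indicator (arc (fst i) (snd i)) z \<partial>count_space C) \<le> g z"
      proof (cases "\<exists>i\<in>C. z \<in> arc (fst i) (snd i)")
        case True
        then obtain i where i: "i \<in> C" "z \<in> arc (fst i) (snd i)" by blast
        have "z \<notin> arc (fst j) (snd j)" if "j \<in> C" "j \<noteq> i" for j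
          using C(3) i that unfolding pairwise_def disjnt_def by blast
        then have "(\<integral>\<^sup>+j. g z * indicator (arc (fst j) (snd j)) z \<partial>count_space C) = (\<integral>\<^sup>+j. g z * indicator {i} j \<partial>count_space C)"
          using i by (intro nn_integral_cong) (auto split: split_indicator)
        also have "\<dots> = g z" using i by (subst nn_integral_cmult_indicator) (auto simp: emeasure_count_space)
        finally show ?thesis by simp
      next
        case False
        then have "(\<integral>\<^sup>+i. g z * indicator (arc (fst i) (snd i)) z \<partial>count_space C) = (\<integral>\<^sup>+i. 0 \<partial>count_space C)"
          by (intro nn_integral_cong) (auto split: split_indicator)
        then show ?thesis by simp
      qed
    qed
    finally show ?thesis using d by (simp add: mult_left_mono)
  qed
  moreover have "(\<integral>\<^sup>+z. g z * indicator (arc \<zeta> r) z \<partial>Tmeas) \<le> ennreal d * emeasure Tmeas (arc \<zeta> r)"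
    if "cmod \<zeta> = 1" "\<zeta> \<notin> A" "0 < r" "r \<le> 3" for \<zeta> r
  proof (rule ccontr)
    assume "\<not> ?thesis"
    then have k: "(\<zeta>, r) \<in> K" using that by (simp add: K_def not_le)
    then have "\<zeta> \<in> (\<Union>i\<in>K. ball (fst i) (snd i))" using that(3) by (intro UN_I[OF k]) simp
    with C(4) have "\<zeta> \<in> (\<Union>i\<in>C. ball (fst i) (5 * snd i))" by (rule subsetD)
    then have "\<zeta> \<in> A" using that(1) by (auto simp: A_def)
    then show False using that by simp
  qed
  ultimately show ?thesis using that by blast
qed

section \<open>Poisson means\<close>

text \<open>The Poisson kernel: for points of the circle the usual denominator, the squared modulus
  of \<open>1 - r * cnj \<zeta> * z\<close>, takes this form. Written with the distance, it shows
  that the kernel depends on \<open>dist \<zeta> z\<close> alone and does not increase with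
  it.\<close>

definition pois :: "real \<Rightarrow> complex \<Rightarrow> complex \<Rightarrow> real" where
  "pois r \<zeta> z = (1 - r\<^sup>2) / ((1 - r)\<^sup>2 + r * (dist \<zeta> z)\<^sup>2)"

lemma cont_pois:
  assumes "0 \<le> r" "r < 1"
  shows "continuous_on UNIV (pois r \<zeta>)"
proof -
  have "(1 - r)\<^sup>2 + r * (dist \<zeta> z)\<^sup>2 \<noteq> 0" for z
    using assms by (intro less_imp_neq[symmetric] add_pos_nonneg) auto
  then show ?thesis unfolding pois_def[abs_def] by (intro continuous_intros) auto
qed

lemma pois_nonneg: "0 \<le> r \<Longrightarrow> r < 1 \<Longrightarrow> 0 \<le> pois r \<zeta> z"
  unfolding pois_def by (intro divide_nonneg_nonneg) (auto simp: power_le_one)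

lemma bdd_sym_pois: "0 \<le> r \<Longrightarrow> r < 1 \<Longrightarrow> bdd_sym (\<lambda>z. complex_of_real (pois r \<zeta> z))"
  by (intro bdd_sym_cont continuous_intros continuous_on_subset[OF cont_pois]) auto

lemma pois_measurable: "0 \<le> r \<Longrightarrow> r < 1 \<Longrightarrow> pois r \<zeta> \<in> borel_measurable Tmeas"
  by (intro borel_measurable_Tmeas_cont continuous_on_subset[OF cont_pois]) auto

lemma pois_szego:
  assumes "0 \<le> r" "r < 1" "cmod \<zeta> = 1" "cmod z = 1"
  shows "complex_of_real (pois r \<zeta> z) = szego (of_real r * \<zeta>) z + cnj (szego (of_real r * \<zeta>) z) - 1"
proof -
  define w where "w = of_real r * \<zeta>"
  define a where "a = 1 - cnj w * z"
  have w: "cmod w = r" using assms by (simp add: w_def norm_mult)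
  have a0: "a \<noteq> 0" unfolding a_def using szego_denom[of w z] assms w by simp
  have "szego w z + cnj (szego w z) - 1 = (a + cnj a - a * cnj a) / (a * cnj a)"
  proof -
    have k: "szego w z = 1 / a" "cnj (szego w z) = 1 / cnj a" by (simp_all add: szego_def a_def)
    show ?thesis unfolding k using a0 by (simp add: field_simps)
  qed
  also have "a + cnj a - a * cnj a = 1 - (1 - a) * cnj (1 - a)" by (simp add: algebra_simps)
  also have "\<dots> = of_real (1 - r\<^sup>2)"
    using assms w unfolding complex_norm_square[symmetric] by (simp add: a_def norm_mult)
  also have "a * cnj a = of_real ((cmod a)\<^sup>2)" by (rule complex_norm_square[symmetric])
  also have "(cmod a)\<^sup>2 = (1 - r)\<^sup>2 + r * (dist \<zeta> z)\<^sup>2"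
  proof -
    have z2: "(Re z)\<^sup>2 + (Im z)\<^sup>2 = 1" "(Re \<zeta>)\<^sup>2 + (Im \<zeta>)\<^sup>2 = 1"
      using assms by (simp_all add: cmod_def)
    have "(cmod a)\<^sup>2 = 1 - 2 * r * (Re \<zeta> * Re z + Im \<zeta> * Im z) + r\<^sup>2 * (((Re z)\<^sup>2 + (Im z)\<^sup>2) * ((Re \<zeta>)\<^sup>2 + (Im \<zeta>)\<^sup>2))"
      unfolding cmod_power2 a_def w_def by (simp add: power2_eq_square algebra_simps)
    moreover have "(dist \<zeta> z)\<^sup>2 = ((Re z)\<^sup>2 + (Im z)\<^sup>2) + ((Re \<zeta>)\<^sup>2 + (Im \<zeta>)\<^sup>2) - 2 * (Re \<zeta> * Re z + Im \<zeta> * Im z)"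
      unfolding dist_norm cmod_power2 by (simp add: power2_eq_square algebra_simps)
    ultimately show ?thesis unfolding z2 by (simp add: power2_diff right_diff_distrib distrib_left)
  qed
  finally show ?thesis by (simp add: pois_def w_def)
qed

text \<open>The Poisson kernel is the Szego kernel plus its conjugate minus 1. Against a Hardy
  vector the conjugate part only yields the value at 0, which the constant cancels.\<close>

lemma cip_pois:
  assumes r: "0 \<le> r" "r < 1" and z: "cmod \<zeta> = 1" and x: "x \<in> Hardy"
  shows "cip x (kvec (of_real r * \<zeta>)) = cip x (cl (\<lambda>z. of_real (pois r \<zeta> z)))"
proof -
  define w where "w = of_real r * \<zeta>"
  have w: "cmod w < 1" using assms by (simp add: w_def norm_mult)
  have kL: "(\<lambda>z. cnj (szego w z)) \<in> L2" by (intro L2_bdd_sym bdd_sym_cnj bdd_sym_szego w)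
  have "cl (\<lambda>z. of_real (pois r \<zeta> z)) = cl (\<lambda>z. (szego w z + cnj (szego w z)) - 1)"
  proof (subst cl_eq_iff)
    show "(\<lambda>z. complex_of_real (pois r \<zeta> z)) \<in> L2" by (intro L2_bdd_sym bdd_sym_pois r)
    show "(\<lambda>z. szego w z + cnj (szego w z) - 1) \<in> L2" by (rule L2_diff[OF L2_add[OF szego_L2[OF w] kL] L2_const])
    show "aeq (\<lambda>z. complex_of_real (pois r \<zeta> z)) (\<lambda>z. szego w z + cnj (szego w z) - 1)"
      unfolding aeq_def by (rule AE_I2) (use pois_szego[OF r z] in \<open>simp add: w_def[symmetric]\<close>)
  qed
  also have "\<dots> = kvec w + cl (\<lambda>z. cnj (szego w z)) - zpow 0"
    by (simp add: cl_diff cl_add L2_add kL szego_L2 w L2_const kvec_def zpow_def)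
  also have "cl (\<lambda>z. cnj (szego w z)) = mulop (\<lambda>z. cnj (szego w z)) (zpow 0)"
    by (simp add: zpow_def mulop_cl bdd_sym_cnj bdd_sym_szego w L2_const)
  finally have "cip x (cl (\<lambda>z. of_real (pois r \<zeta> z))) = cip x (kvec w) + cip (mulop (szego w) x) (zpow 0) - cip x (zpow 0)"
    by (simp add: cip_right_diff cip_add_right cip_mulop bdd_sym_szego w)
  \<comment> \<open>\<open>szego w\<close> has value 1 at 0, so multiplying by it does not change
    the value at 0.\<close>
  also have "cip (mulop (szego w) x) (zpow 0) = cip x (zpow 0)"
    using cip_szego_kvec[OF w, of 0 x] x by (simp add: kvec_0 szego_def)
  finally show ?thesis by (simp add: w_def)
qed

text \<open>The constant 1 is a Hardy vector whose value at every point of the disc is 1.\<close>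

lemma nn_integral_pois:
  assumes r: "0 \<le> r" "r < 1" and z: "cmod \<zeta> = 1"
  shows "(\<integral>\<^sup>+z. ennreal (pois r \<zeta> z) \<partial>Tmeas) = 1"
proof -
  have i: "integrable Tmeas (\<lambda>z. complex_of_real (pois r \<zeta> z))"
    using L2_prod_integrable[OF L2_bdd_sym[OF bdd_sym_pois[OF r]] L2_const[of 1]] by simp
  have w: "cmod (of_real r * \<zeta>) < 1" using assms by (simp add: norm_mult)
  have "1 = cip (zpow 0) (cl (\<lambda>z. of_real (pois r \<zeta> z)))"
    using cip_pois[OF r z, of "zpow 0"] cip_one_kvec[OF w] by (simp add: Hardy_zpow)
  also have "\<dots> = (\<integral>z. complex_of_real (pois r \<zeta> z) \<partial>Tmeas)"
    by (simp add: zpow_def cip_cl L2_const L2_bdd_sym bdd_sym_pois r l2ip_def)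
  finally have "(\<integral>z. pois r \<zeta> z \<partial>Tmeas) = 1" by simp
  moreover have "integrable Tmeas (pois r \<zeta>)"
    using integrable_bounded_linear[OF bounded_linear_Re i] by simp
  ultimately show ?thesis by (subst nn_integral_eq_integral) (auto simp: pois_nonneg r)
qed

lemma pois_superlevel:
  assumes r: "0 \<le> r" "r < 1" and y: "0 \<le> y" and z1: "cmod \<zeta> = 1"
  shows "(\<exists>\<rho>. 0 < \<rho> \<and> \<rho> \<le> 3 \<and> (\<forall>z\<in>sphere 0 1. y < pois r \<zeta> z \<longleftrightarrow> z \<in> arc \<zeta> \<rho>)) \<or>
    (\<forall>z\<in>sphere 0 1. \<not> y < pois r \<zeta> z)"
proof -
  have d2: "dist \<zeta> z \<le> 2" if "z \<in> sphere 0 1" for z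
    using that z1 norm_triangle_ineq4[of \<zeta> z] by (simp add: dist_norm)
  have pos: "(1 - r)\<^sup>2 + r * (dist \<zeta> z)\<^sup>2 > 0" for z using r by (intro add_pos_nonneg) auto
  have iff: "y < pois r \<zeta> z \<longleftrightarrow> y * (r * (dist \<zeta> z)\<^sup>2) < 1 - r\<^sup>2 - y * (1 - r)\<^sup>2" for z
    using pos[of z] by (auto simp: pois_def pos_less_divide_eq algebra_simps)
  \<comment> \<open>The inequality reads \<open>y * r * (dist \<zeta> z)^2 < q\<close>: impossible
    for \<open>q <= 0\<close>, always true if \<open>q > 0\<close> and \<open>y * r = 0\<close>, and
    otherwise an upper bound on the distance.\<close>
  define q where "q = 1 - r\<^sup>2 - y * (1 - r)\<^sup>2"
  consider "q \<le> 0" | "q > 0" "y * r = 0" | "q > 0" "y * r > 0" using y r by (metis less_eq_real_def mult_nonneg_nonneg not_le)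
  then show ?thesis
  proof cases
    case 1
    have "0 \<le> y * (r * (dist \<zeta> z)\<^sup>2)" for z using y r by simp
    then show ?thesis using 1 unfolding iff q_def[symmetric] by (meson le_less_trans not_le order_trans)
  next
    case 2
    then have "y < pois r \<zeta> z" for z unfolding iff q_def[symmetric] by auto
    then show ?thesis using d2 by (intro disjI1 exI[of _ 3]) force
  next
    case 3
    define s where "s = sqrt (q / (y * r))"
    have s: "s > 0" using 3 by (simp add: s_def)
    have *: "y < pois r \<zeta> z \<longleftrightarrow> dist \<zeta> z < s" for z
    proof -
      have "y < pois r \<zeta> z \<longleftrightarrow> (dist \<zeta> z)\<^sup>2 < q / (y * r)"
        unfolding iff q_def[symmetric] using 3 by (simp add: pos_less_divide_eq mult_ac)
      also have "\<dots> \<longleftrightarrow> (dist \<zeta> z)\<^sup>2 < s\<^sup>2" using 3 by (simp add: s_def)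
      also have "\<dots> \<longleftrightarrow> dist \<zeta> z < s" using s by (metis less_eq_real_def power2_less_imp_less power_strict_mono zero_le_dist zero_less_numeral)
      finally show ?thesis .
    qed
    have "y < pois r \<zeta> z \<longleftrightarrow> z \<in> arc \<zeta> (min s 3)" if "z \<in> sphere 0 1" for z
      using d2[OF that] that by (auto simp: *)
    then show ?thesis using s by (intro disjI1 exI[of _ "min s 3"]) auto
  qed
qed

text \<open>The superlevel sets of the Poisson kernel are arcs around the boundary point, so a layer-cake
  decomposition bounds Poisson means by averages over arcs.\<close>

lemma pois_le_maximal:
  fixes g :: "complex \<Rightarrow> ennreal"
  assumes [measurable]: "g \<in> borel_measurable Tmeas" and z: "cmod \<zeta> = 1" and r: "0 \<le> r" "r < 1"
    and H: "\<And>\<rho>. \<lbrakk>0 < \<rho>; \<rho> \<le> 3\<rbrakk> \<Longrightarrow> (\<integral>\<^sup>+z. g z * indicator (arc \<zeta> \<rho>) z \<partial>Tmeas) \<le> ennreal d * emeasure Tmeas (arc \<zeta> \<rho>)"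
  shows "(\<integral>\<^sup>+z. g z * ennreal (pois r \<zeta> z) \<partial>Tmeas) \<le> ennreal d"
proof -
  note [measurable] = pois_measurable[OF r, of \<zeta>]
  interpret pair_sigma_finite Tmeas lborel ..
  define I :: "complex \<Rightarrow> real \<Rightarrow> ennreal" where "I z y = (if 0 \<le> y \<and> y < pois r \<zeta> z then 1 else 0)" for z y
  have I_meas [measurable]: "(\<lambda>(z, y). I z y) \<in> borel_measurable (Tmeas \<Otimes>\<^sub>M lborel)"
    unfolding I_def by measurable
  have lc: "ennreal (pois r \<zeta> z) = (\<integral>\<^sup>+y. I z y \<partial>lborel)" for z
  proof -
    have "(\<integral>\<^sup>+y. I z y \<partial>lborel) = (\<integral>\<^sup>+y. indicator {0..<pois r \<zeta> z} y \<partial>lborel)"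
      by (intro nn_integral_cong) (auto simp: I_def split: split_indicator)
    then show ?thesis using pois_nonneg[OF r, of \<zeta> z] by simp
  qed
  have le: "(\<integral>\<^sup>+z. g z * I z y \<partial>Tmeas) \<le> ennreal d * (\<integral>\<^sup>+z. I z y \<partial>Tmeas)" for y
  proof (cases "0 \<le> y")
    case y: True
    from pois_superlevel[OF r y z] show ?thesis
    proof
      assume "\<exists>\<rho>. 0 < \<rho> \<and> \<rho> \<le> 3 \<and> (\<forall>z\<in>sphere 0 1. y < pois r \<zeta> z \<longleftrightarrow> z \<in> arc \<zeta> \<rho>)"
      then obtain \<rho> where \<rho>: "0 < \<rho>" "\<rho> \<le> 3" "\<And>z. z \<in> sphere 0 1 \<Longrightarrow> y < pois r \<zeta> z \<longleftrightarrow> z \<in> arc \<zeta> \<rho>"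
        by auto
      have I: "I z y = indicator (arc \<zeta> \<rho>) z" if "z \<in> space Tmeas" for z
        using \<rho>(3)[of z] that y by (simp add: I_def split: split_indicator)
      have "(\<integral>\<^sup>+z. g z * I z y \<partial>Tmeas) = (\<integral>\<^sup>+z. g z * indicator (arc \<zeta> \<rho>) z \<partial>Tmeas)"
        by (intro nn_integral_cong) (simp only: I)
      also have "\<dots> \<le> ennreal d * emeasure Tmeas (arc \<zeta> \<rho>)" by (rule H[OF \<rho>(1,2)])
      also have "emeasure Tmeas (arc \<zeta> \<rho>) = (\<integral>\<^sup>+z. indicator (arc \<zeta> \<rho>) z \<partial>Tmeas)" by simp
      also have "\<dots> = (\<integral>\<^sup>+z. I z y \<partial>Tmeas)" by (intro nn_integral_cong) (simp only: I)
      finally show ?thesis .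
    next
      assume "\<forall>z\<in>sphere 0 1. \<not> y < pois r \<zeta> z"
      then have "(\<integral>\<^sup>+z. g z * I z y \<partial>Tmeas) = (\<integral>\<^sup>+z. 0 \<partial>Tmeas)"
        by (intro nn_integral_cong) (auto simp: I_def)
      then show ?thesis by simp
    qed
  next
    case False then show ?thesis by (simp add: I_def)
  qed
  have "(\<integral>\<^sup>+z. g z * ennreal (pois r \<zeta> z) \<partial>Tmeas) = (\<integral>\<^sup>+z. (\<integral>\<^sup>+y. g z * I z y \<partial>lborel) \<partial>Tmeas)"
    unfolding lc by (intro nn_integral_cong nn_integral_cmult[symmetric]) measurable
  also have "\<dots> = (\<integral>\<^sup>+y. (\<integral>\<^sup>+z. g z * I z y \<partial>Tmeas) \<partial>lborel)"
    by (rule Fubini'[symmetric, where f = "\<lambda>z y. g z * I z y"]) measurable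
  also have "\<dots> \<le> (\<integral>\<^sup>+y. ennreal d * (\<integral>\<^sup>+z. I z y \<partial>Tmeas) \<partial>lborel)"
    by (intro nn_integral_mono le)
  also have "\<dots> = ennreal d * (\<integral>\<^sup>+y. (\<integral>\<^sup>+z. I z y \<partial>Tmeas) \<partial>lborel)"
    by (rule nn_integral_cmult) measurable
  also have "(\<integral>\<^sup>+y. (\<integral>\<^sup>+z. I z y \<partial>Tmeas) \<partial>lborel) = (\<integral>\<^sup>+z. (\<integral>\<^sup>+y. I z y \<partial>lborel) \<partial>Tmeas)"
    by (rule Fubini') measurable
  also have "\<dots> = 1" unfolding lc[symmetric] by (rule nn_integral_pois[OF r z])
  finally show ?thesis by simp
qed

lemma cip_kvec_le_pois:
  assumes r: "0 \<le> r" "r < 1" and z: "cmod \<zeta> = 1" and x: "x \<in> Hardy"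
  shows "ennreal (cmod (cip x (kvec (of_real r * \<zeta>)))) \<le> (\<integral>\<^sup>+z. ennreal (cmod (rep_hil x z)) * ennreal (pois r \<zeta> z) \<partial>Tmeas)"
proof -
  have pL: "(\<lambda>z. complex_of_real (pois r \<zeta> z)) \<in> L2" by (intro L2_bdd_sym bdd_sym_pois r)
  have "cip x (kvec (of_real r * \<zeta>)) = cip (cl (rep_hil x)) (cl (\<lambda>z. of_real (pois r \<zeta> z)))"
    using cip_pois[OF assms] by simp
  also have "\<dots> = (\<integral>z. rep_hil x z * of_real (pois r \<zeta> z) \<partial>Tmeas)"
    by (subst cip_cl[OF rep_hil_L2 pL]) (simp add: l2ip_def)
  finally have "ennreal (cmod (cip x (kvec (of_real r * \<zeta>)))) \<le> (\<integral>\<^sup>+z. ennreal (norm (rep_hil x z * complex_of_real (pois r \<zeta> z))) \<partial>Tmeas)"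
    using integral_norm_bound_ennreal[OF L2_prod_integrable[OF rep_hil_L2 pL, of x]] by simp
  also have "\<dots> = (\<integral>\<^sup>+z. ennreal (cmod (rep_hil x z)) * ennreal (pois r \<zeta> z) \<partial>Tmeas)"
    using pois_nonneg[OF r] by (intro nn_integral_cong) (simp add: norm_mult ennreal_mult)
  finally show ?thesis .
qed

text \<open>Applied to the difference of a Blaschke product and a partial product, whose norm tends to 0,
  this gives Fatou's theorem for the Blaschke product.\<close>

lemma fatou_exceptional:
  assumes x: "x \<in> Hardy" and d: "d > 0"
  obtains A where "A \<in> sets Tmeas" "emeasure Tmeas A \<le> ennreal (81 / d * norm x)"
    "\<And>\<zeta> r. \<lbrakk>cmod \<zeta> = 1; \<zeta> \<notin> A; 0 \<le> r; r < 1\<rbrakk> \<Longrightarrow> cmod (cip x (kvec (of_real r * \<zeta>))) \<le> d"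
    "\<And>\<zeta>. \<lbrakk>cmod \<zeta> = 1; \<zeta> \<notin> A\<rbrakk> \<Longrightarrow> cmod (rep_hil x \<zeta>) \<le> d"
proof -
  define g where "g z = ennreal (cmod (rep_hil x z))" for z
  have [measurable]: "rep_hil x \<in> borel_measurable Tmeas" by (rule L2_measurable) simp
  have [measurable]: "g \<in> borel_measurable Tmeas" unfolding g_def by measurable
  have g1: "(\<integral>\<^sup>+z. g z \<partial>Tmeas) \<le> ennreal (norm x)"
    using L1_le_l2norm[OF rep_hil_L2, of x] norm_cl[OF rep_hil_L2, of x]
    unfolding g_def by (subst nn_integral_eq_integral) (auto simp: L2_integrable_cmod)
  obtain A where A: "A \<in> sets Tmeas" "emeasure Tmeas A \<le> ennreal (20 * pi / d) * (\<integral>\<^sup>+z. g z \<partial>Tmeas)"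
    "\<And>\<zeta> r. \<lbrakk>cmod \<zeta> = 1; \<zeta> \<notin> A; 0 < r; r \<le> 3\<rbrakk> \<Longrightarrow>
       (\<integral>\<^sup>+z. g z * indicator (arc \<zeta> r) z \<partial>Tmeas) \<le> ennreal d * emeasure Tmeas (arc \<zeta> r)"
    using weak_type_maximal[of g d] d by (metis \<open>g \<in> borel_measurable Tmeas\<close>)
  \<comment> \<open>The maximal estimate controls means of \<open>x\<close>; its own values are
    controlled off \<open>B\<close>, whose measure is bounded by Markov's inequality.\<close>
  define B where "B = {z \<in> space Tmeas. ennreal d \<le> g z}"
  have B: "B \<in> sets Tmeas" unfolding B_def by measurable
  have "ennreal d * emeasure Tmeas B \<le> (\<integral>\<^sup>+z. g z \<partial>Tmeas)"
  proof -
    have "ennreal d * emeasure Tmeas B = (\<integral>\<^sup>+z. ennreal d * indicator B z \<partial>Tmeas)"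
      using B by (simp add: nn_integral_cmult_indicator)
    also have "\<dots> \<le> (\<integral>\<^sup>+z. g z \<partial>Tmeas)"
      by (intro nn_integral_mono) (auto simp: B_def split: split_indicator)
    finally show ?thesis .
  qed
  then have "ennreal (1/d) * (ennreal d * emeasure Tmeas B) \<le> ennreal (1/d) * ennreal (norm x)"
    using g1 by (intro mult_left_mono) auto
  then have Bm: "emeasure Tmeas B \<le> ennreal (1/d) * ennreal (norm x)"
    using d by (simp add: mult.assoc[symmetric] ennreal_mult[symmetric])
  have "emeasure Tmeas A \<le> ennreal (20 * pi / d) * ennreal (norm x)"
    using A(2) by (rule order_trans) (intro mult_left_mono g1, simp)
  then have "emeasure Tmeas (A \<union> B) \<le> ennreal (20 * pi / d) * ennreal (norm x) + ennreal (1/d) * ennreal (norm x)"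
    using Bm by (intro order_trans[OF emeasure_subadditive[OF A(1) B]] add_mono)
  also have "\<dots> = ennreal ((20 * pi + 1) / d * norm x)"
    using d by (simp add: ennreal_mult[symmetric] ennreal_plus[symmetric] field_simps del: ennreal_plus)
  \<comment> \<open>81 is \<open>20 * 4 + 1\<close>: the constant \<open>20 * pi\<close> for
    \<open>A\<close> and 1 for \<open>B\<close>, with \<open>pi < 4\<close>.\<close>
  also have "\<dots> \<le> ennreal (81 / d * norm x)"
    using d pi_less_4 by (intro ennreal_leI mult_right_mono divide_right_mono) auto
  finally have AB: "emeasure Tmeas (A \<union> B) \<le> ennreal (81 / d * norm x)"
    using pi_less_4 by simp
  have C: "cmod (cip x (kvec (of_real r * \<zeta>))) \<le> d" if "cmod \<zeta> = 1" "\<zeta> \<notin> A \<union> B" "0 \<le> r" "r < 1" for \<zeta> r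
  proof -
    have "ennreal (cmod (cip x (kvec (of_real r * \<zeta>)))) \<le> (\<integral>\<^sup>+z. g z * ennreal (pois r \<zeta> z) \<partial>Tmeas)"
      unfolding g_def by (rule cip_kvec_le_pois) (use that x in auto)
    also have "\<dots> \<le> ennreal d"
      by (rule pois_le_maximal) (use that A(3) in auto)
    finally show ?thesis using d by simp
  qed
  have D: "cmod (rep_hil x \<zeta>) \<le> d" if "cmod \<zeta> = 1" "\<zeta> \<notin> A \<union> B" for \<zeta>
  proof -
    have "g \<zeta> < ennreal d" using that by (auto simp: B_def)
    then show ?thesis by (simp add: g_def ennreal_less_iff)
  qed
  show ?thesis by (rule that[of "A \<union> B", OF _ AB C D]) (use A B in auto)
qed

section \<open>Radial limits of Blaschke products\<close>

text \<open>The Cauchy criterion with natural numbers as parameters, so that the set of points with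
  a radial limit becomes a countable combination of simpler sets.\<close>

lemma radial_limit_iff:
  fixes f :: "real \<Rightarrow> complex"
  shows "(\<exists>L. (f \<longlongrightarrow> L) (at_left 1)) \<longleftrightarrow>
    (\<forall>m::nat. \<exists>N::nat. \<forall>p\<in>{1 - 1/(real N + 2)<..<1}. \<forall>q\<in>{1 - 1/(real N + 2)<..<1}. dist (f p) (f q) \<le> 1 / (real m + 1))"
    (is "?L \<longleftrightarrow> ?R")
proof
  assume ?L
  then obtain L where L: "(f \<longlongrightarrow> L) (at_left 1)" by blast
  show ?R
  proof
    fix m :: nat
    have "\<forall>\<^sub>F r in at_left 1. dist (f r) L < 1 / (2 * (real m + 1))"
      using L by (rule tendstoD) simp
    then obtain b where b: "b < 1" "\<And>r. b < r \<Longrightarrow> r < 1 \<Longrightarrow> dist (f r) L < 1 / (2 * (real m + 1))"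
      by (auto simp: eventually_at_left[of 0 "1::real"] intro!: exI[of _ 0])
    obtain N :: nat where N: "1 / (real N + 2) < 1 - b"
    proof -
      obtain N :: nat where "1 / (1 - b) < real N" using reals_Archimedean2 by blast
      then have "1 / (real N + 2) < 1 - b" using b(1) by (simp add: field_simps)
      then show ?thesis using that by blast
    qed
    have "dist (f p) (f q) \<le> 1 / (real m + 1)" if "p \<in> {1 - 1/(real N + 2)<..<1}" "q \<in> {1 - 1/(real N + 2)<..<1}" for p q
    proof -
      have "dist (f p) L < 1 / (2 * (real m + 1))" "dist (f q) L < 1 / (2 * (real m + 1))"
        by (rule b(2); use that N in force)+
      moreover have "1 / (2 * (real m + 1)) + 1 / (2 * (real m + 1)) = 1 / (real m + 1)"
        by (simp add: field_simps)
      ultimately have "dist (f p) L + dist (f q) L \<le> 1 / (real m + 1)"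
        by (metis add_strict_mono less_imp_le)
      then show ?thesis using dist_triangle2[of "f p" "f q" L] by linarith
    qed
    then show "\<exists>N::nat. \<forall>p\<in>{1 - 1/(real N + 2)<..<1}. \<forall>q\<in>{1 - 1/(real N + 2)<..<1}. dist (f p) (f q) \<le> 1 / (real m + 1)"
      by blast
  qed
next
  assume R: ?R
  define s where "s k = 1 - 1 / (real k + 3)" for k :: nat
  have sN: "s k \<in> {1 - 1/(real N + 2)<..<1}" if "N \<le> k" for k N
    using that by (auto simp: s_def field_simps)
  have "Cauchy (\<lambda>k. f (s k))"
  proof (rule metric_CauchyI)
    fix e :: real assume "e > 0"
    then obtain m :: nat where m: "1 / (real m + 1) < e" using nat_approx_posE[of e] by (metis of_nat_Suc add.commute)
    obtain N where "\<forall>p\<in>{1 - 1/(real N + 2)<..<1}. \<forall>q\<in>{1 - 1/(real N + 2)<..<1}. dist (f p) (f q) \<le> 1 / (real m + 1)"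
      using R by blast
    then show "\<exists>M. \<forall>m\<ge>M. \<forall>n\<ge>M. dist (f (s m)) (f (s n)) < e"
      using sN m by (meson le_less_trans)
  qed
  then obtain L where L: "(\<lambda>k. f (s k)) \<longlonglongrightarrow> L" using Cauchy_convergent_iff convergent_def by blast
  have "(f \<longlongrightarrow> L) (at_left 1)"
  proof (rule tendstoI)
    fix e :: real assume "e > 0"
    then obtain m :: nat where m: "1 / (real m + 1) < e" using nat_approx_posE[of e] by (metis of_nat_Suc add.commute)
    obtain N where N: "\<forall>p\<in>{1 - 1/(real N + 2)<..<1}. \<forall>q\<in>{1 - 1/(real N + 2)<..<1}. dist (f p) (f q) \<le> 1 / (real m + 1)"
      using R by blast
    have "dist (f p) L < e" if p: "p \<in> {1 - 1/(real N + 2)<..<1}" for p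
    proof -
      have "(\<lambda>k. dist (f p) (f (s k))) \<longlonglongrightarrow> dist (f p) L" by (intro tendsto_intros L)
      then have "dist (f p) L \<le> 1 / (real m + 1)"
        by (rule LIMSEQ_le_const2) (use N p sN in blast)
      then show ?thesis using m by simp
    qed
    then show "\<forall>\<^sub>F r in at_left 1. dist (f r) L < e"
      unfolding eventually_at_left[of 0 "1::real", simplified]
      by (intro exI[of _ "1 - 1/(real N + 2)"]) auto
  qed
  then show ?L by blast
qed

text \<open>For fixed \<open>m\<close> and \<open>N\<close> the Cauchy condition ranges over
  uncountably many radii, but each instance is a closed condition on \<open>z\<close>, so the
  intersection is closed too.\<close>

lemma radial_set_measurable:
  assumes c: "\<And>r::real. 0 \<le> r \<Longrightarrow> r < 1 \<Longrightarrow> continuous_on (sphere 0 1) (\<lambda>z. B (of_real r * z) :: complex)"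
  shows "{z \<in> sphere 0 1. \<exists>L. ((\<lambda>r::real. B (of_real r * z)) \<longlongrightarrow> L) (at_left 1)} \<in> sets Tmeas"
proof -
  \<comment> \<open>With \<open>N + 2\<close> all radii exceed \<open>1 / 2\<close>, so they are
    nonnegative, as the continuity hypothesis asks.\<close>
  define F where "F m N = (\<Inter>p\<in>{1 - 1/(real N + 2)<..<1}. \<Inter>q\<in>{1 - 1/(real N + 2)<..<1}.
     {z \<in> sphere 0 1. dist (B (of_real p * z)) (B (of_real q * z)) \<le> 1 / (real m + 1)})" for m N :: nat
  have ne: "{1 - 1/(real N + 2)<..<1} \<noteq> {}" for N :: nat by (simp add: greaterThanLessThan_empty_iff)
  have "closed (F m N)" for m N
    unfolding F_def
  proof (intro closed_INT ballI)
    fix p q assume pq: "p \<in> {1 - 1/(real N + 2)<..<1}" "q \<in> {1 - 1/(real N + 2)<..<1}"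
    have "1/(real N + 2) \<le> 1" by simp
    then have "0 \<le> p" "p < 1" "0 \<le> q" "q < 1" using pq unfolding greaterThanLessThan_iff by linarith+
    then have "continuous_on (sphere 0 1) (\<lambda>z. dist (B (of_real p * z)) (B (of_real q * z)))"
      by (intro continuous_intros c)
    then have "closed (sphere 0 1 \<inter> (\<lambda>z. dist (B (of_real p * z)) (B (of_real q * z))) -` {..1 / (real m + 1)})"
      by (intro continuous_closed_preimage) auto
    moreover have "sphere 0 1 \<inter> (\<lambda>z. dist (B (of_real p * z)) (B (of_real q * z))) -` {..1 / (real m + 1)} =
        {z \<in> sphere 0 1. dist (B (of_real p * z)) (B (of_real q * z)) \<le> 1 / (real m + 1)}" by auto
    ultimately show "closed {z \<in> sphere 0 1. dist (B (of_real p * z)) (B (of_real q * z)) \<le> 1 / (real m + 1)}" by simp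
  qed
  then have "(\<Inter>m. \<Union>N. F m N) \<in> sets borel" by (intro sets.countable_INT'' sets.countable_UN) auto
  moreover have "{z \<in> sphere 0 1. \<exists>L. ((\<lambda>r::real. B (of_real r * z)) \<longlongrightarrow> L) (at_left 1)} = sphere 0 1 \<inter> (\<Inter>m. \<Union>N. F m N)"
    unfolding radial_limit_iff F_def by auto
  ultimately show ?thesis unfolding sets_Tmeas sets_restrict_space by auto
qed

text \<open>For points at distance at least \<open>1 - r\<close> from the circle the kernels vary in
  a Lipschitz way, hence so does the evaluation of a fixed vector; this gives
  \<open>disc_cont\<close>.\<close>

lemma kvec_lipschitz:
  assumes "cmod w \<le> r" "cmod w' \<le> r" "r < 1"
  shows "norm (kvec w - kvec w') \<le> cmod (w - w') / (1 - r)\<^sup>2"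
proof -
  have ww: "cmod w < 1" "cmod w' < 1" using assms by auto
  have "kvec w - kvec w' = cl (\<lambda>z. (szego w z - szego w' z) * 1)"
    by (simp add: kvec_def cl_diff szego_L2 ww)
  then have "norm (kvec w - kvec w') = l2norm (\<lambda>z. (szego w z - szego w' z) * 1)"
    using L2_diff[OF szego_L2 szego_L2, OF ww] by (simp add: norm_cl)
  also have "\<dots> \<le> cmod (w - w') / (1 - r)\<^sup>2 * l2norm (\<lambda>z. 1)"
  proof (rule l2norm_mult_le)
    show "(\<lambda>z. szego w z - szego w' z) \<in> borel_measurable Tmeas"
      using L2_measurable[OF L2_diff[OF szego_L2 szego_L2, OF ww]] .
    fix z :: complex assume z: "cmod z = 1"
    have lb: "1 - r \<le> cmod (1 - cnj v * z)" if "cmod v \<le> r" for v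
      using norm_triangle_ineq2[of 1 "cnj v * z"] that z by (simp add: norm_mult)
    have nz: "1 - cnj w * z \<noteq> 0" "1 - cnj w' * z \<noteq> 0" using szego_denom ww z by auto
    have "szego w z - szego w' z = cnj (w - w') * z / ((1 - cnj w * z) * (1 - cnj w' * z))"
      using nz by (simp add: szego_def diff_frac_eq algebra_simps)
    then have "cmod (szego w z - szego w' z) = cmod (w - w') / (cmod (1 - cnj w * z) * cmod (1 - cnj w' * z))"
      using z by (simp add: norm_mult norm_divide del: complex_cnj_diff)
    also have "\<dots> \<le> cmod (w - w') / ((1 - r) * (1 - r))"
      using assms lb nz by (intro divide_left_mono mult_mono mult_pos_pos) auto
    finally show "cmod (szego w z - szego w' z) \<le> cmod (w - w') / (1 - r)\<^sup>2" by (simp add: power2_eq_square)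
  qed (auto simp: L2_const)
  also have "l2norm (\<lambda>z. 1) = 1" using Tm.prob_space by (simp add: l2norm_def)
  finally show ?thesis by simp
qed

context bzeros
begin

text \<open>The Blaschke product as a limit in norm. That the radial limits in
  \<open>blaschke lam\<close> define the same class is \<open>cl_blaschke\<close>.\<close>

definition u0 :: hil where "u0 = lim U"

lemma U_tendsto: "U \<longlonglongrightarrow> u0"
  using U_Cauchy by (simp add: u0_def Cauchy_convergent_iff convergent_LIMSEQ_iff)

lemma U_Hardy: "U n \<in> Hardy" by (simp add: U_def cl_bl Hardy_bl Hardy_zpow)

lemma u0_Hardy: "u0 \<in> Hardy" by (rule Hardy_closed[OF U_Hardy U_tendsto])

lemma bl_eq_cip: "cmod w < 1 \<Longrightarrow> bl {..<n} w = cip (U n) (kvec w)"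
  using cip_bl_kvec[of w "zpow 0" "{..<n}"] by (simp add: U_def cl_bl Hardy_zpow cip_one_kvec)

lemma bl_tendsto: "cmod w < 1 \<Longrightarrow> (\<lambda>n. bl {..<n} w) \<longlonglongrightarrow> cip u0 (kvec w)"
  unfolding bl_eq_cip by (intro cip_left_tendsto U_tendsto)

text \<open>Together with summability of \<open>1 - cmod (lam k)\<close> this makes the infinite
  product converge absolutely in the disc.\<close>

lemma one_minus_bfac:
  assumes "cmod l < 1" "cmod w < 1"
  shows "cmod (bfac l w - 1) \<le> (1 - cmod l) * (2 / (1 - cmod w))"
proof (cases "l = 0")
  case True
  have "cmod (w - 1) \<le> 2" using norm_triangle_ineq4[of w 1] assms by simp
  also have "\<dots> \<le> 2 / (1 - cmod w)" using assms by (simp add: field_simps)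
  finally show ?thesis using True by (simp add: bfac_def)
next
  case False
  have d: "1 - cnj l * w \<noteq> 0" using szego_denom[of l w] assms by simp
  have "1 - cmod w \<le> 1 - cmod l * cmod w" using assms mult_right_mono[of "cmod l" 1 "cmod w"] by simp
  also have "\<dots> \<le> cmod (1 - cnj l * w)" using norm_triangle_ineq2[of 1 "cnj l * w"] by (simp add: norm_mult)
  finally have lb: "1 - cmod w \<le> cmod (1 - cnj l * w)" .
  have ll: "cnj l * l = of_real (cmod l) * of_real (cmod l)"
    using complex_norm_square[of l] by (simp add: power2_eq_square mult.commute)
  \<comment> \<open>Because \<open>cnj l * l\<close> is the square of \<open>cmod l\<close>, the
    numerator has the factor \<open>1 - cmod l\<close>.\<close>
  have "bfac l w - 1 = - (of_real (1 - cmod l) * (l + of_real (cmod l) * w)) / (l * (1 - cnj l * w))"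
    using False d ll unfolding bfac_def
    by (simp add: divide_simps) (simp add: algebra_simps)
  then have "cmod (bfac l w - 1) = (1 - cmod l) * cmod (l + of_real (cmod l) * w) / (cmod l * cmod (1 - cnj l * w))"
    using assms by (simp add: norm_mult norm_divide del: of_real_diff)
  also have "\<dots> \<le> (1 - cmod l) * (cmod l * 2) / (cmod l * (1 - cmod w))"
  proof (intro frac_le mult_left_mono)
    show "cmod (l + of_real (cmod l) * w) \<le> cmod l * 2"
      using norm_triangle_ineq[of l "of_real (cmod l) * w"] mult_left_mono[of "cmod w" 1 "cmod l"] assms
      by (simp add: norm_mult)
  qed (use assms False lb in auto)
  finally show ?thesis using False by simp
qed

text \<open>Both sides are limits of the finite products: the left by absolute convergence, the
  right because evaluation at \<open>w\<close> is continuous in the norm.\<close>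

lemma disc_eq:
  assumes "cmod w < 1"
  shows "blaschke_disc lam w = cip u0 (kvec w)"
proof -
  have "summable (\<lambda>k. (1 - cmod (lam k)) * (2 / (1 - cmod w)))"
    using bs by (intro summable_mult2) (simp add: blaschke_seq_def)
  then have "summable (\<lambda>k. cmod (bfac (lam k) w - 1))"
    by (rule summable_comparison_test'[where N = 0]) (use one_minus_bfac lam1 assms in auto)
  then have "convergent_prod (\<lambda>k. bfac (lam k) w)"
    by (intro abs_convergent_prod_imp_convergent_prod summable_imp_abs_convergent_prod)
  then have "(\<lambda>n. bl {..n} w) \<longlonglongrightarrow> blaschke_disc lam w"
    unfolding blaschke_disc_def bl_def by (rule convergent_prod_LIMSEQ)
  moreover have "(\<lambda>n. bl {..n} w) \<longlonglongrightarrow> cip u0 (kvec w)"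
    using LIMSEQ_Suc[OF bl_tendsto[OF assms]] by (simp add: lessThan_Suc_atMost)
  ultimately show ?thesis by (rule LIMSEQ_unique)
qed

lemma cmod_disc_le: "cmod w < 1 \<Longrightarrow> cmod (blaschke_disc lam w) \<le> 1"
  unfolding disc_eq
  by (rule LIMSEQ_le_const2[OF tendsto_norm[OF bl_tendsto]]) (auto simp: cmod_bl_le)

lemma disc_cont: "0 \<le> r \<Longrightarrow> r < 1 \<Longrightarrow> continuous_on (sphere 0 1) (\<lambda>z. blaschke_disc lam (of_real r * z))"
proof -
  assume r: "0 \<le> r" "r < 1"
  have "(norm u0 / (1 - r)\<^sup>2)-lipschitz_on (sphere 0 1) (\<lambda>z. blaschke_disc lam (of_real r * z))"
  proof (rule lipschitz_onI)
    fix z z' :: complex assume z: "z \<in> sphere 0 1" "z' \<in> sphere 0 1"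
    have rz: "cmod (of_real r * z) \<le> r" "cmod (of_real r * z') \<le> r" using z r by (auto simp: norm_mult)
    have "dist (blaschke_disc lam (of_real r * z)) (blaschke_disc lam (of_real r * z'))
       = cmod (cip u0 (kvec (of_real r * z) - kvec (of_real r * z')))"
      using rz r by (simp add: disc_eq dist_norm cip_right_diff)
    also have "\<dots> \<le> norm u0 * norm (kvec (of_real r * z) - kvec (of_real r * z'))" by (rule cip_cauchy)
    also have "\<dots> \<le> norm u0 * (cmod (of_real r * z - of_real r * z') / (1 - r)\<^sup>2)"
      by (intro mult_left_mono kvec_lipschitz rz r) simp
    also have "cmod (of_real r * z - of_real r * z') \<le> dist z z'"
      using r by (simp add: dist_norm norm_mult right_diff_distrib[symmetric] mult_left_le_one_le)
    finally show "dist (blaschke_disc lam (of_real r * z)) (blaschke_disc lam (of_real r * z')) \<le> norm u0 / (1 - r)\<^sup>2 * dist z z'"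
      by (simp add: divide_right_mono mult_left_mono)
  qed (use r in simp)
  then show ?thesis by (rule lipschitz_on_continuous_on)
qed

text \<open>For given \<open>d\<close> the difference \<open>u0 - U n\<close> is within
  \<open>d\<close>, along the radius and at its end, off a set \<open>A n\<close> of measure at most
  a constant times \<open>norm (u0 - U n)\<close>. The finite product \<open>bl {..<n}\<close> is
  continuous up to the circle, so off \<open>A n\<close> the oscillation is at most
  \<open>3 * d\<close>.\<close>

lemma fatou: "AE z in Tmeas. ((\<lambda>r::real. blaschke_disc lam (of_real r * z)) \<longlongrightarrow> rep_hil u0 z) (at_left 1)"
proof -
  have rep: "AE z in Tmeas. \<forall>n. rep_hil (u0 - U n) z = rep_hil u0 z - bl {..<n} z"
  proof (subst AE_all_countable, intro allI)
    fix n
    have "cl (\<lambda>z. rep_hil u0 z - bl {..<n} z) = u0 - U n"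
      by (simp add: cl_diff bl_L2 U_def)
    then have "aeq (rep_hil (u0 - U n)) (\<lambda>z. rep_hil u0 z - bl {..<n} z)"
      by (subst cl_eq_iff[symmetric]) (auto intro: L2_diff bl_L2)
    then show "AE z in Tmeas. rep_hil (u0 - U n) z = rep_hil u0 z - bl {..<n} z" by (simp add: aeq_def)
  qed
  have main: "AE z in Tmeas. \<forall>\<^sub>F r::real in at_left 1. dist (blaschke_disc lam (of_real r * z)) (rep_hil u0 z) \<le> 3 * d" if d: "d > 0" for d
  proof -
    have "\<exists>A. A \<in> sets Tmeas \<and> emeasure Tmeas A \<le> ennreal (81 / d * norm (u0 - U n)) \<and>
      (\<forall>\<zeta> r. cmod \<zeta> = 1 \<and> \<zeta> \<notin> A \<and> 0 \<le> r \<and> r < 1 \<longrightarrow> cmod (cip (u0 - U n) (kvec (of_real r * \<zeta>))) \<le> d) \<and>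
      (\<forall>\<zeta>. cmod \<zeta> = 1 \<and> \<zeta> \<notin> A \<longrightarrow> cmod (rep_hil (u0 - U n) \<zeta>) \<le> d)" for n
      by (rule fatou_exceptional[OF Hardy_diff[OF u0_Hardy U_Hardy[of n]] d]) blast
    then obtain A where A: "\<And>n. A n \<in> sets Tmeas" "\<And>n. emeasure Tmeas (A n) \<le> ennreal (81 / d * norm (u0 - U n))"
      "\<And>n \<zeta> r. \<lbrakk>cmod \<zeta> = 1; \<zeta> \<notin> A n; 0 \<le> r; r < 1\<rbrakk> \<Longrightarrow> cmod (cip (u0 - U n) (kvec (of_real r * \<zeta>))) \<le> d"
      "\<And>n \<zeta>. \<lbrakk>cmod \<zeta> = 1; \<zeta> \<notin> A n\<rbrakk> \<Longrightarrow> cmod (rep_hil (u0 - U n) \<zeta>) \<le> d"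
      by metis
    \<comment> \<open>A single good \<open>n\<close> suffices for a point, so the bad set is the
      intersection of the \<open>A n\<close>, and their measures tend to 0.\<close>
    have "emeasure Tmeas (\<Inter>n. A n) \<le> 0"
    proof (rule LIMSEQ_le_const)
      have "(\<lambda>n. 81 / d * norm (u0 - U n)) \<longlonglongrightarrow> 81 / d * norm (u0 - u0)"
        by (intro tendsto_intros U_tendsto)
      then show "(\<lambda>n. ennreal (81 / d * norm (u0 - U n))) \<longlonglongrightarrow> 0"
        using tendsto_ennrealI by fastforce
      show "\<exists>N. \<forall>n\<ge>N. emeasure Tmeas (\<Inter>n. A n) \<le> ennreal (81 / d * norm (u0 - U n))"
        using A(1,2) by (meson INT_lower UNIV_I emeasure_mono order_trans)
    qed
    then have "(\<Inter>n. A n) \<in> null_sets Tmeas" using A(1) by (intro null_setsI) auto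
    then have "AE z in Tmeas. z \<notin> (\<Inter>n. A n)" by (rule AE_not_in)
    with rep show ?thesis
    proof (rule AE_mp[OF AE_conjI], intro AE_I2 impI)
      fix z assume z: "z \<in> space Tmeas" and h: "(\<forall>n. rep_hil (u0 - U n) z = rep_hil u0 z - bl {..<n} z) \<and> z \<notin> (\<Inter>n. A n)"
      then obtain n where n: "z \<notin> A n" by auto
      have z1: "cmod z = 1" using z by simp
      have "continuous (at_left 1) (\<lambda>r::real. bl {..<n} (of_real r * z))"
      proof -
        have "continuous_on {0..1} (\<lambda>r::real. bl {..<n} (of_real r * z))"
          by (rule continuous_on_compose2[OF cont_bl]) (auto intro!: continuous_intros simp: norm_mult z1)
        then have "((\<lambda>r::real. bl {..<n} (of_real r * z)) \<longlongrightarrow> bl {..<n} (of_real 1 * z)) (at_left 1)"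
          by (rule continuous_on_Icc_at_leftD) simp
        then show ?thesis by (simp add: continuous_within)
      qed
      then have "((\<lambda>r::real. bl {..<n} (of_real r * z)) \<longlongrightarrow> bl {..<n} z) (at_left 1)"
        by (simp add: continuous_within)
      then have "\<forall>\<^sub>F r::real in at_left 1. dist (bl {..<n} (of_real r * z)) (bl {..<n} z) < d"
        using d by (rule tendstoD)
      moreover have "\<forall>\<^sub>F r::real in at_left 1. 0 < r \<and> r < 1"
        by (auto simp: eventually_at_left[of 0 "1::real"] intro!: exI[of _ 0])
      ultimately show "\<forall>\<^sub>F r::real in at_left 1. dist (blaschke_disc lam (of_real r * z)) (rep_hil u0 z) \<le> 3 * d"
      proof eventually_elim
        case (elim r)
        have w: "cmod (of_real r * z) < 1" using elim z1 by (simp add: norm_mult)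
        have "dist (blaschke_disc lam (of_real r * z)) (bl {..<n} (of_real r * z)) \<le> d"
          using A(3)[OF z1 n, of r] elim by (simp add: disc_eq bl_eq_cip w dist_norm cip_left_diff)
        moreover have "dist (bl {..<n} z) (rep_hil u0 z) \<le> d"
          using A(4)[OF z1 n] h by (simp add: dist_norm norm_minus_commute)
        moreover have "dist (blaschke_disc lam (of_real r * z)) (rep_hil u0 z) \<le>
            dist (blaschke_disc lam (of_real r * z)) (bl {..<n} (of_real r * z)) +
            dist (bl {..<n} (of_real r * z)) (bl {..<n} z) + dist (bl {..<n} z) (rep_hil u0 z)" by metric
        ultimately show ?case using elim by linarith
      qed
    qed
  qed
  have "AE z in Tmeas. \<forall>k::nat. \<forall>\<^sub>F r::real in at_left 1. dist (blaschke_disc lam (of_real r * z)) (rep_hil u0 z) \<le> 3 * (1 / (real k + 1))"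
    by (subst AE_all_countable) (intro allI main, simp)
  then show ?thesis
  proof (rule AE_mp, intro AE_I2 impI tendstoI)
    fix z and e :: real assume h: "\<forall>k::nat. \<forall>\<^sub>F r::real in at_left 1. dist (blaschke_disc lam (of_real r * z)) (rep_hil u0 z) \<le> 3 * (1 / (real k + 1))" and e: "e > 0"
    obtain k :: nat where k: "1 / (real k + 1) < e / 3" using nat_approx_posE[of "e/3"] e by (metis of_nat_Suc add.commute divide_pos_pos zero_less_numeral)
    from h[rule_format, of k] show "\<forall>\<^sub>F r::real in at_left 1. dist (blaschke_disc lam (of_real r * z)) (rep_hil u0 z) < e"
      by eventually_elim (use k in linarith)
  qed
qed

lemma blaschke_AE: "AE z in Tmeas. blaschke lam z = rep_hil u0 z"
  using fatou
proof eventually_elim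
  case (elim z)
  then show ?case unfolding blaschke_def by (auto intro!: tendsto_Lim)
qed

lemma blaschke_le: "cmod z = 1 \<Longrightarrow> cmod (blaschke lam z) \<le> 1"
proof -
  assume z: "cmod z = 1"
  show ?thesis
  proof (cases "\<exists>L. ((\<lambda>r::real. blaschke_disc lam (of_real r * z)) \<longlongrightarrow> L) (at_left 1)")
    case True
    then obtain L where L: "((\<lambda>r::real. blaschke_disc lam (of_real r * z)) \<longlongrightarrow> L) (at_left 1)" by blast
    then have "blaschke lam z = L" unfolding blaschke_def by (auto intro!: tendsto_Lim)
    moreover have "cmod L \<le> 1"
    proof (rule tendsto_upperbound[OF tendsto_norm[OF L]])
      have "\<forall>\<^sub>F r::real in at_left 1. 0 < r \<and> r < 1" by (auto simp: eventually_at_left[of 0 "1::real"] intro!: exI[of _ 0])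
      then show "\<forall>\<^sub>F r::real in at_left 1. cmod (blaschke_disc lam (of_real r * z)) \<le> 1"
        by eventually_elim (intro cmod_disc_le, simp add: norm_mult z)
    qed simp
    ultimately show ?thesis by simp
  qed (simp add: blaschke_def)
qed

text \<open>Where the radial limit exists it is the limit along one sequence of radii; the set of
  these points is measurable, and elsewhere the value is 0.\<close>

lemma blaschke_measurable: "blaschke lam \<in> borel_measurable Tmeas"
proof -
  define E where "E = {z \<in> sphere 0 1. \<exists>L. ((\<lambda>r::real. blaschke_disc lam (of_real r * z)) \<longlongrightarrow> L) (at_left 1)}"
  have [measurable]: "E \<in> sets Tmeas" unfolding E_def by (intro radial_set_measurable disc_cont)
  define s where "s k = 1 - 1 / (real k + 1)" for k :: nat
  have s: "0 \<le> s k" "s k < 1" for k by (auto simp: s_def field_simps)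
  have "s \<longlonglongrightarrow> 1 - 0" unfolding s_def
    using LIMSEQ_inverse_real_of_nat by (intro tendsto_intros) (simp add: inverse_eq_divide add.commute)
  then have sl: "filterlim s (at_left 1) sequentially"
    by (intro filterlim_at_withinI) (use s in \<open>auto simp: less_imp_neq\<close>)
  have [measurable]: "(\<lambda>z. blaschke_disc lam (of_real (s k) * z)) \<in> borel_measurable Tmeas" for k
    by (intro borel_measurable_Tmeas_cont disc_cont s)
  have "(\<lambda>z. if z \<in> E then lim (\<lambda>k. blaschke_disc lam (of_real (s k) * z)) else 0) \<in> borel_measurable Tmeas"
    by (intro measurable_If_set borel_measurable_lim_metric) measurable
  moreover have "blaschke lam z = (if z \<in> E then lim (\<lambda>k. blaschke_disc lam (of_real (s k) * z)) else 0)" if "z \<in> space Tmeas" for z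
  proof (cases "z \<in> E")
    case True
    then obtain L where L: "((\<lambda>r::real. blaschke_disc lam (of_real r * z)) \<longlongrightarrow> L) (at_left 1)" by (auto simp: E_def)
    then have "blaschke lam z = L" unfolding blaschke_def by (auto intro!: tendsto_Lim)
    moreover have "(\<lambda>k. blaschke_disc lam (of_real (s k) * z)) \<longlonglongrightarrow> L" using filterlim_compose[OF L sl] .
    ultimately show ?thesis using True by (simp add: limI)
  next
    case False then show ?thesis using that by (auto simp: E_def blaschke_def)
  qed
  ultimately show ?thesis by (subst measurable_cong) auto
qed

lemma bdd_sym_blaschke: "bdd_sym (blaschke lam)"
  using blaschke_measurable blaschke_le by (rule bmI)

lemma cl_blaschke: "cl (blaschke lam) = u0"
  using blaschke_AE cl_eq_iff[of "blaschke lam" "rep_hil u0"] L2_bdd_sym[OF bdd_sym_blaschke] by (simp add: aeq_def)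

text \<open>The finite products have modulus 1 on the circle, so the integral of
  \<open>1 - cmod (blaschke lam z)\<close> is at most their distance to the limit, which tends to
  0.\<close>

lemma blaschke_unimodular: "AE z in Tmeas. cmod (blaschke lam z) = 1"
proof -
  have "(\<integral>\<^sup>+z. ennreal (1 - cmod (blaschke lam z)) \<partial>Tmeas) \<le> 0"
  proof (rule LIMSEQ_le_const)
    have "(\<lambda>n. norm (u0 - U n)) \<longlonglongrightarrow> norm (u0 - u0)" by (intro tendsto_intros U_tendsto)
    then show "(\<lambda>n. ennreal (norm (u0 - U n))) \<longlonglongrightarrow> 0" using tendsto_ennrealI by fastforce
    have "(\<integral>\<^sup>+z. ennreal (1 - cmod (blaschke lam z)) \<partial>Tmeas) \<le> ennreal (norm (u0 - U n))" for n
    proof -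
      have L: "(\<lambda>z. blaschke lam z - bl {..<n} z) \<in> L2" by (intro L2_diff bl_L2 L2_bdd_sym bdd_sym_blaschke)
      have "(\<integral>\<^sup>+z. ennreal (1 - cmod (blaschke lam z)) \<partial>Tmeas) \<le> (\<integral>\<^sup>+z. ennreal (cmod (blaschke lam z - bl {..<n} z)) \<partial>Tmeas)"
      proof (intro nn_integral_mono ennreal_leI)
        fix z assume "z \<in> space Tmeas"
        then have "cmod (bl {..<n} z) = 1" by (simp add: cmod_bl)
        then show "1 - cmod (blaschke lam z) \<le> cmod (blaschke lam z - bl {..<n} z)"
          using norm_triangle_ineq2[of "bl {..<n} z" "blaschke lam z"] by (simp add: norm_minus_commute)
      qed
      also have "\<dots> = ennreal (\<integral>z. cmod (blaschke lam z - bl {..<n} z) \<partial>Tmeas)"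
        by (rule nn_integral_eq_integral) (auto intro: L2_integrable_cmod[OF L])
      also have "\<dots> \<le> ennreal (norm (u0 - U n))"
        using L1_le_l2norm[OF L] by (intro ennreal_leI) (simp add: norm_cl[OF L, symmetric] cl_diff bl_L2 L2_bdd_sym bdd_sym_blaschke cl_blaschke U_def)
      finally show ?thesis .
    qed
    then show "\<exists>N. \<forall>n\<ge>N. (\<integral>\<^sup>+z. ennreal (1 - cmod (blaschke lam z)) \<partial>Tmeas) \<le> ennreal (norm (u0 - U n))" by blast
  qed
  then have "(\<integral>\<^sup>+z. ennreal (1 - cmod (blaschke lam z)) \<partial>Tmeas) = 0" by simp
  moreover have "(\<lambda>z. ennreal (1 - cmod (blaschke lam z))) \<in> borel_measurable Tmeas"
    using blaschke_measurable by measurable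
  ultimately have "AE z in Tmeas. ennreal (1 - cmod (blaschke lam z)) = 0"
    using nn_integral_0_iff_AE by blast
  then show ?thesis
  proof (rule AE_mp, intro AE_I2 impI)
    fix z assume "z \<in> space Tmeas" "ennreal (1 - cmod (blaschke lam z)) = 0"
    then show "cmod (blaschke lam z) = 1" using blaschke_le[of z] by simp
  qed
qed

end

section \<open>Model spaces\<close>

definition cutoff :: "real \<Rightarrow> cfun \<Rightarrow> cfun" where
  "cutoff N f z = (if cmod (f z) \<le> N then f z else 0)"

lemma cutoff_L2: "f \<in> L2 \<Longrightarrow> cutoff N f \<in> L2"
proof -
  assume f: "f \<in> L2"
  note [measurable] = L2_measurable[OF f]
  have m: "cutoff N f \<in> borel_measurable Tmeas" unfolding cutoff_def[abs_def] by measurable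
  moreover have "integrable Tmeas (\<lambda>z. (cmod (cutoff N f z))\<^sup>2)"
    by (rule Bochner_Integration.integrable_bound[OF L2_sq_integrable[OF f]])
      (use m in \<open>auto simp: cutoff_def\<close>)
  ultimately show ?thesis by (simp add: L2_iff)
qed

lemma cutoff_tendsto:
  assumes f: "f \<in> L2"
  shows "(\<lambda>N. l2norm (\<lambda>z. f z - cutoff (real N) f z)) \<longlonglongrightarrow> 0"
proof -
  note [measurable] = L2_measurable[OF f] L2_measurable[OF cutoff_L2[OF f]]
  have "(\<lambda>N. \<integral>z. (cmod (f z - cutoff (real N) f z))\<^sup>2 \<partial>Tmeas) \<longlonglongrightarrow> (\<integral>z. 0 \<partial>Tmeas)"
  proof (rule integral_dominated_convergence[OF _ _ L2_sq_integrable[OF f]])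
    show "AE z in Tmeas. (\<lambda>N. (cmod (f z - cutoff (real N) f z))\<^sup>2) \<longlonglongrightarrow> 0"
    proof (rule AE_I2)
      fix z
      obtain M :: nat where "cmod (f z) \<le> real M" using real_arch_simple by blast
      then show "(\<lambda>N. (cmod (f z - cutoff (real N) f z))\<^sup>2) \<longlonglongrightarrow> 0"
        by (intro tendsto_eventually eventually_sequentiallyI[of M]) (simp add: cutoff_def)
    qed
    show "AE z in Tmeas. norm ((cmod (f z - cutoff (real N) f z))\<^sup>2) \<le> (cmod (f z))\<^sup>2" for N
      by (rule AE_I2) (simp add: cutoff_def)
  qed measurable
  then have "(\<lambda>N. sqrt (\<integral>z. (cmod (f z - cutoff (real N) f z))\<^sup>2 \<partial>Tmeas)) \<longlonglongrightarrow> sqrt 0"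
    by (intro tendsto_real_sqrt) simp
  then show ?thesis by (simp add: l2norm_def)
qed

text \<open>Norm convergence of uniformly bounded symbols gives strong convergence of the
  multiplications. On a bounded vector \<open>g\<close> the roles are exchanged: \<open>g\<close>
  multiplies the difference of the symbols. Cutoffs approximate a general vector, and the bound 1 on
  the symbols controls the error.\<close>

lemma mulop_tendsto_symbol:
  assumes a: "\<And>n. bdd_sym (a n)" "bdd_sym b" "\<And>n z. cmod z = 1 \<Longrightarrow> cmod (a n z) \<le> 1" "\<And>z. cmod z = 1 \<Longrightarrow> cmod (b z) \<le> 1"
    and conv: "(\<lambda>n. cl (a n)) \<longlonglongrightarrow> cl b"
  shows "(\<lambda>n. mulop (a n) y) \<longlonglongrightarrow> mulop b y"
proof (rule metric_LIMSEQ_I)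
  fix r :: real assume r: "r > 0"
  define f where "f = rep_hil y"
  have f: "f \<in> L2" "y = cl f" by (simp_all add: f_def)
  have "\<forall>\<^sub>F N in sequentially. l2norm (\<lambda>z. f z - cutoff (real N) f z) < r/4"
    by (rule order_tendstoD(2)[OF cutoff_tendsto[OF f(1)]]) (use r in simp)
  then obtain N where N: "l2norm (\<lambda>z. f z - cutoff (real N) f z) < r/4"
    by (auto simp: eventually_sequentially)
  define g where "g = cutoff (real N) f"
  have g: "g \<in> L2" unfolding g_def by (intro cutoff_L2 f)
  have yg: "norm (y - cl g) < r/4" using N f g by (simp add: g_def[symmetric] cl_diff[symmetric] norm_cl L2_diff)
  have "(\<lambda>n. real N * norm (cl (a n) - cl b)) \<longlonglongrightarrow> real N * norm (cl b - cl b)"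
    by (intro tendsto_intros conv)
  then have "\<forall>\<^sub>F n in sequentially. real N * norm (cl (a n) - cl b) < r/4"
    using r by (intro order_tendstoD(2)) auto
  then obtain M where M: "\<And>n. n \<ge> M \<Longrightarrow> real N * norm (cl (a n) - cl b) < r/4"
    by (auto simp: eventually_sequentially)
  have "dist (mulop (a n) y) (mulop b y) < r" if "n \<ge> M" for n
  proof -
    have aL: "a n \<in> L2" "b \<in> L2" by (intro L2_bdd_sym a)+
    have "mulop (a n) (cl g) - mulop b (cl g) = cl (\<lambda>z. g z * (a n z - b z))"
      by (simp add: mulop_cl a g cl_diff[symmetric] L2_bdd_sym_mult right_diff_distrib mult.commute[of "g _"])
    moreover have gN: "cmod (g z) \<le> real N" for z by (simp add: g_def cutoff_def)
    have gb: "bdd_sym g"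
      by (rule bmI[of _ "real N"]) (use L2_measurable[OF g] gN in auto)
    ultimately have "norm (mulop (a n) (cl g) - mulop b (cl g)) = l2norm (\<lambda>z. g z * (a n z - b z))"
      by (simp add: norm_cl L2_bdd_sym_mult L2_diff aL)
    also have "\<dots> \<le> real N * l2norm (\<lambda>z. a n z - b z)"
      by (rule l2norm_mult_le) (use L2_measurable[OF g] gN in \<open>auto simp: L2_diff aL\<close>)
    also have "\<dots> = real N * norm (cl (a n) - cl b)"
      by (simp add: cl_diff[symmetric] aL norm_cl L2_diff)
    finally have 1: "norm (mulop (a n) (cl g) - mulop b (cl g)) < r/4" using M[OF that] by simp
    have 2: "norm (mulop (a n) (y - cl g)) < r/4"
      using norm_mulop[of "a n" 1 "y - cl g"] a(3) yg by force
    have 3: "norm (mulop b (y - cl g)) < r/4"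
      using norm_mulop[of b 1 "y - cl g"] a(4) yg by force
    have "mulop (a n) y - mulop b y = (mulop (a n) (cl g) - mulop b (cl g)) + mulop (a n) (y - cl g) - mulop b (y - cl g)"
      by (simp add: mulop_diff)
    then have "norm (mulop (a n) y - mulop b y) \<le> norm (mulop (a n) (cl g) - mulop b (cl g)) + norm (mulop (a n) (y - cl g)) + norm (mulop b (y - cl g))"
      by (metis norm_triangle_ineq norm_triangle_ineq4 order_trans add_right_mono)
    then show ?thesis using 1 2 3 r by (simp add: dist_norm)
  qed
  then show "\<exists>M. \<forall>n\<ge>M. dist (mulop (a n) y) (mulop b y) < r" by blast
qed

section \<open>Model spaces of functions and of classes\<close>

lemma H2_iff: "f \<in> H2 \<longleftrightarrow> f \<in> L2 \<and> cl f \<in> Hardy"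
proof -
  have "f \<in> L2 \<Longrightarrow> fcoef f n = cip (cl f) (zpow n)" for n
    by (simp add: zpow_def cip_cl powi_L2 fcoef_def l2ip_def)
  then show ?thesis by (auto simp: H2_def Hardy_def)
qed

lemma K2_iff:
  assumes v: "bdd_sym v"
  shows "f \<in> K2 v \<longleftrightarrow> f \<in> L2 \<and> cl f \<in> KV v"
proof -
  have *: "l2ip f (\<lambda>z. v z * h z) = cip (cl f) (mulop v (cl h))" if "f \<in> L2" "h \<in> L2" for h
    using that by (simp add: mulop_cl v cip_cl L2_bdd_sym_mult)
  show ?thesis
  proof
    assume f: "f \<in> K2 v"
    then have fH: "f \<in> H2" by (simp add: K2_def)
    have "cip (cl f) (mulop v y) = 0" if "y \<in> Hardy" for y
      using f that *[of "rep_hil y"] fH by (simp add: K2_def H2_iff)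
    then show "f \<in> L2 \<and> cl f \<in> KV v" using fH by (simp add: KV_def H2_iff)
  next
    assume f: "f \<in> L2 \<and> cl f \<in> KV v"
    then show "f \<in> K2 v" using * by (auto simp: K2_def KV_def H2_iff)
  qed
qed

text \<open>\<open>orth_proj\<close> is a choice, so only its class can be known. The class is
  unique because the difference \<open>d\<close> lies in the subspace and is orthogonal to
  it.\<close>

lemma orth_proj_char:
  assumes V: "\<And>f. f \<in> V \<longleftrightarrow> f \<in> L2 \<and> q (cl f) = cl f"
    and q: "\<And>x. q (q x) = q x" "\<And>x y. cip (q x) y = cip x (q y)" "\<And>x y. q (x - y) = q x - q y"
    and f: "f \<in> L2"
  shows "orth_proj V f \<in> V" "cl (orth_proj V f) = q (cl f)"
proof -
  have tr: "l2ip (\<lambda>z. f z - g z) h = cip (cl f - cl g) (cl h)" if "g \<in> L2" "h \<in> L2" for g h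
    using that f by (simp add: cip_cl[symmetric] cl_diff L2_diff)
  define R where "R g \<longleftrightarrow> g \<in> V \<and> (\<forall>h\<in>V. l2ip (\<lambda>z. f z - g z) h = 0)" for g
  have "R (rep_hil (q (cl f)))"
    unfolding R_def
  proof (intro conjI ballI)
    show "rep_hil (q (cl f)) \<in> V" by (simp add: V q)
    fix h assume "h \<in> V"
    then have h: "h \<in> L2" "cl h = q (cl h)" by (simp_all add: V)
    have "l2ip (\<lambda>z. f z - rep_hil (q (cl f)) z) h = cip (cl f - q (cl f)) (q (cl h))"
      using tr[of "rep_hil (q (cl f))" h] h by simp
    also have "\<dots> = cip (q (cl f) - q (cl f)) (cl h)" by (simp add: q(2)[symmetric] q(1,3))
    finally show "l2ip (\<lambda>z. f z - rep_hil (q (cl f)) z) h = 0" by simp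
  qed
  then have R: "R (orth_proj V f)" unfolding orth_proj_def R_def by (rule someI[where P = "\<lambda>g. g \<in> V \<and> (\<forall>h\<in>V. l2ip (\<lambda>z. f z - g z) h = 0)"])
  then show V1: "orth_proj V f \<in> V" by (simp add: R_def)
  define g where "g = orth_proj V f"
  have g: "g \<in> L2" "q (cl g) = cl g" using V1 by (simp_all add: V g_def)
  define d where "d = q (cl f) - cl g"
  have qd: "q d = d" by (simp add: d_def q g)
  have "0 = cip (cl f - cl g) d"
    using R tr[of g "rep_hil d"] g qd unfolding R_def g_def[symmetric] by (simp add: V)
  also have "\<dots> = cip (q (cl f - cl g)) d" by (simp add: q(2) qd)
  also have "\<dots> = cip d d" by (simp add: d_def q(3) g)
  finally have "d = 0" by (simp add: cip_self)
  then show "cl (orth_proj V f) = q (cl f)" by (simp add: d_def g_def)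
qed

context bzeros
begin

lemma mulop_bl_tendsto: "(\<lambda>n. mulop (bl {..<n}) y) \<longlonglongrightarrow> mulop (blaschke lam) y"
  by (rule mulop_tendsto_symbol)
    (use U_tendsto in \<open>auto simp: bdd_sym_bl bdd_sym_blaschke cmod_bl blaschke_le cl_blaschke U_def[symmetric]\<close>)

lemma mulop_cnj_bl_tendsto: "(\<lambda>n. mulop (\<lambda>z. cnj (bl {..<n} z)) y) \<longlonglongrightarrow> mulop (\<lambda>z. cnj (blaschke lam z)) y"
proof (rule mulop_tendsto_symbol)
  have L: "(\<lambda>z. cnj (bl {..<n} z)) \<in> L2" "(\<lambda>z. cnj (blaschke lam z)) \<in> L2" for n
    by (intro L2_bdd_sym bdd_sym_cnj bdd_sym_bl bdd_sym_blaschke)+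
  have L': "blaschke lam \<in> L2" by (intro L2_bdd_sym bdd_sym_blaschke)
  have "norm (cl (\<lambda>z. cnj (bl {..<n} z)) - cl (\<lambda>z. cnj (blaschke lam z))) = norm (U n - u0)" for n
  proof -
    have "norm (cl (\<lambda>z. cnj (bl {..<n} z)) - cl (\<lambda>z. cnj (blaschke lam z))) = l2norm (\<lambda>z. cnj (bl {..<n} z) - cnj (blaschke lam z))"
      by (simp add: cl_diff[symmetric] L norm_cl L2_diff)
    also have "\<dots> = l2norm (\<lambda>z. bl {..<n} z - blaschke lam z)"
      unfolding l2norm_def by (simp only: complex_cnj_diff[symmetric] complex_mod_cnj)
    also have "\<dots> = norm (U n - u0)"
      by (simp add: U_def cl_blaschke[symmetric] cl_diff[symmetric] bl_L2 L' norm_cl L2_diff)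
    finally show ?thesis .
  qed
  then show "(\<lambda>n. cl (\<lambda>z. cnj (bl {..<n} z))) \<longlonglongrightarrow> cl (\<lambda>z. cnj (blaschke lam z))"
    using tendsto_norm_zero[OF iffD1[OF LIM_zero_iff[symmetric] U_tendsto]]
    by (subst LIM_zero_iff[symmetric], subst tendsto_norm_zero_iff[symmetric]) simp
qed (auto simp: bdd_sym_cnj bdd_sym_bl bdd_sym_blaschke cmod_bl blaschke_le)

text \<open>The vector lies in the model space of every \<open>bl {..<m}\<close> with
  \<open>m >= n\<close>; the multiplications by these products converge strongly, and orthogonality
  survives in the limit.\<close>

lemma pr_KV_blaschke: "pr n x \<in> KV (blaschke lam)"
  unfolding KV_def
proof (intro CollectI conjI ballI)
  show "pr n x \<in> Hardy" using pr_KV[of n x] by (simp add: KV_def)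
  fix y assume y: "y \<in> Hardy"
  have "(\<lambda>m. cip (pr n x) (mulop (bl {..<m}) y)) \<longlonglongrightarrow> cip (pr n x) (mulop (blaschke lam) y)"
    by (intro cip_right_tendsto mulop_bl_tendsto)
  moreover have "(\<lambda>m. cip (pr n x) (mulop (bl {..<m}) y)) \<longlonglongrightarrow> 0"
  proof (rule tendsto_eventually, rule eventually_sequentiallyI[of n])
    fix m assume "n \<le> m"
    then have "pr n x \<in> KV (bl {..<m})" by (simp add: KV_bl pr_pr min_absorb2)
    then show "cip (pr n x) (mulop (bl {..<m}) y) = 0" using y by (simp add: KV_def)
  qed
  ultimately show "cip (pr n x) (mulop (blaschke lam) y) = 0" by (rule LIMSEQ_unique)
qed

lemma pu_KV: "pu x \<in> KV (blaschke lam)"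
  by (rule KV_closed[OF pr_KV_blaschke pr_tendsto])

lemma mulop_blaschke_cnj: "mulop (blaschke lam) (mulop (\<lambda>z. cnj (blaschke lam z)) x) = x"
proof -
  have "mulop (\<lambda>z. blaschke lam z * cnj (blaschke lam z)) x = mulop (\<lambda>z. 1) x"
  proof (rule mulop_cong)
    show "AE z in Tmeas. blaschke lam z * cnj (blaschke lam z) = 1"
      using blaschke_unimodular by eventually_elim (rule cnj_mult_circle(2))
  qed (simp_all add: bdd_sym_mult bdd_sym_cnj bdd_sym_blaschke bdd_sym_const)
  then show ?thesis by (simp add: mulop_mulop bdd_sym_cnj bdd_sym_blaschke mulop_one)
qed

lemma mulop_cnj_bl: "mulop (\<lambda>z. cnj (bl S z)) (mulop (bl S) x) = x"
proof -
  have "mulop (\<lambda>z. cnj (bl S z) * bl S z) x = mulop (\<lambda>z. 1) x"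
    by (rule mulop_cong') (auto simp: bdd_sym_mult bdd_sym_cnj bdd_sym_bl cnj_mult_circle cmod_bl)
  then show ?thesis by (simp add: mulop_mulop bdd_sym_cnj bdd_sym_bl mulop_one)
qed

text \<open>Completeness of the basis. If \<open>g\<close> is orthogonal to every
  \<open>e j\<close>, each finite product divides it in the Hardy space. The quotients converge,
  since the conjugated products do so strongly, hence the full product divides \<open>g\<close> as
  well; so \<open>g\<close> is orthogonal to itself.\<close>

lemma KV_blaschke: "KV (blaschke lam) = {x. pu x = x}"
proof (intro set_eqI iffI CollectI)
  fix x assume x: "x \<in> KV (blaschke lam)"
  define g where "g = x - pu x"
  have g: "g \<in> KV (blaschke lam)" unfolding g_def by (intro KV_diff x pu_KV)
  have "cip (pu x) (e j) = cip x (e j)" for j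
    using cip_pr_e[of "Suc j" "pu x" j] by (simp add: pr_pu cip_pr_e)
  then have ge: "cip g (e j) = 0" for j by (simp add: g_def cip_left_diff)
  have "mulop (\<lambda>z. cnj (bl {..<n} z)) g \<in> Hardy" for n
    using orth_e_factor[of g n] g ge by (auto simp: KV_def mulop_cnj_bl)
  then have "mulop (\<lambda>z. cnj (blaschke lam z)) g \<in> Hardy"
    by (rule Hardy_closed[OF _ mulop_cnj_bl_tendsto])
  then have "cip g (mulop (blaschke lam) (mulop (\<lambda>z. cnj (blaschke lam z)) g)) = 0"
    using g by (simp add: KV_def)
  then have "g = 0" by (simp add: mulop_blaschke_cnj cip_self)
  then show "pu x = x" by (simp add: g_def)
next
  fix x assume "x \<in> {x. pu x = x}" then show "x \<in> KV (blaschke lam)" using pu_KV[of x] by simp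
qed

abbreviation "Kn n \<equiv> K2 (bpartial lam n)"
abbreviation "Ku \<equiv> K2 (blaschke lam)"

text \<open>The product with index \<open>n\<close> has \<open>n + 1\<close> factors; this is the
  origin of every \<open>Suc n\<close> in the sections.\<close>

lemma bpartial_eq: "bpartial lam n = bl {..<Suc n}"
  by (simp add: bpartial_def bl_def fun_eq_iff lessThan_Suc_atMost)

lemma Kn_iff: "f \<in> Kn n \<longleftrightarrow> f \<in> L2 \<and> pr (Suc n) (cl f) = cl f"
  unfolding bpartial_eq K2_iff[OF bdd_sym_bl] KV_bl by simp

lemma Ku_iff: "f \<in> Ku \<longleftrightarrow> f \<in> L2 \<and> pu (cl f) = cl f"
  unfolding K2_iff[OF bdd_sym_blaschke] KV_blaschke by simp

lemma pr_diff: "pr n (x - y) = pr n x - pr n y"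
  by (rule linear_diff[OF bounded_linear.linear[OF bounded_linear_pr]])
lemma pu_diff: "pu (x - y) = pu x - pu y"
  by (rule linear_diff[OF bounded_linear.linear[OF bounded_linear_pu]])

lemma Pn_Kn: "f \<in> L2 \<Longrightarrow> Pn lam n f \<in> Kn n"
  and cl_Pn: "f \<in> L2 \<Longrightarrow> cl (Pn lam n f) = pr (Suc n) (cl f)"
  unfolding Pn_def
  using orth_proj_char[of "Kn n" "pr (Suc n)" f, OF Kn_iff] pr_pr pr_self_adjoint pr_diff by auto

lemma ttoep_Ku: "bdd_sym a \<Longrightarrow> f \<in> L2 \<Longrightarrow> ttoep (blaschke lam) a f \<in> Ku"
  and cl_ttoep: "bdd_sym a \<Longrightarrow> f \<in> L2 \<Longrightarrow> cl (ttoep (blaschke lam) a f) = pu (mulop a (cl f))"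
  unfolding ttoep_def mult_op_def
  using orth_proj_char[of Ku pu "\<lambda>z. a z * f z", OF Ku_iff] pu_pu pu_self_adjoint pu_diff
  by (auto simp: L2_bdd_sym_mult mulop_cl)

end

section \<open>Sections of operators modulo compact and null sequences\<close>

lemmas compose_add_left = bounded_bilinear.add_left[OF bounded_bilinear_blinfun_compose]
lemmas compose_add_right = bounded_bilinear.add_right[OF bounded_bilinear_blinfun_compose]
lemmas compose_diff_left = bounded_bilinear.diff_left[OF bounded_bilinear_blinfun_compose]
lemmas compose_diff_right = bounded_bilinear.diff_right[OF bounded_bilinear_blinfun_compose]
lemmas compose_simps = compose_add_left compose_add_right compose_diff_left compose_diff_right

lemma compose_null_right:
  fixes G Y :: "nat \<Rightarrow> hil \<Rightarrow>\<^sub>L hil"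
  assumes "G \<longlonglongrightarrow> 0" "\<And>n. norm (Y n) \<le> C"
  shows "(\<lambda>n. Y n o\<^sub>L G n) \<longlonglongrightarrow> 0"
proof (rule Lim_null_comparison[OF always_eventually[OF allI]])
  show "norm (Y n o\<^sub>L G n) \<le> C * norm (G n)" for n
    using norm_blinfun_compose[of "Y n" "G n"] assms(2)[of n] by (meson mult_right_mono norm_ge_zero order_trans)
  show "(\<lambda>n. C * norm (G n)) \<longlonglongrightarrow> 0"
    by (intro tendsto_mult_right_zero tendsto_norm_zero assms)
qed

lemma compose_null_left:
  fixes G Y :: "nat \<Rightarrow> hil \<Rightarrow>\<^sub>L hil"
  assumes "G \<longlonglongrightarrow> 0" "\<And>n. norm (Y n) \<le> C"
  shows "(\<lambda>n. G n o\<^sub>L Y n) \<longlonglongrightarrow> 0"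
proof (rule Lim_null_comparison[OF always_eventually[OF allI]])
  show "norm (G n o\<^sub>L Y n) \<le> C * norm (G n)" for n
    using norm_blinfun_compose[of "G n" "Y n"] assms(2)[of n] mult_left_mono[OF assms(2)[of n], of "norm (G n)"]
    by (simp add: mult.commute)
  show "(\<lambda>n. C * norm (G n)) \<longlonglongrightarrow> 0"
    by (intro tendsto_mult_right_zero tendsto_norm_zero assms)
qed

context ons
begin

lemma onV_add: "onV X \<Longrightarrow> onV Y \<Longrightarrow> onV (X + Y)"
  by (simp add: onV_def clin_add blinfun.add_left pu_add)
lemma onV_cmul: "onV X \<Longrightarrow> onV (cmul c X)"
  by (simp add: onV_def clin_cmul pu_scaleC)
lemma onV_compose: "onV X \<Longrightarrow> onV Y \<Longrightarrow> onV (X o\<^sub>L Y)"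
  by (simp add: onV_def clin_compose)
lemma onV_zero: "onV 0"
  using linear_0[OF bounded_linear.linear[OF bounded_linear_pu]] by (simp add: onV_def clin_zero)
lemma onV_uminus: "onV X \<Longrightarrow> onV (- X)"
  using onV_cmul[of X "-1"] by (subgoal_tac "cmul (-1) X = - X")
    (auto intro!: blinfun_eqI simp: scaleC_minus_one blinfun.minus_left)
lemma onV_diff: "onV X \<Longrightarrow> onV Y \<Longrightarrow> onV (X - Y)"
  using onV_add[OF _ onV_uminus] by fastforce

lemma onV_limit:
  assumes "\<And>n. onV (X n)" "X \<longlonglongrightarrow> Y" shows "onV Y"
proof -
  have l: "(\<lambda>n. X n y) \<longlonglongrightarrow> Y y" for y
    using assms(2) by (intro blinfun.tendsto tendsto_const)
  have "Y (pu x) = Y x" for x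
    using LIMSEQ_unique[OF l[of "pu x"]] l[of x] assms(1) by (simp add: onV_def)
  moreover have "pu (Y x) = Y x" for x
    using LIMSEQ_unique[OF bounded_linear.tendsto[OF bounded_linear_pu l[of x]]] l[of x] assms(1) by (simp add: onV_def)
  moreover have "clin Y" by (rule clin_limit[OF _ assms(2)]) (use assms(1) in \<open>simp add: onV_def\<close>)
  ultimately show ?thesis by (simp add: onV_def)
qed

lemma onV_rk1: "pu a = a \<Longrightarrow> pu b = b \<Longrightarrow> onV (rk1 a b)"
  by (simp add: onV_def clin_rk1 pu_self_adjoint pu_scaleC)

definition sec :: "(hil \<Rightarrow>\<^sub>L hil) \<Rightarrow> nat \<Rightarrow> (hil \<Rightarrow>\<^sub>L hil)" where
  "sec X n = P (Suc n) o\<^sub>L X o\<^sub>L P (Suc n)"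

lemma sec_apply: "sec X n x = pr (Suc n) (X (pr (Suc n) x))" by (simp add: sec_def)

lemma sec_add: "sec (X + Y) n = sec X n + sec Y n"
  by (simp add: sec_def compose_simps)
lemma sec_diff: "sec (X - Y) n = sec X n - sec Y n"
  by (simp add: sec_def compose_simps)
lemma sec_cmul: "sec (cmul c X) n = cmul c (sec X n)"
  by (rule blinfun_eqI) (simp add: sec_apply pr_scaleC)
lemma sec_zero: "sec 0 n = 0"
  using sec_diff[of 0 0 n] by simp

lemma norm_sec: "norm (sec X n) \<le> norm X"
proof -
  have "norm (sec X n) \<le> norm (P (Suc n)) * norm X * norm (P (Suc n))"
    unfolding sec_def
    by (intro order_trans[OF norm_blinfun_compose] mult_right_mono norm_blinfun_compose) simp
  also have "\<dots> \<le> 1 * norm X * 1" by (intro mult_mono norm_P) auto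
  finally show ?thesis by simp
qed

definition cptop :: "(hil \<Rightarrow>\<^sub>L hil) \<Rightarrow> bool" where "cptop K \<longleftrightarrow> cpt K \<and> onV K"

lemma cptop_zero: "cptop 0" by (simp add: cptop_def cpt_zero onV_zero)
lemma cptop_add: "cptop K \<Longrightarrow> cptop L \<Longrightarrow> cptop (K + L)" by (simp add: cptop_def cpt_add onV_add)
lemma cptop_cmul: "cptop K \<Longrightarrow> cptop (cmul c K)" by (simp add: cptop_def cpt_cmul onV_cmul)
lemma cptop_left: "onV X \<Longrightarrow> cptop K \<Longrightarrow> cptop (X o\<^sub>L K)" by (simp add: cptop_def cpt_compose_left onV_compose)
lemma cptop_right: "onV X \<Longrightarrow> cptop K \<Longrightarrow> cptop (K o\<^sub>L X)" by (simp add: cptop_def cpt_compose_right onV_compose)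
lemma cptop_rk1: "pu a = a \<Longrightarrow> pu b = b \<Longrightarrow> cptop (rk1 a b)" by (simp add: cptop_def cpt_rk1 onV_rk1)

text \<open>The class \<open>J\<close> of the overview, as a predicate on sequences of class
  operators.\<close>

definition cpt_ideal :: "(nat \<Rightarrow> hil \<Rightarrow>\<^sub>L hil) \<Rightarrow> bool" where
  "cpt_ideal A \<longleftrightarrow> (\<exists>K. cptop K \<and> (\<lambda>n. A n - sec K n) \<longlonglongrightarrow> 0)"

lemma JJI: "cptop K \<Longrightarrow> (\<lambda>n. A n - sec K n) \<longlonglongrightarrow> 0 \<Longrightarrow> cpt_ideal A" by (auto simp: cpt_ideal_def)
lemma cpt_ideal_sec: "cptop K \<Longrightarrow> cpt_ideal (sec K)" by (rule JJI) auto
lemma cpt_ideal_null: "A \<longlonglongrightarrow> 0 \<Longrightarrow> cpt_ideal A" by (rule JJI[OF cptop_zero]) (simp add: sec_zero)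

lemma cpt_ideal_add: assumes "cpt_ideal A" "cpt_ideal B" shows "cpt_ideal (\<lambda>n. A n + B n)"
proof -
  obtain K L where K: "cptop K" "(\<lambda>n. A n - sec K n) \<longlonglongrightarrow> 0" and L: "cptop L" "(\<lambda>n. B n - sec L n) \<longlonglongrightarrow> 0"
    using assms by (auto simp: cpt_ideal_def)
  show ?thesis by (rule JJI[OF cptop_add[OF K(1) L(1)]])
    (use tendsto_add_zero[OF K(2) L(2)] in \<open>simp add: sec_add algebra_simps\<close>)
qed

lemma cmul_null: "A \<longlonglongrightarrow> 0 \<Longrightarrow> (\<lambda>n. cmul c (A n)) \<longlonglongrightarrow> 0"
  by (rule Lim_null_comparison[OF always_eventually[OF allI[OF norm_cmul]]])
    (intro tendsto_mult_right_zero tendsto_norm_zero)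

lemma cmul_diff: "cmul c (X - Y) = cmul c X - cmul c Y"
  by (rule blinfun_eqI) (simp add: blinfun.diff_left scaleC_diff)

lemma cpt_ideal_cmul: assumes "cpt_ideal A" shows "cpt_ideal (\<lambda>n. cmul c (A n))"
proof -
  obtain K where K: "cptop K" "(\<lambda>n. A n - sec K n) \<longlonglongrightarrow> 0" using assms by (auto simp: cpt_ideal_def)
  show ?thesis by (rule JJI[OF cptop_cmul[OF K(1)]])
    (use cmul_null[OF K(2)] in \<open>simp add: sec_cmul cmul_diff\<close>)
qed

lemma cmul_minus_one: "cmul (-1) X = - X"
  by (rule blinfun_eqI) (simp add: scaleC_minus_one blinfun.minus_left)

lemma cpt_ideal_minus: "cpt_ideal A \<Longrightarrow> cpt_ideal (\<lambda>n. - A n)"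
  using cpt_ideal_cmul[of A "-1"] by (simp add: cmul_minus_one)

lemma cpt_ideal_diff: "cpt_ideal A \<Longrightarrow> cpt_ideal B \<Longrightarrow> cpt_ideal (\<lambda>n. A n - B n)"
  using cpt_ideal_add[OF _ cpt_ideal_minus] by fastforce

text \<open>The sequences by which members of \<open>cpt_ideal\<close> may be multiplied.\<close>

definition sec_like :: "(nat \<Rightarrow> hil \<Rightarrow>\<^sub>L hil) \<Rightarrow> bool" where
  "sec_like A \<longleftrightarrow> (\<exists>X. onV X \<and> (\<lambda>n. A n - sec X n) \<longlonglongrightarrow> 0)"

lemma sec_like_sec: "onV X \<Longrightarrow> sec_like (sec X)" unfolding sec_like_def by (intro exI[of _ X]) simp

lemma null_bounded:
  fixes G :: "nat \<Rightarrow> hil \<Rightarrow>\<^sub>L hil"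
  assumes "G \<longlonglongrightarrow> 0" obtains C where "\<And>n. norm (G n) \<le> C"
  using convergent_imp_bounded[OF assms] unfolding bounded_iff by auto

lemma sec_like_bounded:
  assumes "sec_like A" obtains C where "\<And>n. norm (A n) \<le> C"
proof -
  obtain X where X: "onV X" "(\<lambda>n. A n - sec X n) \<longlonglongrightarrow> 0" using assms by (auto simp: sec_like_def)
  obtain C where C: "\<And>n. norm (A n - sec X n) \<le> C" using null_bounded[OF X(2)] by blast
  have "norm (A n) \<le> C + norm X" for n
    using norm_triangle_ineq[of "A n - sec X n" "sec X n"] C[of n] norm_sec[of X n] by simp
  then show ?thesis using that by blast
qed

text \<open>The difference is minus the section of \<open>X (PU - P) K\<close>, and the tails of a
  compact operator on the left tend to 0 in norm.\<close>

lemma sec_mult_left: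
  assumes "onV X" "cptop K"
  shows "(\<lambda>n. (sec X n o\<^sub>L sec K n) - sec (X o\<^sub>L K) n) \<longlonglongrightarrow> 0"
proof (rule Lim_null_comparison[OF always_eventually[OF allI]])
  fix n
  have "(sec X n o\<^sub>L sec K n) - sec (X o\<^sub>L K) n = - sec (X o\<^sub>L ((PU - P (Suc n)) o\<^sub>L K)) n"
    using assms by (intro blinfun_eqI)
      (simp add: sec_apply blinfun.diff_left blinfun.minus_left pr_pr blinfun.diff_right
        linear_diff[OF bounded_linear.linear[OF bounded_linear_pr]] cptop_def onV_def)
  then have "norm ((sec X n o\<^sub>L sec K n) - sec (X o\<^sub>L K) n) \<le> norm (X o\<^sub>L ((PU - P (Suc n)) o\<^sub>L K))"
    using norm_sec by simp
  also have "\<dots> \<le> norm X * norm ((PU - P (Suc n)) o\<^sub>L K)" by (rule norm_blinfun_compose)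
  finally show "norm ((sec X n o\<^sub>L sec K n) - sec (X o\<^sub>L K) n) \<le> norm X * norm ((PU - P (Suc n)) o\<^sub>L K)" .
next
  show "(\<lambda>n. norm X * norm ((PU - P (Suc n)) o\<^sub>L K)) \<longlonglongrightarrow> 0"
    by (intro tendsto_mult_right_zero LIMSEQ_Suc cpt_tail_left) (use assms in \<open>simp add: cptop_def\<close>)
qed

text \<open>The same with \<open>K (PU - P) X\<close>, which requires the tails on the right of
  \<open>K\<close>.\<close>

lemma sec_mult_right:
  assumes "onV X" "cptop K"
  shows "(\<lambda>n. (sec K n o\<^sub>L sec X n) - sec (K o\<^sub>L X) n) \<longlonglongrightarrow> 0"
proof (rule Lim_null_comparison[OF always_eventually[OF allI]])
  fix n
  have "(sec K n o\<^sub>L sec X n) - sec (K o\<^sub>L X) n = - sec ((K o\<^sub>L (PU - P (Suc n))) o\<^sub>L X) n"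
    using assms by (intro blinfun_eqI)
      (simp add: sec_apply blinfun.diff_left blinfun.minus_left pr_pr blinfun.diff_right
        linear_diff[OF bounded_linear.linear[OF bounded_linear_pr]] cptop_def onV_def)
  then have "norm ((sec K n o\<^sub>L sec X n) - sec (K o\<^sub>L X) n) \<le> norm ((K o\<^sub>L (PU - P (Suc n))) o\<^sub>L X)"
    using norm_sec by simp
  also have "\<dots> \<le> norm (K o\<^sub>L (PU - P (Suc n))) * norm X" by (rule norm_blinfun_compose)
  finally show "norm ((sec K n o\<^sub>L sec X n) - sec (K o\<^sub>L X) n) \<le> norm (K o\<^sub>L (PU - P (Suc n))) * norm X" .
next
  show "(\<lambda>n. norm (K o\<^sub>L (PU - P (Suc n))) * norm X) \<longlonglongrightarrow> 0"
    by (intro tendsto_mult_left_zero LIMSEQ_Suc cpt_tail_right) (use assms in \<open>simp_all add: cptop_def\<close>)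
qed

lemma cpt_ideal_mult_left:
  assumes "sec_like Y" "cpt_ideal A" shows "cpt_ideal (\<lambda>n. Y n o\<^sub>L A n)"
proof -
  obtain X where X: "onV X" "(\<lambda>n. Y n - sec X n) \<longlonglongrightarrow> 0" using assms by (auto simp: sec_like_def)
  obtain K where K: "cptop K" "(\<lambda>n. A n - sec K n) \<longlonglongrightarrow> 0" using assms by (auto simp: cpt_ideal_def)
  obtain C where C: "\<And>n. norm (Y n) \<le> C" using sec_like_bounded[OF assms(1)] by blast
  \<comment> \<open>The three terms telescope to \<open>Y A - sec (X K)\<close>: the first is small
    by boundedness of \<open>Y\<close>, the second by \<open>norm_sec\<close>, the third by
    \<open>sec_mult_left\<close>.\<close>
  have "(\<lambda>n. (Y n o\<^sub>L (A n - sec K n)) + ((Y n - sec X n) o\<^sub>L sec K n) + ((sec X n o\<^sub>L sec K n) - sec (X o\<^sub>L K) n)) \<longlonglongrightarrow> 0"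
    by (intro tendsto_add_zero compose_null_right[OF K(2) C] compose_null_left[OF X(2) norm_sec] sec_mult_left X K)
  then show ?thesis
    by (intro JJI[OF cptop_left[OF X(1) K(1)]]) (simp add: compose_simps)
qed

lemma cpt_ideal_mult_right:
  assumes "sec_like Y" "cpt_ideal A" shows "cpt_ideal (\<lambda>n. A n o\<^sub>L Y n)"
proof -
  obtain X where X: "onV X" "(\<lambda>n. Y n - sec X n) \<longlonglongrightarrow> 0" using assms by (auto simp: sec_like_def)
  obtain K where K: "cptop K" "(\<lambda>n. A n - sec K n) \<longlonglongrightarrow> 0" using assms by (auto simp: cpt_ideal_def)
  obtain C where C: "\<And>n. norm (Y n) \<le> C" using sec_like_bounded[OF assms(1)] by blast
  have "(\<lambda>n. ((A n - sec K n) o\<^sub>L Y n) + (sec K n o\<^sub>L (Y n - sec X n)) + ((sec K n o\<^sub>L sec X n) - sec (K o\<^sub>L X) n)) \<longlonglongrightarrow> 0"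
    by (intro tendsto_add_zero compose_null_left[OF K(2) C] compose_null_right[OF X(2) norm_sec] sec_mult_right X K)
  then show ?thesis
    by (intro JJI[OF cptop_right[OF X(1) K(1)]]) (simp add: compose_simps)
qed

lemma sec_tendsto:
  assumes "onV X" shows "(\<lambda>n. sec X n x) \<longlonglongrightarrow> X x"
proof -
  have "(\<lambda>n. pr (Suc n) x) \<longlonglongrightarrow> pu x" by (rule LIMSEQ_Suc[OF pr_tendsto])
  then have a: "(\<lambda>n. X (pr (Suc n) x)) \<longlonglongrightarrow> X x"
    using blinfun.tendsto[OF tendsto_const[of X]] assms by (metis onV_def)
  have "(\<lambda>n. pr (Suc n) (X (pr (Suc n) x) - X x)) \<longlonglongrightarrow> 0"
    by (rule Lim_null_comparison[OF always_eventually[OF allI[OF norm_pr]]])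
      (use a in \<open>simp add: tendsto_norm_zero LIM_zero_iff\<close>)
  moreover have "(\<lambda>n. pr (Suc n) (X x)) \<longlonglongrightarrow> X x"
    using LIMSEQ_Suc[OF pr_tendsto[of "X x"]] assms by (simp add: onV_def)
  ultimately have "(\<lambda>n. pr (Suc n) (X (pr (Suc n) x) - X x) + pr (Suc n) (X x)) \<longlonglongrightarrow> 0 + X x"
    by (rule tendsto_add)
  then show ?thesis by (simp add: sec_apply linear_diff[OF bounded_linear.linear[OF bounded_linear_pr]])
qed

text \<open>The norm is lower semicontinuous under strong convergence. Hence the distance of two
  compact operators can be read off from their sections up to null sequences.\<close>

lemma norm_le_sec:
  assumes X: "onV X" and ev: "\<And>d. d > 0 \<Longrightarrow> \<forall>\<^sub>F n in sequentially. norm (sec X n) \<le> c + d" and c: "0 \<le> c"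
  shows "norm X \<le> c"
proof (rule norm_blinfun_bound[OF c])
  fix x
  have lim: "(\<lambda>n. norm (sec X n x)) \<longlonglongrightarrow> norm (X x)" by (intro tendsto_norm sec_tendsto X)
  have "norm (X x) \<le> (c + d) * norm x" if "d > 0" for d
  proof (rule tendsto_upperbound[OF lim])
    show "\<forall>\<^sub>F n in sequentially. norm (sec X n x) \<le> (c + d) * norm x"
      using ev[OF that]
      by eventually_elim (meson mult_right_mono norm_blinfun norm_ge_zero order_trans)
  qed simp
  then have "norm (X x) \<le> c * norm x + d" if "d > 0" for d
  proof (cases "x = 0")
    case False
    have "norm (X x) \<le> (c + d / norm x) * norm x" using that False \<open>\<And>d. d > 0 \<Longrightarrow> norm (X x) \<le> (c + d) * norm x\<close> by simp
    then show ?thesis using False by (simp add: distrib_right)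
  qed (use that in simp)
  then show "norm (X x) \<le> c * norm x" by (rule field_le_epsilon)
qed

text \<open>By \<open>norm_le_sec\<close> the compact operators belonging to the approximants form a
  Cauchy sequence; its limit is compact and belongs to \<open>A\<close>.\<close>

lemma cpt_ideal_closed:
  assumes "\<And>e. e > 0 \<Longrightarrow> \<exists>B. cpt_ideal B \<and> (\<forall>n. norm (A n - B n) \<le> e)"
  shows "cpt_ideal A"
proof -
  have "\<forall>j. \<exists>B. cpt_ideal B \<and> (\<forall>n. norm (A n - B n) \<le> 1 / real (Suc j))" using assms by simp
  then obtain B where B: "\<And>j. cpt_ideal (B j)" "\<And>j n. norm (A n - B j n) \<le> 1 / real (Suc j)" by metis
  have "\<forall>j. \<exists>K. cptop K \<and> (\<lambda>n. B j n - sec K n) \<longlonglongrightarrow> 0" using B(1) by (auto simp: cpt_ideal_def)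
  then obtain K where K: "\<And>j. cptop (K j)" "\<And>j. (\<lambda>n. B j n - sec (K j) n) \<longlonglongrightarrow> 0" by metis
  have KK: "norm (K i - K j) \<le> 1 / real (Suc i) + 1 / real (Suc j)" for i j
  proof (rule norm_le_sec)
    show "onV (K i - K j)" using K(1) by (intro onV_diff) (auto simp: cptop_def)
    fix d :: real assume d: "d > 0"
    have "\<forall>\<^sub>F n in sequentially. norm (B i n - sec (K i) n) < d/2" "\<forall>\<^sub>F n in sequentially. norm (B j n - sec (K j) n) < d/2"
      using d by (intro order_tendstoD(2)[OF tendsto_norm_zero[OF K(2)]]; simp)+
    then show "\<forall>\<^sub>F n in sequentially. norm (sec (K i - K j) n) \<le> 1 / real (Suc i) + 1 / real (Suc j) + d"
    proof eventually_elim
      case (elim n)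
      have "sec (K i - K j) n = (A n - B j n) - (A n - B i n) - (B i n - sec (K i) n) + (B j n - sec (K j) n)"
        by (simp add: sec_diff)
      then have "norm (sec (K i - K j) n) \<le> norm (A n - B j n) + norm (A n - B i n) + norm (B i n - sec (K i) n) + norm (B j n - sec (K j) n)"
        using norm_triangle_ineq[of "(A n - B j n) - (A n - B i n) - (B i n - sec (K i) n)" "B j n - sec (K j) n"]
          norm_triangle_ineq4[of "(A n - B j n) - (A n - B i n)" "B i n - sec (K i) n"]
          norm_triangle_ineq4[of "A n - B j n" "A n - B i n"] by simp
      then show ?case using elim B(2)[of n i] B(2)[of n j] by linarith
    qed
  qed simp
  have small: "\<exists>N. \<forall>j\<ge>N. 1 / real (Suc j) < e" if "e > 0" for e :: real
  proof -
    obtain N :: nat where "1 / real (Suc N) < e" using nat_approx_posE[OF \<open>e > 0\<close>] by blast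
    then have "1 / real (Suc j) < e" if "j \<ge> N" for j
      using that by (meson le_less_trans frac_le less_eq_real_def of_nat_0_less_iff of_nat_le_iff Suc_le_mono zero_less_Suc zero_le_one order_refl)
    then show ?thesis by blast
  qed
  have "Cauchy K"
  proof (rule metric_CauchyI)
    fix e :: real assume "e > 0"
    then obtain N where N: "\<And>j. j \<ge> N \<Longrightarrow> 1 / real (Suc j) < e/2" using small[of "e/2"] by auto
    have "dist (K m) (K n) < e" if "m \<ge> N" "n \<ge> N" for m n
      using KK[of m n] N[OF that(1)] N[OF that(2)] by (simp add: dist_norm)
    then show "\<exists>M. \<forall>m\<ge>M. \<forall>n\<ge>M. dist (K m) (K n) < e" by blast
  qed
  then obtain L where L: "K \<longlonglongrightarrow> L" using Cauchy_convergent[OF \<open>Cauchy K\<close>] by (auto simp: convergent_def)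
  have "cptop L" unfolding cptop_def
  proof
    show "onV L" by (rule onV_limit[OF _ L]) (use K(1) in \<open>simp add: cptop_def\<close>)
    show "cpt L"
    proof (rule cpt_limit)
      fix e :: real assume "e > 0"
      then have "\<forall>\<^sub>F j in sequentially. dist (K j) L < e" using tendstoD[OF L] by blast
      then obtain j where "dist (K j) L < e" by (auto simp: eventually_sequentially)
      then show "\<exists>Y. cpt Y \<and> norm (L - Y) \<le> e"
        using K(1) by (intro exI[of _ "K j"]) (auto simp: cptop_def dist_norm norm_minus_commute)
    qed
  qed
  moreover have "(\<lambda>n. A n - sec L n) \<longlonglongrightarrow> 0"
  proof (rule metric_LIMSEQ_I)
    fix e :: real assume e: "e > 0"
    have "\<forall>\<^sub>F j in sequentially. dist (K j) L < e/3" using tendstoD[OF L, of "e/3"] e by simp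
    moreover have "\<forall>\<^sub>F j in sequentially. 1 / real (Suc j) < e/3"
      using small[of "e/3"] e by (simp add: eventually_sequentially)
    ultimately have "\<forall>\<^sub>F j in sequentially. dist (K j) L < e/3 \<and> 1 / real (Suc j) < e/3" by (rule eventually_conj)
    then obtain j where j: "dist (K j) L < e/3" "1 / real (Suc j) < e/3" by (auto simp: eventually_sequentially)
    have "\<forall>\<^sub>F n in sequentially. norm (B j n - sec (K j) n) < e/3"
      using e by (intro order_tendstoD(2)[OF tendsto_norm_zero[OF K(2)]]) simp
    then obtain N where N: "\<And>n. n \<ge> N \<Longrightarrow> norm (B j n - sec (K j) n) < e/3" by (auto simp: eventually_sequentially)
    have "norm (A n - sec L n) < e" if "n \<ge> N" for n
    proof -
      have eq: "A n - sec L n = (A n - B j n) + (B j n - sec (K j) n) + sec (K j - L) n" by (simp add: sec_diff)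
      have "norm (A n - sec L n) \<le> norm (A n - B j n) + norm (B j n - sec (K j) n) + norm (sec (K j - L) n)"
        unfolding eq using norm_triangle_ineq[of "(A n - B j n) + (B j n - sec (K j) n)" "sec (K j - L) n"]
          norm_triangle_ineq[of "A n - B j n" "B j n - sec (K j) n"] by linarith
      then show ?thesis using N[OF that] j norm_sec[of "K j - L" n] B(2)[of n j] by (simp add: dist_norm)
    qed
    then show "\<exists>no. \<forall>n\<ge>no. dist (A n - sec L n) 0 < e" by auto
  qed
  ultimately show ?thesis by (rule JJI)
qed

end

section \<open>Sections of truncated Toeplitz operators\<close>

definition Mul :: "cfun \<Rightarrow> hil \<Rightarrow>\<^sub>L hil" where "Mul a = Blinfun (mulop a)"

lemma Mul_apply [simp]: "blinfun_apply (Mul a) = mulop a"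
  by (simp add: Mul_def bounded_linear_Blinfun_apply bounded_linear_mulop)

lemma norm_rk1_diff: "norm (rk1 a b - rk1 c d) \<le> norm (a - c) * norm b + norm c * norm (b - d)"
proof -
  have eq: "rk1 a b - rk1 c d = rk1 (a - c) b + rk1 c (b - d)"
    by (rule blinfun_eqI) (simp add: blinfun.diff_left blinfun.add_left scaleC_diff cip_right_diff scaleC_diff_left)
  show ?thesis unfolding eq
    using norm_triangle_ineq[of "rk1 (a - c) b" "rk1 c (b - d)"] norm_rk1[of "a - c" b] norm_rk1[of c "b - d"] by linarith
qed

text \<open>The backward shift \<open>(h - h(0)) / z\<close>; the subtracted term is the coefficient
  that division by \<open>z\<close> moves to index -1.\<close>

definition shiftback :: "hil \<Rightarrow> hil" where
  "shiftback h = mulop (\<lambda>z. z powi (-1)) h - cip h (zpow 0) *\<^sub>C zpow (-1)"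

lemma mulop_cnj_z: "mulop (\<lambda>z. cnj z) h = mulop (\<lambda>z. z powi (-1)) h"
  by (rule mulop_cong') (auto simp: bdd_sym_cnj bdd_sym_id cnj_circle)

lemma shiftback_Hardy:
  assumes "h \<in> Hardy" shows "shiftback h \<in> Hardy"
  unfolding Hardy_def
proof (intro CollectI allI impI)
  fix n :: int assume n: "n < 0"
  have "cip (shiftback h) (zpow n) = cip h (zpow (n + 1)) - cip h (zpow 0) * (if n = -1 then 1 else 0)"
    unfolding shiftback_def by (simp add: cip_left_diff cip_mulop_powi cip_zpow del: power_int_minus1_right)
  also have "\<dots> = 0" using assms n by (auto simp: Hardy_def)
  finally show "cip (shiftback h) (zpow n) = 0" .
qed

lemma Hardy_decomp: "h = cip h (zpow 0) *\<^sub>C zpow 0 + mulop (\<lambda>z. z) (shiftback h)"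
proof -
  have "mulop (\<lambda>z. z) (mulop (\<lambda>z. z powi (-1)) h) = mulop (\<lambda>z. z * z powi (-1)) h"
    by (rule mulop_mulop[OF bdd_sym_id bdd_sym_powi])
  also have "\<dots> = mulop (\<lambda>z. 1) h"
  proof (rule mulop_cong'[OF bdd_sym_mult[OF bdd_sym_id bdd_sym_powi]])
    fix z :: complex assume "cmod z = 1"
    then have "z \<noteq> 0" by auto
    then show "z * z powi (-1) = 1" by simp
  qed
  finally have "mulop (\<lambda>z. z) (mulop (\<lambda>z. z powi (-1)) h) = h" by (simp add: mulop_one del: power_int_minus1_right)
  moreover have "mulop (\<lambda>z. z) (zpow (-1)) = zpow 0" using mulop_powi_zpow[of 1 "-1"] by simp
  ultimately show ?thesis by (simp add: shiftback_def mulop_diff mulop_scaleC)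
qed

lemma cip_z_left: "cip (mulop (\<lambda>z. z) x) y = cip x (mulop (\<lambda>z. cnj z) y)"
  by (rule cip_mulop[OF bdd_sym_id])

lemma cip_cnj_z_left: "cip (mulop (\<lambda>z. cnj z) x) y = cip x (mulop (\<lambda>z. z) y)"
  using cip_mulop[OF bdd_sym_cnj[OF bdd_sym_id], of x y] by simp

context bzeros
begin

lemma U_eq: "U n = mulop (bl {..<n}) (zpow 0)" by (simp add: U_def cl_bl)

lemma mulop_z_bl: "mulop (\<lambda>z. z) (mulop (bl S) x) = mulop (bl S) (mulop (\<lambda>z. z) x)"
  by (simp add: mulop_mulop bdd_sym_id bdd_sym_bl mult.commute)

lemma pr_Hardy: "pr n x \<in> Hardy"
  using pr_KV[of n x] by (simp add: KV_def)

lemma pr_orth_bl: "k \<in> Hardy \<Longrightarrow> cip (pr n x) (mulop (bl {..<n}) k) = 0"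
  using pr_KV[of n x] by (simp add: KV_def)

text \<open>Model spaces are invariant under the backward shift: pairing with
  \<open>bl {..<n} * k\<close> moves \<open>z\<close> to \<open>k\<close>, and the correction term
  is orthogonal to \<open>Hardy\<close>.\<close>

lemma shiftback_pr: "pr n (shiftback (pr n y)) = shiftback (pr n y)"
proof -
  define h where "h = pr n y"
  have "shiftback h \<in> KV (bl {..<n})"
    unfolding KV_def
  proof (intro CollectI conjI ballI)
    show "shiftback h \<in> Hardy" unfolding h_def by (intro shiftback_Hardy pr_Hardy)
    fix k assume k: "k \<in> Hardy"
    have "cip (mulop (\<lambda>z. z powi (-1)) h) (mulop (bl {..<n}) k) = cip h (mulop (bl {..<n}) (mulop (\<lambda>z. z) k))"
      unfolding mulop_cnj_z[symmetric] by (simp add: cip_cnj_z_left mulop_z_bl)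
    also have "\<dots> = 0" unfolding h_def by (intro pr_orth_bl Hardy_z k)
    finally have 1: "cip (mulop (\<lambda>z. z powi (-1)) h) (mulop (bl {..<n}) k) = 0" .
    have "cip (mulop (bl {..<n}) k) (zpow (-1)) = 0" using Hardy_bl[of "{..<n}" k] k by (simp add: Hardy_def)
    then have "cip (zpow (-1)) (mulop (bl {..<n}) k) = 0" by (subst cip_commute) simp
    with 1 show "cip (shiftback h) (mulop (bl {..<n}) k) = 0"
      by (simp add: shiftback_def cip_left_diff del: power_int_minus1_right)
  qed
  then show ?thesis unfolding KV_bl h_def by simp
qed

text \<open>After moving \<open>z\<close> to the other side, \<open>cnj z\<close> meets a vector of
  the model space and yields its backward shift, again in the model space, plus a multiple of
  \<open>zpow (-1)\<close>. Since \<open>w\<close> is orthogonal to the model space, only the second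
  part counts.\<close>

lemma pr_z_orth:
  assumes "pr n w = 0"
  shows "pr n (mulop (\<lambda>z. z) w) = cip w (zpow (-1)) *\<^sub>C pr n (zpow 0)"
proof -
  have "cip (pr n (mulop (\<lambda>z. z) w) - cip w (zpow (-1)) *\<^sub>C pr n (zpow 0)) y = 0" for y
  proof -
    define h where "h = pr n y"
    have "mulop (\<lambda>z. cnj z) h = shiftback h + cip h (zpow 0) *\<^sub>C zpow (-1)"
      by (simp add: shiftback_def mulop_cnj_z)
    moreover have "cip w (shiftback h) = 0"
      using shiftback_pr[of n y] pr_self_adjoint[of n w "shiftback h"] assms by (simp add: h_def)
    ultimately have "cip w (mulop (\<lambda>z. cnj z) h) = cnj (cip h (zpow 0)) * cip w (zpow (-1))"
      by (simp add: cip_add_right)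
    then show ?thesis
      by (simp add: cip_left_diff pr_self_adjoint cip_z_left h_def[symmetric] cip_commute[of "zpow 0" h])
  qed
  then have "pr n (mulop (\<lambda>z. z) w) - cip w (zpow (-1)) *\<^sub>C pr n (zpow 0) = 0" by (rule cip_eq_0_imp)
  then show ?thesis by simp
qed

text \<open>Multiplication by \<open>z\<close> leaves the model space only in the direction
  \<open>U n\<close>: up to a constant every Hardy vector is \<open>z * k'\<close>, and
  \<open>z * h\<close> is orthogonal to \<open>z * bl {..<n} * k'\<close>.\<close>

lemma z_pr_decomp: "pr n (mulop (\<lambda>z. z) (pr n y) - cip (mulop (\<lambda>z. z) (pr n y)) (U n) *\<^sub>C U n)
   = mulop (\<lambda>z. z) (pr n y) - cip (mulop (\<lambda>z. z) (pr n y)) (U n) *\<^sub>C U n"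
proof -
  define h where "h = pr n y"
  define c where "c = cip (mulop (\<lambda>z. z) h) (U n)"
  have "mulop (\<lambda>z. z) h - c *\<^sub>C U n \<in> KV (bl {..<n})"
    unfolding KV_def
  proof (intro CollectI conjI ballI)
    show "mulop (\<lambda>z. z) h - c *\<^sub>C U n \<in> Hardy" unfolding h_def
      by (intro Hardy_diff Hardy_z pr_Hardy Hardy_scale U_Hardy)
    fix k assume k: "k \<in> Hardy"
    define k0 k' where "k0 = cip k (zpow 0)" and "k' = shiftback k"
    have kd: "k = k0 *\<^sub>C zpow 0 + mulop (\<lambda>z. z) k'" unfolding k0_def k'_def by (rule Hardy_decomp)
    have k': "k' \<in> Hardy" unfolding k'_def by (intro shiftback_Hardy k)
    have "mulop (bl {..<n}) k = k0 *\<^sub>C U n + mulop (\<lambda>z. z) (mulop (bl {..<n}) k')"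
      by (subst kd) (simp add: mulop_add mulop_scaleC U_eq mulop_z_bl)
    moreover have "cip (mulop (\<lambda>z. z) h) (mulop (\<lambda>z. z) (mulop (bl {..<n}) k')) = cip h (mulop (bl {..<n}) k')"
      by (rule cip_mulop_isometry) (auto simp: bdd_sym_id)
    moreover have "cip h (mulop (bl {..<n}) k') = 0" unfolding h_def by (intro pr_orth_bl k')
    ultimately have 1: "cip (mulop (\<lambda>z. z) h) (mulop (bl {..<n}) k) = cnj k0 * c"
      by (simp add: cip_add_right c_def)
    have "cip (U n) (mulop (bl {..<n}) k) = cip (zpow 0) k" by (simp add: U_eq cip_bl_isometry)
    also have "\<dots> = cnj k0" unfolding k0_def by (rule cip_commute)
    finally show "cip (mulop (\<lambda>z. z) h - c *\<^sub>C U n) (mulop (bl {..<n}) k) = 0"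
      using 1 by (simp add: cip_left_diff)
  qed
  then show ?thesis unfolding KV_bl h_def c_def by simp
qed

text \<open>The counterpart of \<open>pr_z_orth\<close> with \<open>z_pr_decomp\<close> in place of
  the backward shift. The distinguished vector is now \<open>U n\<close>, which changes with
  \<open>n\<close>.\<close>

lemma pr_cnj_z_orth:
  assumes "pr n w = 0"
  shows "pr n (mulop (\<lambda>z. cnj z) w) = cip w (U n) *\<^sub>C pr n (mulop (\<lambda>z. cnj z) (U n))"
proof -
  have "cip (pr n (mulop (\<lambda>z. cnj z) w) - cip w (U n) *\<^sub>C pr n (mulop (\<lambda>z. cnj z) (U n))) y = 0" for y
  proof -
    define h where "h = pr n y"
    define c where "c = cip (mulop (\<lambda>z. z) h) (U n)"
    define g where "g = mulop (\<lambda>z. z) h - c *\<^sub>C U n"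
    have "pr n g = g" unfolding g_def c_def h_def by (rule z_pr_decomp)
    then have "cip w g = 0" using pr_self_adjoint[of n w g] assms by simp
    moreover have "mulop (\<lambda>z. z) h = g + c *\<^sub>C U n" by (simp add: g_def)
    ultimately have "cip w (mulop (\<lambda>z. z) h) = cnj c * cip w (U n)" by (simp add: cip_add_right)
    moreover have "cip (U n) (mulop (\<lambda>z. z) h) = cnj c" unfolding c_def by (rule cip_commute)
    ultimately show ?thesis
      by (simp add: cip_left_diff pr_self_adjoint cip_cnj_z_left h_def[symmetric])
  qed
  then have "pr n (mulop (\<lambda>z. cnj z) w) - cip w (U n) *\<^sub>C pr n (mulop (\<lambda>z. cnj z) (U n)) = 0" by (rule cip_eq_0_imp)
  then show ?thesis by simp
qed

definition T :: "cfun \<Rightarrow> hil \<Rightarrow>\<^sub>L hil" where "T a = PU o\<^sub>L Mul a o\<^sub>L PU"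

lemma T_apply: "T a x = pu (mulop a (pu x))" by (simp add: T_def)

lemma onV_T: "onV (T a)"
  by (simp add: onV_def clin_def T_apply pu_pu pu_scaleC mulop_scaleC)

lemma norm_T:
  assumes "\<And>z. cmod z = 1 \<Longrightarrow> cmod (a z) \<le> C"
  shows "norm (T a) \<le> C"
proof (rule norm_blinfun_bound)
  show C: "0 \<le> C" using assms[of 1] by (auto intro: order_trans[OF norm_ge_zero])
  fix x
  have "norm (T a x) \<le> norm (mulop a (pu x))" by (simp add: T_apply norm_pu)
  also have "\<dots> \<le> C * norm (pu x)" by (rule norm_mulop[OF assms])
  also have "\<dots> \<le> C * norm x" by (intro mult_left_mono norm_pu C)
  finally show "norm (T a x) \<le> C * norm x" .
qed

lemma T_add: "bdd_sym a \<Longrightarrow> bdd_sym b \<Longrightarrow> bdd_sym (\<lambda>z. a z + b z) \<Longrightarrow> T (\<lambda>z. a z + b z) = T a + T b"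
  by (rule blinfun_eqI) (simp add: T_apply mulop_add_symbol pu_add blinfun.add_left)

lemma T_scale: "bdd_sym a \<Longrightarrow> bdd_sym (\<lambda>z. c * a z) \<Longrightarrow> T (\<lambda>z. c * a z) = cmul c (T a)"
  by (rule blinfun_eqI) (simp add: T_apply mulop_scale_symbol pu_scaleC)

lemma sec_T: "sec (T a) n x = pr (Suc n) (mulop a (pr (Suc n) x))"
  by (simp add: sec_apply T_apply pu_pr pr_pu)

definition cont_sym :: "cfun \<Rightarrow> bool" where "cont_sym a \<longleftrightarrow> continuous_on (sphere 0 1) a"

lemma cont_bdd_sym: "cont_sym a \<Longrightarrow> bdd_sym a" by (simp add: cont_sym_def bdd_sym_cont)
lemma cont_mult: "cont_sym a \<Longrightarrow> cont_sym b \<Longrightarrow> cont_sym (\<lambda>z. a z * b z)" by (simp add: cont_sym_def continuous_intros)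
lemma cont_add: "cont_sym a \<Longrightarrow> cont_sym b \<Longrightarrow> cont_sym (\<lambda>z. a z + b z)" by (simp add: cont_sym_def continuous_intros)
lemma cont_diff: "cont_sym a \<Longrightarrow> cont_sym b \<Longrightarrow> cont_sym (\<lambda>z. a z - b z)" by (simp add: cont_sym_def continuous_intros)
lemma cont_const: "cont_sym (\<lambda>z. c)" by (simp add: cont_sym_def)
lemma cont_scale: "cont_sym a \<Longrightarrow> cont_sym (\<lambda>z. c * a z)" by (intro cont_mult cont_const)
lemma cont_id: "cont_sym (\<lambda>z. z)" by (simp add: cont_sym_def)
lemma cont_cnj: "cont_sym (\<lambda>z. cnj z)" by (simp add: cont_sym_def continuous_intros)

definition semicomm :: "cfun \<Rightarrow> cfun \<Rightarrow> nat \<Rightarrow> hil \<Rightarrow>\<^sub>L hil" where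
  "semicomm a b n = (sec (T a) n o\<^sub>L sec (T b) n) - sec (T (\<lambda>z. a z * b z)) n"

text \<open>In the form \<open>- P a (1 - P) b P\<close> the vector to which \<open>a\<close> is
  applied is annihilated by the projection, as \<open>pr_z_orth\<close> and
  \<open>pr_cnj_z_orth\<close> require.\<close>

lemma semicomm_apply:
  assumes "bdd_sym a" "bdd_sym b"
  shows "semicomm a b n x = - pr (Suc n) (mulop a (mulop b (pr (Suc n) x) - pr (Suc n) (mulop b (pr (Suc n) x))))"
  by (simp add: semicomm_def blinfun.diff_left sec_T pr_pr mulop_diff mulop_mulop assms pr_diff)

lemma pr_defect: "pr n (x - pr n x) = 0" by (simp add: pr_diff pr_pr)

lemma sec_rk1: "sec (rk1 (pu a) (pu b)) n = rk1 (pr (Suc n) a) (pr (Suc n) b)"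
  by (rule blinfun_eqI)
    (simp add: sec_apply pu_self_adjoint[symmetric] pu_pr pr_self_adjoint pr_scaleC pr_pu)

lemma cptop_rk1_pu: "cptop (rk1 (pu a) (pu b))"
  by (intro cptop_rk1 pu_pu)

text \<open>By \<open>pr_z_orth\<close> the entry has rank one and depends on the coefficient of
  \<open>w\<close> at -1. This coefficient is a fixed functional of \<open>p x\<close>, so the
  entries are sections of one rank one operator.\<close>

lemma cpt_ideal_semicomm_z:
  assumes b: "cont_sym b"
  shows "cpt_ideal (semicomm (\<lambda>z. z) b)"
proof -
  define \<beta> where "\<beta> = mulop (\<lambda>z. cnj (b z)) (zpow (-1))"
  have "semicomm (\<lambda>z. z) b n = - sec (rk1 (pu (zpow 0)) (pu \<beta>)) n" for n
  proof (rule blinfun_eqI)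
    fix x
    define p w where "p = pr (Suc n)" and "w = mulop b (p x) - p (mulop b (p x))"
    \<comment> \<open>The subtracted projection lies in \<open>Hardy\<close> and has no coefficient
      at -1.\<close>
    have "cip w (zpow (-1)) = cip (mulop b (p x)) (zpow (-1))"
      using pr_Hardy[of "Suc n" "mulop b (p x)"] by (simp add: w_def cip_left_diff p_def Hardy_def)
    also have "\<dots> = cip (p x) \<beta>" by (simp add: \<beta>_def cip_mulop cont_bdd_sym b)
    also have "\<dots> = cip x (p \<beta>)" unfolding p_def by (rule pr_self_adjoint)
    finally have "cip w (zpow (-1)) = cip x (p \<beta>)" .
    moreover have "p w = 0" unfolding w_def p_def by (rule pr_defect)
    ultimately show "semicomm (\<lambda>z. z) b n x = (- sec (rk1 (pu (zpow 0)) (pu \<beta>)) n) x"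
      using pr_z_orth[of "Suc n" w]
      by (simp add: semicomm_apply bdd_sym_id cont_bdd_sym b p_def[symmetric] w_def[symmetric] sec_rk1 blinfun.minus_left)
  qed
  then have "semicomm (\<lambda>z. z) b = (\<lambda>n. - sec (rk1 (pu (zpow 0)) (pu \<beta>)) n)" by (simp add: fun_eq_iff)
  then show ?thesis using cpt_ideal_minus[OF cpt_ideal_sec[OF cptop_rk1_pu]] by simp
qed

text \<open>Here both vectors of the rank one entry are built from \<open>U (Suc n)\<close>. They
  converge in norm because \<open>U\<close> does, so the entries differ from the sections of one
  rank one operator by a null sequence.\<close>

lemma cpt_ideal_semicomm_cnj_z:
  assumes b: "cont_sym b"
  shows "cpt_ideal (semicomm (\<lambda>z. cnj z) b)"
proof -
  have bb: "bdd_sym b" "bdd_sym (\<lambda>z. cnj (b z))" using b by (simp_all add: cont_bdd_sym bdd_sym_cnj)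
  define \<alpha> where "\<alpha> n = mulop (\<lambda>z. cnj z) (U n)" for n
  define \<beta> where "\<beta> n = mulop (\<lambda>z. cnj (b z)) (U n)" for n
  define \<alpha>0 \<beta>0 where "\<alpha>0 = mulop (\<lambda>z. cnj z) u0" and "\<beta>0 = mulop (\<lambda>z. cnj (b z)) u0"
  have al: "\<alpha> \<longlonglongrightarrow> \<alpha>0" and be: "\<beta> \<longlonglongrightarrow> \<beta>0"
    unfolding \<alpha>_def[abs_def] \<beta>_def[abs_def] \<alpha>0_def \<beta>0_def by (intro mulop_tendsto U_tendsto)+
  have DTn: "semicomm (\<lambda>z. cnj z) b n = - rk1 (pr (Suc n) (\<alpha> (Suc n))) (pr (Suc n) (\<beta> (Suc n)))" for n
  proof (rule blinfun_eqI)
    fix x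
    define p w where "p = pr (Suc n)" and "w = mulop b (p x) - p (mulop b (p x))"
    \<comment> \<open>The subtracted projection lies in the model space, which is orthogonal to
      \<open>U (Suc n)\<close>, the product times the constant 1.\<close>
    have "cip w (U (Suc n)) = cip (mulop b (p x)) (U (Suc n))"
      using pr_orth_bl[of "zpow 0" "Suc n" "mulop b (p x)"] by (simp add: w_def cip_left_diff p_def Hardy_zpow U_eq)
    also have "\<dots> = cip (p x) (\<beta> (Suc n))" by (simp add: \<beta>_def cip_mulop bb)
    also have "\<dots> = cip x (p (\<beta> (Suc n)))" unfolding p_def by (rule pr_self_adjoint)
    finally have "cip w (U (Suc n)) = cip x (p (\<beta> (Suc n)))" .
    moreover have "p w = 0" unfolding w_def p_def by (rule pr_defect)
    ultimately show "semicomm (\<lambda>z. cnj z) b n x = (- rk1 (pr (Suc n) (\<alpha> (Suc n))) (pr (Suc n) (\<beta> (Suc n)))) x"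
      using pr_cnj_z_orth[of "Suc n" w]
      by (simp add: semicomm_apply bdd_sym_cnj bdd_sym_id bb p_def[symmetric] w_def[symmetric] blinfun.minus_left \<alpha>_def)
  qed
  have "(\<lambda>n. rk1 (pr (Suc n) (\<alpha> (Suc n))) (pr (Suc n) (\<beta> (Suc n))) - sec (rk1 (pu \<alpha>0) (pu \<beta>0)) n) \<longlonglongrightarrow> 0"
  proof (rule Lim_null_comparison[OF always_eventually[OF allI]])
    fix n
    define p where "p = pr (Suc n)"
    have d: "norm (p a - p c) \<le> norm (a - c)" "norm (p a) \<le> norm a" for a c
      unfolding p_def pr_diff[symmetric] by (rule norm_pr)+
    have "norm (rk1 (p (\<alpha> (Suc n))) (p (\<beta> (Suc n))) - rk1 (p \<alpha>0) (p \<beta>0))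
      \<le> norm (p (\<alpha> (Suc n)) - p \<alpha>0) * norm (p (\<beta> (Suc n))) + norm (p \<alpha>0) * norm (p (\<beta> (Suc n)) - p \<beta>0)"
      by (rule norm_rk1_diff)
    also have "\<dots> \<le> norm (\<alpha> (Suc n) - \<alpha>0) * norm (\<beta> (Suc n)) + norm \<alpha>0 * norm (\<beta> (Suc n) - \<beta>0)"
      by (intro add_mono mult_mono d) auto
    finally show "norm (rk1 (pr (Suc n) (\<alpha> (Suc n))) (pr (Suc n) (\<beta> (Suc n))) - sec (rk1 (pu \<alpha>0) (pu \<beta>0)) n)
      \<le> norm (\<alpha> (Suc n) - \<alpha>0) * norm (\<beta> (Suc n)) + norm \<alpha>0 * norm (\<beta> (Suc n) - \<beta>0)"
      by (simp add: p_def sec_rk1)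
  next
    have "(\<lambda>n. norm (\<alpha> (Suc n) - \<alpha>0) * norm (\<beta> (Suc n)) + norm \<alpha>0 * norm (\<beta> (Suc n) - \<beta>0)) \<longlonglongrightarrow>
       norm (\<alpha>0 - \<alpha>0) * norm \<beta>0 + norm \<alpha>0 * norm (\<beta>0 - \<beta>0)"
      by (intro tendsto_intros LIMSEQ_Suc al be)
    then show "(\<lambda>n. norm (\<alpha> (Suc n) - \<alpha>0) * norm (\<beta> (Suc n)) + norm \<alpha>0 * norm (\<beta> (Suc n) - \<beta>0)) \<longlonglongrightarrow> 0" by simp
  qed
  then have "cpt_ideal (\<lambda>n. rk1 (pr (Suc n) (\<alpha> (Suc n))) (pr (Suc n) (\<beta> (Suc n))))" by (rule JJI[OF cptop_rk1_pu])
  from cpt_ideal_minus[OF this] show ?thesis by (simp add: DTn[abs_def])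
qed

definition good_symbols :: "cfun set" where "good_symbols = {a. cont_sym a \<and> (\<forall>b. cont_sym b \<longrightarrow> cpt_ideal (semicomm a b))}"

lemma good_symbols_mult:
  assumes a: "a \<in> good_symbols" and c: "c \<in> good_symbols" shows "(\<lambda>z. a z * c z) \<in> good_symbols"
proof -
  have ac: "cont_sym a" "cont_sym c" using a c by (auto simp: good_symbols_def)
  have "cpt_ideal (semicomm (\<lambda>z. a z * c z) b)" if b: "cont_sym b" for b
  proof -
    have 1: "cpt_ideal (semicomm a c)" "cpt_ideal (semicomm c b)" "cpt_ideal (semicomm a (\<lambda>z. c z * b z))"
      using a c b ac cont_mult by (auto simp: good_symbols_def)
    \<comment> \<open>Regrouping the triple product of sections expresses the semicommutator of
      \<open>a * c\<close> and \<open>b\<close> through three that are already in the ideal.\<close>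
    have "cpt_ideal (\<lambda>n. (sec (T a) n o\<^sub>L semicomm c b n) + semicomm a (\<lambda>z. c z * b z) n - (semicomm a c n o\<^sub>L sec (T b) n))"
      by (intro cpt_ideal_add cpt_ideal_diff 1 cpt_ideal_mult_left cpt_ideal_mult_right sec_like_sec onV_T)
    moreover have "(\<lambda>n. (sec (T a) n o\<^sub>L semicomm c b n) + semicomm a (\<lambda>z. c z * b z) n - (semicomm a c n o\<^sub>L sec (T b) n)) = semicomm (\<lambda>z. a z * c z) b"
      by (intro ext blinfun_eqI) (simp add: semicomm_def blinfun.add_left blinfun.diff_left blinfun.diff_right mult.assoc)
    ultimately show ?thesis by simp
  qed
  then show ?thesis using ac by (simp add: good_symbols_def cont_mult)
qed

lemma good_symbols_add:
  assumes a: "a \<in> good_symbols" and c: "c \<in> good_symbols" shows "(\<lambda>z. a z + c z) \<in> good_symbols"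
proof -
  have ac: "cont_sym a" "cont_sym c" using a c by (auto simp: good_symbols_def)
  have "cpt_ideal (semicomm (\<lambda>z. a z + c z) b)" if b: "cont_sym b" for b
  proof -
    have "cpt_ideal (\<lambda>n. semicomm a b n + semicomm c b n)" using a c b by (intro cpt_ideal_add) (auto simp: good_symbols_def)
    moreover have "semicomm (\<lambda>z. a z + c z) b = (\<lambda>n. semicomm a b n + semicomm c b n)"
      using T_add[of "\<lambda>z. a z * b z" "\<lambda>z. c z * b z"] T_add[of a c] ac b
      by (intro ext) (simp add: semicomm_def distrib_right sec_add compose_simps cont_bdd_sym cont_add cont_mult)
    ultimately show ?thesis by simp
  qed
  then show ?thesis using ac by (simp add: good_symbols_def cont_add)
qed

lemma good_symbols_const: "(\<lambda>z. k) \<in> good_symbols"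
proof -
  have "cpt_ideal (semicomm (\<lambda>z. k) b)" if b: "cont_sym b" for b
  proof -
    have "mulop (\<lambda>z. k) y = k *\<^sub>C y" for y
      using mulop_scale_symbol[OF bdd_sym_const[of 1] bdd_sym_const, of k y] by (simp add: mulop_one)
    then have "semicomm (\<lambda>z. k) b n = 0" for n
      by (intro blinfun_eqI) (simp add: semicomm_apply bdd_sym_const cont_bdd_sym b pr_scaleC pr_defect)
    then have "semicomm (\<lambda>z. k) b = (\<lambda>n. 0)" by (simp add: fun_eq_iff)
    then show ?thesis using cpt_ideal_null[of "\<lambda>n. 0"] by simp
  qed
  then show ?thesis by (simp add: good_symbols_def cont_const)
qed

lemma cont_bounded: assumes "cont_sym b" obtains C where "\<And>z. cmod z = 1 \<Longrightarrow> cmod (b z) \<le> C" "0 \<le> C"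
proof -
  obtain C where C: "\<And>z. cmod z = 1 \<Longrightarrow> cmod (b z) \<le> C" using cont_bdd_sym[OF assms] by (auto simp: bdd_sym_def)
  have "cmod (b 1) \<le> C" using C[of 1] by simp
  then have "0 \<le> C" by (meson norm_ge_zero order_trans)
  with C that show ?thesis by blast
qed

lemma good_symbols_limit:
  assumes a: "cont_sym a" and ap: "\<And>e. e > 0 \<Longrightarrow> \<exists>c\<in>good_symbols. \<forall>z. cmod z = 1 \<longrightarrow> cmod (a z - c z) \<le> e"
  shows "a \<in> good_symbols"
proof -
  have "cpt_ideal (semicomm a b)" if b: "cont_sym b" for b
  proof (rule cpt_ideal_closed)
    fix e :: real assume e: "e > 0"
    obtain C where C: "\<And>z. cmod z = 1 \<Longrightarrow> cmod (b z) \<le> C" "0 \<le> C" using cont_bounded[OF b] by blast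
    \<comment> \<open>Two error terms of size \<open>d * C\<close> must fit into \<open>e\<close>;
      \<open>C + 1\<close> avoids dividing by 0 when \<open>C = 0\<close>.\<close>
    define d where "d = e / (2 * (C + 1))"
    have d0: "d > 0" using e C(2) by (simp add: d_def)
    have "d * (2 * (C + 1)) = e" using C(2) by (simp add: d_def)
    then have d: "d > 0" "d * C + d * C \<le> e" using d0 by (auto simp: algebra_simps)
    obtain c where c: "c \<in> good_symbols" "\<And>z. cmod z = 1 \<Longrightarrow> cmod (a z - c z) \<le> d" using ap[OF d(1)] by blast
    have cc: "cont_sym c" using c by (simp add: good_symbols_def)
    have g: "cont_sym (\<lambda>z. a z - c z)" by (intro cont_diff a cc)
    have T1: "T a = T (\<lambda>z. a z - c z) + T c"
      using T_add[of "\<lambda>z. a z - c z" c] g cc a by (simp add: cont_bdd_sym)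
    have T2: "T (\<lambda>z. a z * b z) = T (\<lambda>z. (a z - c z) * b z) + T (\<lambda>z. c z * b z)"
      using T_add[of "\<lambda>z. (a z - c z) * b z" "\<lambda>z. c z * b z"] cont_mult[OF g b] cont_mult[OF cc b] cont_mult[OF a b]
      by (simp add: cont_bdd_sym left_diff_distrib)
    have "norm (semicomm a b n - semicomm c b n) \<le> e" for n
    proof -
      have eq: "semicomm a b n - semicomm c b n = (sec (T (\<lambda>z. a z - c z)) n o\<^sub>L sec (T b) n) - sec (T (\<lambda>z. (a z - c z) * b z)) n"
        by (simp add: semicomm_def T1 T2 sec_add compose_simps)
      have "norm (sec (T (\<lambda>z. a z - c z)) n o\<^sub>L sec (T b) n) \<le> norm (sec (T (\<lambda>z. a z - c z)) n) * norm (sec (T b) n)"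
        by (rule norm_blinfun_compose)
      also have "\<dots> \<le> d * C"
        by (intro mult_mono order_trans[OF norm_sec norm_T] c C) (use d in auto)
      finally have 1: "norm (sec (T (\<lambda>z. a z - c z)) n o\<^sub>L sec (T b) n) \<le> d * C" .
      have 2: "norm (sec (T (\<lambda>z. (a z - c z) * b z)) n) \<le> d * C"
      proof (rule order_trans[OF norm_sec norm_T])
        fix z :: complex assume "cmod z = 1"
        then show "cmod ((a z - c z) * b z) \<le> d * C"
          unfolding norm_mult using c C d by (intro mult_mono) auto
      qed
      show ?thesis unfolding eq using 1 2 d(2) norm_triangle_ineq4 by (smt (verit))
    qed
    then show "\<exists>B. cpt_ideal B \<and> (\<forall>n. norm (semicomm a b n - B n) \<le> e)"
      using c(1) b by (intro exI[of _ "semicomm c b"]) (simp add: good_symbols_def)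
  qed
  then show ?thesis using a by (simp add: good_symbols_def)
qed

lemma good_symbols_polynomial: "real_polynomial_function p \<Longrightarrow> (\<lambda>z. complex_of_real (p z)) \<in> good_symbols"
proof (induction rule: real_polynomial_function.induct)
  case (linear f)
  have zC: "(\<lambda>z. z) \<in> good_symbols" "(\<lambda>z. cnj z) \<in> good_symbols" using cpt_ideal_semicomm_z cpt_ideal_semicomm_cnj_z by (auto simp: good_symbols_def cont_id cont_cnj)
  \<comment> \<open>A real linear functional on the plane is a complex combination of
    \<open>z\<close> and \<open>cnj z\<close>, so polynomials reduce to these two symbols and
    constants.\<close>
  have "complex_of_real (f z) = (of_real (f 1) / 2 - \<i> / 2 * of_real (f \<i>)) * z + (of_real (f 1) / 2 + \<i> / 2 * of_real (f \<i>)) * cnj z" for z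
  proof -
    have "f z = f (Re z *\<^sub>R 1 + Im z *\<^sub>R \<i>)" by (simp add: scaleR_conv_of_real complex_eq[symmetric] mult.commute)
    also have "\<dots> = Re z * f 1 + Im z * f \<i>"
      using linear by (simp add: bounded_linear.linear linear_add linear_scale)
    finally have "complex_of_real (f z) = of_real (Re z) * of_real (f 1) + of_real (Im z) * of_real (f \<i>)" by simp
    also have "of_real (Re z) = (z + cnj z) / 2" by (simp add: complex_add_cnj)
    also have "of_real (Im z) = - (\<i> / 2) * (z - cnj z)" by (simp add: complex_eq_iff)
    also have "(z + cnj z) / 2 * of_real (f 1) + - (\<i> / 2) * (z - cnj z) * of_real (f \<i>) =
       (of_real (f 1) / 2 - \<i> / 2 * of_real (f \<i>)) * z + (of_real (f 1) / 2 + \<i> / 2 * of_real (f \<i>)) * cnj z"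
      by (simp add: ring_distribs add_divide_distrib diff_divide_distrib mult_ac)
    finally show ?thesis .
  qed
  then have "(\<lambda>z. complex_of_real (f z)) = (\<lambda>z. (of_real (f 1) / 2 - \<i> / 2 * of_real (f \<i>)) * z
      + (of_real (f 1) / 2 + \<i> / 2 * of_real (f \<i>)) * cnj z)" by (rule ext)
  moreover have "(\<lambda>z. (of_real (f 1) / 2 - \<i> / 2 * of_real (f \<i>)) * z
      + (of_real (f 1) / 2 + \<i> / 2 * of_real (f \<i>)) * cnj z) \<in> good_symbols"
    by (intro good_symbols_add good_symbols_mult good_symbols_const zC)
  ultimately show ?case by metis
next
  case (const c) show ?case by (rule good_symbols_const)
next
  case (add f g) then show ?case using good_symbols_add[of "\<lambda>z. of_real (f z)" "\<lambda>z. of_real (g z)"] by simp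
next
  case (mult f g) then show ?case using good_symbols_mult[of "\<lambda>z. of_real (f z)" "\<lambda>z. of_real (g z)"] by simp
qed

lemma good_symbols_all: assumes a: "cont_sym a" shows "a \<in> good_symbols"
proof (rule good_symbols_limit[OF a])
  fix e :: real assume e: "e > 0"
  have cR: "continuous_on (sphere 0 1) (\<lambda>z. Re (a z))" "continuous_on (sphere 0 1) (\<lambda>z. Im (a z))"
    using a by (auto simp: cont_sym_def intro!: continuous_intros)
  obtain p where p: "real_polynomial_function p" "\<And>z. z \<in> sphere 0 1 \<Longrightarrow> \<bar>Re (a z) - p z\<bar> < e/2"
    using Stone_Weierstrass_real_polynomial_function[OF compact_sphere cR(1), of "e/2"] e by auto
  obtain q where q: "real_polynomial_function q" "\<And>z. z \<in> sphere 0 1 \<Longrightarrow> \<bar>Im (a z) - q z\<bar> < e/2"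
    using Stone_Weierstrass_real_polynomial_function[OF compact_sphere cR(2), of "e/2"] e by auto
  have 1: "(\<lambda>z. of_real (p z) + \<i> * of_real (q z)) \<in> good_symbols"
    by (intro good_symbols_add good_symbols_mult good_symbols_const good_symbols_polynomial p q)
  have 2: "cmod (a z - (of_real (p z) + \<i> * of_real (q z))) \<le> e" if "cmod z = 1" for z
  proof -
    have "cmod (a z - (of_real (p z) + \<i> * of_real (q z))) \<le> \<bar>Re (a z) - p z\<bar> + \<bar>Im (a z) - q z\<bar>"
      using cmod_le[of "a z - (of_real (p z) + \<i> * of_real (q z))"] by simp
    then show ?thesis using p(2)[of z] q(2)[of z] that by simp
  qed
  show "\<exists>c\<in>good_symbols. \<forall>z. cmod z = 1 \<longrightarrow> cmod (a z - c z) \<le> e"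
    by (rule bexI[OF _ 1]) (use 2 in simp)
qed

lemma cpt_ideal_semicomm: "cont_sym a \<Longrightarrow> cont_sym b \<Longrightarrow> cpt_ideal (semicomm a b)"
  using good_symbols_all by (auto simp: good_symbols_def)

end

section \<open>Closedness of the symbol class\<close>

text \<open>Banach-Steinhaus by Baire's theorem. It is used because \<open>seqnorm\<close> is a
  supremum of reals and bounds the single entries only if these are bounded.\<close>

lemma uniform_boundedness:
  fixes X :: "nat \<Rightarrow> hil \<Rightarrow>\<^sub>L hil"
  assumes pt: "\<And>x. convergent (\<lambda>n. X n x)"
  obtains C where "\<And>n. norm (X n) \<le> C"
proof -
  define F where "F m = {x. \<forall>n. norm (X n x) \<le> real m}" for m :: nat
  have cl: "closed (F m)" for m
    unfolding F_def by (intro closed_Collect_all closed_Collect_le continuous_intros)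
  have "\<exists>m. x \<in> F m" for x
  proof -
    obtain C where "\<And>n. norm (X n x) \<le> C"
      using convergent_imp_Bseq[OF pt[of x]] by (auto simp: Bseq_def)
    moreover obtain m :: nat where "C \<le> real m" using real_arch_simple by blast
    ultimately show ?thesis by (auto simp: F_def intro: order_trans)
  qed
  then have UF: "(\<Union>m. F m) = UNIV" by auto
  have "\<exists>m. interior (F m) \<noteq> {}"
  proof (rule ccontr)
    assume h: "\<not> ?thesis"
    have "Met_TC.mtopology interior_of \<Union>(range F) = {}"
      by (rule Met_TC.metric_Baire_category_alt) (use h cl in \<open>auto simp: complete_UNIV\<close>)
    then show False using UF by simp
  qed
  then obtain m x0 where "x0 \<in> interior (F m)" by blast
  then obtain r where r: "r > 0" "cball x0 r \<subseteq> F m" by (auto simp: mem_interior_cball)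
  have "norm (X n) \<le> 2 * real m / r" for n
  proof (rule norm_blinfun_bound)
    fix x
    show "norm (X n x) \<le> 2 * real m / r * norm x"
    proof (cases "x = 0")
      case False
      \<comment> \<open>Scaling \<open>x\<close> to length \<open>r\<close> puts
        \<open>x0 + v\<close> and \<open>x0\<close> into \<open>F m\<close>; their difference costs
        the factor 2.\<close>
      define v where "v = (r / norm x) *\<^sub>R x"
      have "norm v = r" using False r by (simp add: v_def)
      then have "x0 + v \<in> F m" "x0 \<in> F m" using r by (auto simp: subset_iff dist_norm)
      then have "norm (X n (x0 + v)) \<le> real m" "norm (X n x0) \<le> real m" by (auto simp: F_def)
      then have "norm (X n v) \<le> 2 * real m"
        using norm_triangle_ineq4[of "X n (x0 + v)" "X n x0"] by (simp add: blinfun.add_right)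
      then show ?thesis using False r by (simp add: v_def blinfun.scaleR_right field_simps)
    qed simp
  qed (use r in simp)
  then show ?thesis using that by blast
qed

context bzeros
begin

text \<open>The section with symbol \<open>c\<close> times the \<open>k\<close>-th power of
  \<open>Y\<close>. Modulo the ideal it has symbol \<open>c * a ^ k\<close>, while its norm is at
  most a bound of \<open>c\<close> times \<open>eps ^ k\<close>; \<open>symbol_truncation\<close>
  plays these two facts against each other.\<close>

primrec word :: "cfun \<Rightarrow> (nat \<Rightarrow> hil \<Rightarrow>\<^sub>L hil) \<Rightarrow> nat \<Rightarrow> nat \<Rightarrow> (hil \<Rightarrow>\<^sub>L hil)" where
  "word c Y 0 n = sec (T c) n"
| "word c Y (Suc k) n = word c Y k n o\<^sub>L Y n"

lemma cont_power: "cont_sym a \<Longrightarrow> cont_sym (\<lambda>z. a z ^ k)"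
  by (simp add: cont_sym_def continuous_intros)

lemma cpt_ideal_T_sec_like:
  assumes "cpt_ideal (\<lambda>n. Y n - sec (T a) n)" shows "sec_like Y"
proof -
  obtain K where K: "cptop K" "(\<lambda>n. (Y n - sec (T a) n) - sec K n) \<longlonglongrightarrow> 0" using assms by (auto simp: cpt_ideal_def)
  show ?thesis unfolding sec_like_def
    by (rule exI[of _ "T a + K"]) (use K in \<open>simp add: onV_add onV_T cptop_def sec_add diff_diff_eq\<close>)
qed

lemma cpt_ideal_word:
  assumes Y: "cpt_ideal (\<lambda>n. Y n - sec (T a) n)" and a: "cont_sym a" and c: "cont_sym c"
  shows "cpt_ideal (\<lambda>n. word c Y k n - sec (T (\<lambda>z. c z * a z ^ k)) n)"
proof (induction k)
  case 0
  show ?case using cpt_ideal_null[of "\<lambda>n. 0"] by simp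
next
  case (Suc k)
  have ca: "cont_sym (\<lambda>z. c z * a z ^ k)" by (intro cont_mult c cont_power a)
  have "cpt_ideal (\<lambda>n. ((word c Y k n - sec (T (\<lambda>z. c z * a z ^ k)) n) o\<^sub>L Y n)
    + (sec (T (\<lambda>z. c z * a z ^ k)) n o\<^sub>L (Y n - sec (T a) n)) + semicomm (\<lambda>z. c z * a z ^ k) a n)"
    by (intro cpt_ideal_add cpt_ideal_mult_left cpt_ideal_mult_right Suc cpt_ideal_T_sec_like[OF Y] Y sec_like_sec onV_T cpt_ideal_semicomm ca a)
  moreover have "(\<lambda>n. ((word c Y k n - sec (T (\<lambda>z. c z * a z ^ k)) n) o\<^sub>L Y n)
    + (sec (T (\<lambda>z. c z * a z ^ k)) n o\<^sub>L (Y n - sec (T a) n)) + semicomm (\<lambda>z. c z * a z ^ k) a n)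
    = (\<lambda>n. word c Y (Suc k) n - sec (T (\<lambda>z. c z * a z ^ Suc k)) n)"
    by (rule ext) (simp add: semicomm_def compose_simps mult_ac)
  ultimately show ?case by simp
qed

lemma norm_word:
  assumes "\<And>n. norm (Y n) \<le> eps" "\<And>z. cmod z = 1 \<Longrightarrow> cmod (c z) \<le> C"
  shows "norm (word c Y k n) \<le> C * eps ^ k"
proof (induction k)
  case 0 then show ?case using order_trans[OF norm_sec norm_T] assms(2) by simp
next
  case (Suc k)
  have "norm (word c Y (Suc k) n) \<le> norm (word c Y k n) * norm (Y n)" by (simp add: norm_blinfun_compose)
  also have "\<dots> \<le> (C * eps ^ k) * eps"
    by (intro mult_mono Suc assms) (auto intro: order_trans[OF norm_ge_zero Suc])
  finally show ?case by (simp add: mult_ac)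
qed

text \<open>If a sequence with symbol \<open>a\<close> has norm below \<open>eps'\<close>, then \<open>a\<close> may be truncated at modulus \<open>eps'\<close>
  without changing its class modulo the ideal: the part \<open>d\<close> cut off equals \<open>c a^N\<close> with \<open>c\<close>
  of size \<open>eps'^(-N)\<close>, so its class has norm at most a constant times \<open>(eps / eps')^N\<close> for every \<open>N\<close>.\<close>

lemma symbol_truncation:
  assumes Y: "cpt_ideal (\<lambda>n. Y n - sec (T a) n)" and a: "cont_sym a" and eps: "\<And>n. norm (Y n) \<le> eps" "eps < eps'"
  obtains b where "cont_sym b" "\<And>z. cmod z = 1 \<Longrightarrow> cmod (b z) \<le> eps'" "cpt_ideal (\<lambda>n. Y n - sec (T b) n)"
proof -
  have e0: "0 \<le> eps" "0 < eps'" using eps(1)[of 0] eps(2) by (auto intro: order_trans[OF norm_ge_zero] le_less_trans)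
  \<comment> \<open>Since \<open>m z >= eps' > 0\<close>, the radial truncation
    \<open>a * eps' / m\<close> below is continuous, and it agrees with \<open>a\<close> where the
    modulus is at most \<open>eps'\<close>.\<close>
  define m where "m z = max (cmod (a z)) eps'" for z
  have m0: "m z > 0" "m z \<ge> eps'" "cmod (a z) \<le> m z" for z using e0 by (auto simp: m_def)
  have mc: "cont_sym (\<lambda>z. of_real (m z))" "cont_sym (\<lambda>z. of_real (eps' / m z))"
  proof -
    have m: "continuous_on (sphere 0 1) m"
      using a unfolding cont_sym_def m_def[abs_def] by (intro continuous_intros)
    then show "cont_sym (\<lambda>z. of_real (m z))" unfolding cont_sym_def by (intro continuous_intros)
    have "m z \<noteq> 0" for z using m0(1)[of z] by simp
    then show "cont_sym (\<lambda>z. of_real (eps' / m z))" unfolding cont_sym_def by (intro continuous_intros m) auto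
  qed
  define b where "b z = a z * of_real (eps' / m z)" for z
  have b: "cont_sym b" unfolding b_def[abs_def] by (intro cont_mult a mc)
  have be: "cmod (b z) \<le> eps'" for z
  proof -
    have "cmod (b z) = cmod (a z) * (eps' / m z)" using e0 m0(1)[of z] by (simp add: b_def norm_mult norm_divide)
    also have "\<dots> \<le> m z * (eps' / m z)" using e0 m0[of z] by (intro mult_right_mono) auto
    finally show ?thesis using m0(1)[of z] by simp
  qed
  define d where "d z = a z - b z" for z
  have dc: "cont_sym d" unfolding d_def[abs_def] by (intro cont_diff a b)
  obtain D where D: "\<And>z. cmod z = 1 \<Longrightarrow> cmod (d z) \<le> D" "0 \<le> D" using cont_bounded[OF dc] by blast
  have "cpt_ideal (sec (T d))"
  proof (rule cpt_ideal_closed)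
    fix r :: real assume r: "r > 0"
    have "(\<lambda>k. D * (eps / eps') ^ k) \<longlonglongrightarrow> D * 0"
      using eps e0 by (intro tendsto_intros LIMSEQ_power_zero) simp
    then have "\<forall>\<^sub>F k in sequentially. D * (eps / eps') ^ k < r" using r by (intro order_tendstoD(2)) auto
    then obtain k where k: "D * (eps / eps') ^ k < r" by (auto simp: eventually_sequentially)
    \<comment> \<open>Where the modulus of \<open>a\<close> exceeds \<open>eps'\<close> it equals
      \<open>m\<close>, so \<open>cnj (a z) / (m z)^2\<close> is the inverse of \<open>a z\<close>;
      elsewhere \<open>d\<close> vanishes. Dividing by \<open>m\<close> instead of \<open>a\<close>
      keeps \<open>c\<close> continuous.\<close>
    define c where "c z = d z * (cnj (a z) * (1 / of_real (m z)) * (1 / of_real (m z))) ^ k" for z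
    have c: "cont_sym c" unfolding c_def[abs_def]
    proof (intro cont_mult dc cont_power)
      show "cont_sym (\<lambda>z. cnj (a z))" using a by (simp add: cont_sym_def continuous_intros)
      show "cont_sym (\<lambda>z. 1 / of_real (m z))" "cont_sym (\<lambda>z. 1 / of_real (m z))"
        using mc(1) m0(1) unfolding cont_sym_def by (auto intro!: continuous_intros simp: less_imp_neq[symmetric])
    qed
    have ca: "c z * a z ^ k = d z" for z
    proof (cases "cmod (a z) \<le> eps'")
      case True
      then have "m z = eps'" by (simp add: m_def)
      then have "d z = 0" using e0 by (simp add: d_def b_def)
      then show ?thesis by (simp add: c_def)
    next
      case False
      then have mz: "m z = cmod (a z)" by (simp add: m_def)
      have "cnj (a z) * (1 / of_real (m z)) * (1 / of_real (m z)) * a z = of_real ((cmod (a z))\<^sup>2) / of_real ((m z)\<^sup>2)"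
        unfolding complex_norm_square by (simp add: power2_eq_square mult_ac)
      also have "\<dots> = 1" unfolding mz using m0(1)[of z] mz by simp
      finally show ?thesis unfolding c_def by (simp add: mult.assoc power_mult_distrib[symmetric])
    qed
    have cC: "cmod (c z) \<le> D / eps' ^ k" if "cmod z = 1" for z
    proof -
      have "cmod (cnj (a z) * (1 / of_real (m z)) * (1 / of_real (m z))) = cmod (a z) / m z * (1 / m z)"
        using m0(1)[of z] by (simp add: norm_mult norm_divide)
      also have "\<dots> \<le> 1 * (1 / eps')"
        using m0[of z] e0 by (intro mult_mono divide_left_mono) (auto simp: divide_le_eq_1)
      finally have "cmod (cnj (a z) * (1 / of_real (m z)) * (1 / of_real (m z))) ^ k \<le> (1 / eps') ^ k"
        by (intro power_mono) auto
      then have "cmod (c z) \<le> D * (1 / eps') ^ k"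
        unfolding c_def norm_mult[of "d z"] norm_power using D that by (intro mult_mono) auto
      then show ?thesis by (simp add: power_one_over)
    qed
    have J: "cpt_ideal (\<lambda>n. word c Y k n - sec (T d) n)" using cpt_ideal_word[OF Y a c, of k] by (simp add: ca)
    \<comment> \<open>Subtracting the member \<open>sec (T d) - word\<close> of the ideal leaves the
      word itself, which is small.\<close>
    have "norm (sec (T d) n - - (word c Y k n - sec (T d) n)) \<le> r" for n
    proof -
      have "norm (word c Y k n) \<le> D / eps' ^ k * eps ^ k" by (rule norm_word[OF eps(1) cC])
      also have "\<dots> \<le> r" using k by (simp add: power_divide)
      finally show ?thesis by simp
    qed
    then show "\<exists>B. cpt_ideal B \<and> (\<forall>n. norm (sec (T d) n - B n) \<le> r)"
      using cpt_ideal_minus[OF J] by blast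
  qed
  then have "cpt_ideal (\<lambda>n. (Y n - sec (T a) n) + sec (T d) n)" by (intro cpt_ideal_add Y)
  moreover have "T a = T d + T b"
    using T_add[of d b] a b dc by (simp add: cont_bdd_sym d_def)
  ultimately have "cpt_ideal (\<lambda>n. Y n - sec (T b) n)" by (simp add: sec_add diff_diff_eq[symmetric])
  with b be show ?thesis using that by blast
qed

text \<open>The symbols of the approximants need not converge. Consecutive approximants are close,
  so truncation supplies small symbols \<open>g j\<close> for their differences; the partial sums
  \<open>s j\<close> are again symbols of the \<open>B j\<close>, and they converge
  uniformly.\<close>

lemma symbol_class_closed:
  assumes ap: "\<And>eps. eps > 0 \<Longrightarrow> \<exists>B a. cont_sym a \<and> cpt_ideal (\<lambda>n. B n - sec (T a) n) \<and> (\<forall>n. norm (A n - B n) \<le> eps)"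
  shows "\<exists>a. cont_sym a \<and> cpt_ideal (\<lambda>n. A n - sec (T a) n)"
proof -
  have "\<forall>j. \<exists>B a. cont_sym a \<and> cpt_ideal (\<lambda>n. B n - sec (T a) n) \<and> (\<forall>n. norm (A n - B n) \<le> (1/2)^j)"
    using ap by simp
  then obtain B a where B: "\<And>j. cont_sym (a j)" "\<And>j. cpt_ideal (\<lambda>n. B j n - sec (T (a j)) n)" "\<And>j n. norm (A n - B j n) \<le> (1/2)^j"
    by metis
  have "\<exists>g. cont_sym g \<and> (\<forall>z. cmod z = 1 \<longrightarrow> cmod (g z) \<le> 3 * (1/2)^j) \<and> cpt_ideal (\<lambda>n. (B (Suc j) n - B j n) - sec (T g) n)" for j
  proof -
    have c: "cont_sym (\<lambda>z. a (Suc j) z - a j z)" by (intro cont_diff B)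
    have "T (a (Suc j)) = T (\<lambda>z. a (Suc j) z - a j z) + T (a j)"
      using T_add[of "\<lambda>z. a (Suc j) z - a j z" "a j"] c B(1) by (simp add: cont_bdd_sym)
    then have eq: "(B (Suc j) n - B j n) - sec (T (\<lambda>z. a (Suc j) z - a j z)) n
       = (B (Suc j) n - sec (T (a (Suc j))) n) - (B j n - sec (T (a j)) n)" for n
      by (simp add: sec_add)
    have J: "cpt_ideal (\<lambda>n. (B (Suc j) n - B j n) - sec (T (\<lambda>z. a (Suc j) z - a j z)) n)"
      unfolding eq by (intro cpt_ideal_diff B)
    have N: "norm (B (Suc j) n - B j n) \<le> 2 * (1/2)^j" for n
    proof -
      have "norm (B (Suc j) n - B j n) \<le> norm (A n - B j n) + norm (A n - B (Suc j) n)"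
        using norm_triangle_ineq4[of "A n - B j n" "A n - B (Suc j) n"] by simp
      also have "\<dots> \<le> (1/2)^j + (1/2)^Suc j" by (intro add_mono B)
      also have "\<dots> \<le> 2 * (1/2)^j" by simp
      finally show ?thesis .
    qed
    \<comment> \<open>Truncation needs a level strictly above the norm bound
      \<open>2 * (1/2)^j\<close>, hence the constant 3.\<close>
    show ?thesis by (rule symbol_truncation[OF J c N, of "3 * (1/2)^j"]) auto
  qed
  then obtain g where g: "\<And>j. cont_sym (g j)" "\<And>j z. cmod z = 1 \<Longrightarrow> cmod (g j z) \<le> 3 * (1/2)^j"
    "\<And>j. cpt_ideal (\<lambda>n. (B (Suc j) n - B j n) - sec (T (g j)) n)" by metis
  define s where "s j z = a 0 z + (\<Sum>i<j. g i z)" for j z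
  have sc: "cont_sym (s j)" for j
  proof (induction j)
    case 0 then show ?case using B(1)[of 0] by (simp add: s_def[abs_def])
  next
    case (Suc j)
    have "s (Suc j) = (\<lambda>z. s j z + g j z)" by (simp add: s_def fun_eq_iff)
    then show ?case using cont_add[OF Suc g(1)] by simp
  qed
  have sJ: "cpt_ideal (\<lambda>n. B j n - sec (T (s j)) n)" for j
  proof (induction j)
    case 0 then show ?case using B(2)[of 0] by (simp add: s_def[abs_def])
  next
    case (Suc j)
    have "T (s (Suc j)) = T (s j) + T (g j)"
      using T_add[of "s j" "g j"] sc g(1) cont_add[OF sc g(1)]
      by (simp add: cont_bdd_sym s_def[abs_def] add.assoc)
    then have eq: "B (Suc j) n - sec (T (s (Suc j))) n = ((B (Suc j) n - B j n) - sec (T (g j)) n) + (B j n - sec (T (s j)) n)" for n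
      by (simp add: sec_add)
    show ?case unfolding eq by (rule cpt_ideal_add[OF g(3) Suc])
  qed
  have sm: "summable (\<lambda>j. 3 * (1/2)^j :: real)" by (intro summable_mult summable_geometric) simp
  define h where "h z = a 0 z + (\<Sum>i. g i z)" for z
  have ul: "uniform_limit (sphere 0 1) (\<lambda>j z. \<Sum>i<j. g i z) (\<lambda>z. \<Sum>i. g i z) sequentially"
    by (rule Weierstrass_m_test[OF _ sm]) (use g(2) in auto)
  then have ulh: "uniform_limit (sphere 0 1) s h sequentially"
    unfolding s_def[abs_def] h_def[abs_def] by (intro uniform_limit_add uniform_limit_const)
  have hc: "cont_sym h" unfolding cont_sym_def
    by (rule uniform_limit_theorem[OF _ ulh]) (use sc in \<open>auto simp: cont_sym_def\<close>)
  have "cpt_ideal (\<lambda>n. A n - sec (T h) n)"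
  proof (rule cpt_ideal_closed)
    fix eps :: real assume eps: "eps > 0"
    have "\<forall>\<^sub>F j in sequentially. \<forall>z\<in>sphere 0 1. dist (s j z) (h z) < eps/2"
      using uniform_limitD[OF ulh, of "eps/2"] eps by simp
    moreover have "\<forall>\<^sub>F j in sequentially. (1/2)^j < eps/2"
      using eps by (intro order_tendstoD(2)[OF LIMSEQ_power_zero]) auto
    ultimately have "\<forall>\<^sub>F j in sequentially. (\<forall>z\<in>sphere 0 1. dist (s j z) (h z) < eps/2) \<and> (1/2)^j < eps/2"
      by (rule eventually_conj)
    then obtain j where jj: "(\<forall>z\<in>sphere 0 1. dist (s j z) (h z) < eps/2) \<and> (1/2)^j < eps/2"
      unfolding eventually_sequentially by blast
    then have j: "\<And>z. cmod z = 1 \<Longrightarrow> dist (s j z) (h z) < eps/2" "(1/2)^j < eps/2" by simp_all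
    have Td: "T h = T (\<lambda>z. h z - s j z) + T (s j)"
      using T_add[of "\<lambda>z. h z - s j z" "s j"] cont_diff[OF hc sc] sc hc by (simp add: cont_bdd_sym)
    have "norm ((A n - sec (T h) n) - (B j n - sec (T (s j)) n)) \<le> eps" for n
    proof -
      have eq: "(A n - sec (T h) n) - (B j n - sec (T (s j)) n) = (A n - B j n) - sec (T (\<lambda>z. h z - s j z)) n"
        by (simp add: Td sec_add)
      have "norm (sec (T (\<lambda>z. h z - s j z)) n) \<le> eps/2"
        by (rule order_trans[OF norm_sec norm_T]) (use j(1) in \<open>auto simp: dist_norm norm_minus_commute intro: less_imp_le\<close>)
      then show ?thesis unfolding eq
        using norm_triangle_ineq4[of "A n - B j n" "sec (T (\<lambda>z. h z - s j z)) n"] B(3)[of n j] j(2) by linarith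
    qed
    then show "\<exists>C. cpt_ideal C \<and> (\<forall>n. norm ((A n - sec (T h) n) - C n) \<le> eps)" using sJ[of j] by blast
  qed
  with hc show ?thesis by blast
qed

end

section \<open>Operator sequences on function spaces\<close>

text \<open>One interface for two uses: the finite dimensional spaces \<open>Kn n\<close> with
  \<open>pr (Suc n)\<close> and the model space \<open>Ku\<close> with \<open>pu\<close>.\<close>

locale subsp =
  fixes V :: "cfun set" and q :: "hil \<Rightarrow> hil"
  assumes V_iff: "f \<in> V \<longleftrightarrow> f \<in> L2 \<and> q (cl f) = cl f"
    and q_add: "q (x + y) = q x + q y"
    and q_scale: "q (c *\<^sub>C x) = c *\<^sub>C q x"
    and q_idem: "q (q x) = q x"
    and q_norm: "norm (q x) \<le> norm x"
begin

text \<open>Applying \<open>q\<close> first extends the operator by zero to the complement and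
  ignores what \<open>A\<close> does off \<open>V\<close>.\<close>

definition lift :: "cop \<Rightarrow> hil \<Rightarrow>\<^sub>L hil" where
  "lift A = Blinfun (\<lambda>x. cl (A (rep_hil (q x))))"

lemma VL2: "f \<in> V \<Longrightarrow> f \<in> L2" by (simp add: V_iff)
lemma V_rep: "rep_hil (q x) \<in> V" by (simp add: V_iff q_idem)

lemma V_comb: "f \<in> V \<Longrightarrow> g \<in> V \<Longrightarrow> (\<lambda>z. f z + c * g z) \<in> V"
  by (simp add: V_iff L2_add L2_scale cl_add cl_scale q_add q_scale)

lemma bounded_op_cl:
  assumes A: "bounded_op V A"
  shows "f \<in> V \<Longrightarrow> A f \<in> V"
    and "f \<in> V \<Longrightarrow> g \<in> V \<Longrightarrow> cl f = cl g \<Longrightarrow> cl (A f) = cl (A g)"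
    and "f \<in> V \<Longrightarrow> g \<in> V \<Longrightarrow> cl (A (\<lambda>z. f z + c * g z)) = cl (A f) + c *\<^sub>C cl (A g)"
proof -
  show AV: "A f \<in> V" if "f \<in> V" for f using A that by (simp add: bounded_op_def)
  show "f \<in> V \<Longrightarrow> g \<in> V \<Longrightarrow> cl f = cl g \<Longrightarrow> cl (A f) = cl (A g)"
    using A AV VL2 by (simp add: bounded_op_def cl_eq_iff)
  assume fg: "f \<in> V" "g \<in> V"
  have "aeq (A (\<lambda>z. f z + c * g z)) (\<lambda>z. A f z + c * A g z)"
    using A fg by (simp add: bounded_op_def)
  then have "cl (A (\<lambda>z. f z + c * g z)) = cl (\<lambda>z. A f z + c * A g z)"
    using VL2[OF AV[OF V_comb[OF fg]]] VL2[OF V_comb[OF AV[OF fg(1)] AV[OF fg(2)]]] by (simp add: cl_eq_iff)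
  then show "cl (A (\<lambda>z. f z + c * g z)) = cl (A f) + c *\<^sub>C cl (A g)"
    using AV fg VL2 by (simp add: cl_add cl_scale L2_scale)
qed

lemma lift_apply:
  assumes A: "bounded_op V A"
  shows "lift A x = cl (A (rep_hil (q x)))"
proof -
  obtain C where C: "\<And>f. f \<in> V \<Longrightarrow> l2norm (A f) \<le> C * l2norm f"
    using A unfolding bounded_op_def by blast
  note B = bounded_op_cl[OF A]
  have comb: "cl (A (rep_hil (q (x + c *\<^sub>C y)))) = cl (A (rep_hil (q x))) + c *\<^sub>C cl (A (rep_hil (q y)))" for x y c
  proof -
    have "cl (A (rep_hil (q (x + c *\<^sub>C y)))) = cl (A (\<lambda>z. rep_hil (q x) z + c * rep_hil (q y) z))"
      by (rule B(2)) (simp_all add: V_iff q_idem cl_add cl_scale L2_add L2_scale q_add q_scale)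
    then show ?thesis by (simp add: B(3) V_rep)
  qed
  have z: "cl (A (rep_hil (q 0))) = 0"
    using comb[of 0 "-1" 0] by (simp add: scaleC_minus_one)
  have "bounded_linear (\<lambda>x. cl (A (rep_hil (q x))))"
  proof (rule bounded_linear_intro[of _ "\<bar>C\<bar>"])
    show "cl (A (rep_hil (q (x + y)))) = cl (A (rep_hil (q x))) + cl (A (rep_hil (q y)))" for x y
      using comb[of x 1 y] by simp
    show "cl (A (rep_hil (q (r *\<^sub>R x)))) = r *\<^sub>R cl (A (rep_hil (q x)))" for r x
      using comb[of 0 "of_real r" x] z by (simp add: scaleC_of_real)
    show "norm (cl (A (rep_hil (q x)))) \<le> norm x * \<bar>C\<bar>" for x
    proof -
      have "norm (cl (A (rep_hil (q x)))) = l2norm (A (rep_hil (q x)))"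
        by (rule norm_cl) (intro VL2 B V_rep)
      also have "\<dots> \<le> C * l2norm (rep_hil (q x))" by (intro C V_rep)
      also have "l2norm (rep_hil (q x)) = norm (q x)" using norm_cl[of "rep_hil (q x)"] by simp
      also have "C * norm (q x) \<le> \<bar>C\<bar> * norm x" using q_norm by (intro mult_mono) auto
      finally show ?thesis by (simp add: mult.commute)
    qed
  qed
  then show ?thesis by (simp add: lift_def bounded_linear_Blinfun_apply)
qed

lemma lift_cl: "bounded_op V A \<Longrightarrow> f \<in> V \<Longrightarrow> lift A (cl f) = cl (A f)"
  by (simp add: lift_apply) (rule bounded_op_cl(2); simp add: V_iff)

lemma lift_q: "bounded_op V A \<Longrightarrow> lift A (q x) = lift A x"
  by (simp add: lift_apply q_idem)

lemma q_lift: assumes A: "bounded_op V A" shows "q (lift A x) = lift A x"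
proof -
  have "A (rep_hil (q x)) \<in> V" by (intro bounded_op_cl[OF A] V_rep)
  then show ?thesis by (simp add: lift_apply[OF A] V_iff)
qed

lemma clin_lift:
  assumes A: "bounded_op V A" shows "clin (lift A)"
  unfolding clin_def
proof (intro allI)
  fix c x
  have "lift A (c *\<^sub>C q x) = c *\<^sub>C lift A (q x)"
  proof -
    define f where "f = rep_hil (q x)"
    have f: "f \<in> V" "cl f = q x" by (simp_all add: f_def V_rep)
    have 0: "(\<lambda>z. 0) \<in> V" using V_comb[OF f(1) f(1), of "-1"] by simp
    have "cl (A (\<lambda>z. 0)) = 0" using bounded_op_cl(3)[OF A 0 0, of "-1"] by (simp add: scaleC_minus_one)
    moreover have "cl (A (\<lambda>z. 0 + c * f z)) = cl (A (\<lambda>z. 0)) + c *\<^sub>C cl (A f)"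
      by (rule bounded_op_cl(3)[OF A 0 f(1)])
    moreover have "lift A (cl (\<lambda>z. 0 + c * f z)) = cl (A (\<lambda>z. 0 + c * f z))"
      by (rule lift_cl[OF A V_comb[OF 0 f(1)]])
    ultimately show ?thesis using f by (simp add: cl_scale VL2 lift_cl[OF A f(1), symmetric])
  qed
  then show "lift A (c *\<^sub>C x) = c *\<^sub>C lift A x"
    using lift_q[OF A] by (metis q_scale)
qed

lemma bounded_opI:
  fixes X :: "hil \<Rightarrow>\<^sub>L hil"
  assumes AV: "\<And>f. f \<in> V \<Longrightarrow> A f \<in> V" and AX: "\<And>f. f \<in> V \<Longrightarrow> cl (A f) = X (cl f)" and X: "clin X"
  shows "bounded_op V A" "lift A x = X (q x)"
proof -
  show b: "bounded_op V A"
    unfolding bounded_op_def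
  proof (intro conjI ballI allI impI)
    fix f g assume fg: "f \<in> V" "g \<in> V"
    show "aeq (A f) (A g)" if "aeq f g"
      using that fg AX AV VL2 by (simp add: cl_eq_iff[symmetric])
    fix c
    have "cl (A (\<lambda>z. f z + c * g z)) = cl (\<lambda>z. A f z + c * A g z)"
      using fg X by (simp add: AX V_comb cl_add cl_scale AV VL2 L2_scale blinfun.add_right clinD)
    then show "aeq (A (\<lambda>z. f z + c * g z)) (\<lambda>z. A f z + c * A g z)"
      using VL2[OF AV[OF V_comb[OF fg]]] VL2[OF V_comb[OF AV[OF fg(1)] AV[OF fg(2)]]] by (simp add: cl_eq_iff)
  next
    have "l2norm (A f) \<le> norm X * l2norm f" if "f \<in> V" for f
      using norm_blinfun[of X "cl f"] AX[OF that] by (metis norm_cl VL2 AV that)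
    then show "\<exists>C. \<forall>f\<in>V. l2norm (A f) \<le> C * l2norm f" by blast
  qed (rule AV)
  show "lift A x = X (q x)" using AX[OF V_rep, of x] by (simp add: lift_apply[OF b])
qed

text \<open>Extension by zero along a contractive projection does not change the norm.\<close>

lemma opnorm_lift:
  assumes A: "bounded_op V A" shows "opnorm V A = norm (lift A)"
proof -
  have le: "l2norm (A f) \<le> norm (lift A)" if "f \<in> V" "l2norm f \<le> 1" for f
  proof -
    have "l2norm (A f) = norm (lift A (cl f))"
      using that bounded_op_cl(1)[OF A] by (simp add: lift_cl[OF A] norm_cl VL2)
    also have "\<dots> \<le> norm (lift A) * l2norm f"
      using norm_blinfun[of "lift A" "cl f"] that by (simp add: norm_cl VL2)
    finally show ?thesis using that by (meson mult_left_le norm_ge_zero order_trans)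
  qed
  have ne: "{f \<in> V. l2norm f \<le> 1} \<noteq> {}"
  proof -
    have "(\<lambda>z. 0) \<in> V" using V_comb[OF V_rep V_rep, of 0 "-1" 0] by simp
    moreover have "l2norm (\<lambda>z. 0) \<le> 1" by (simp add: l2norm_def)
    ultimately show ?thesis by blast
  qed
  have bdd: "bdd_above ((\<lambda>f. l2norm (A f)) ` {f \<in> V. l2norm f \<le> 1})"
    using le by (intro bdd_aboveI2[of _ _ "norm (lift A)"]) auto
  show ?thesis
  proof (rule antisym)
    show "opnorm V A \<le> norm (lift A)"
      unfolding opnorm_def by (rule cSUP_least[OF ne]) (use le in auto)
    have up: "l2norm (A f) \<le> opnorm V A" if "f \<in> V" "l2norm f \<le> 1" for f
      unfolding opnorm_def by (rule cSUP_upper[OF _ bdd]) (use that in simp)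
    show "norm (lift A) \<le> opnorm V A"
    proof (rule norm_blinfun_bound)
      obtain f where "f \<in> V" "l2norm f \<le> 1" using ne by blast
      then show "0 \<le> opnorm V A" using up order_trans[OF l2norm_nonneg] by blast
      fix x
      show "norm (lift A x) \<le> opnorm V A * norm x"
      proof (cases "x = 0")
        case False
        define y where "y = (1 / norm x) *\<^sub>R x"
        have "norm y = 1" using False by (simp add: y_def)
        then have "l2norm (rep_hil (q y)) \<le> 1"
          using q_norm[of y] norm_cl[of "rep_hil (q y)"] by simp
        then have "l2norm (A (rep_hil (q y))) \<le> opnorm V A" by (intro up V_rep)
        then have "norm (lift A y) \<le> opnorm V A"
          using bounded_op_cl(1)[OF A V_rep] by (simp add: lift_apply[OF A] norm_cl VL2)
        then show ?thesis using False by (simp add: y_def blinfun.scaleR_right field_simps)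
      qed simp
    qed
  qed
qed

end

lemma strong_convI:
  assumes "\<And>f n. f \<in> V \<Longrightarrow> B n f \<in> L2" "\<And>f. f \<in> V \<Longrightarrow> \<exists>g\<in>V. g \<in> L2 \<and> (\<lambda>n. cl (B n f)) \<longlonglongrightarrow> cl g"
  shows "strong_conv V B"
  unfolding strong_conv_def
proof
  fix f assume f: "f \<in> V"
  then obtain g where g: "g \<in> V" "g \<in> L2" "(\<lambda>n. cl (B n f)) \<longlonglongrightarrow> cl g" using assms by blast
  have "l2norm (\<lambda>z. B n f z - g z) = norm (cl (B n f) - cl g)" for n
    using assms(1)[OF f] g(2) by (simp add: cl_diff[symmetric] norm_cl L2_diff)
  then have "(\<lambda>n. l2norm (\<lambda>z. B n f z - g z)) \<longlonglongrightarrow> 0"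
    using g(3) by (simp add: tendsto_norm_zero LIM_zero_iff)
  with g show "\<exists>g\<in>V. (\<lambda>n. l2norm (\<lambda>z. B n f z - g z)) \<longlonglongrightarrow> 0" by blast
qed

lemma strong_convD:
  assumes "strong_conv V B" "f \<in> V" "\<And>n. B n f \<in> L2" "V \<subseteq> L2"
  shows "convergent (\<lambda>n. cl (B n f))"
proof -
  obtain g where g: "g \<in> V" "(\<lambda>n. l2norm (\<lambda>z. B n f z - g z)) \<longlonglongrightarrow> 0"
    using assms by (auto simp: strong_conv_def)
  have "g \<in> L2" using g assms by auto
  then have "l2norm (\<lambda>z. B n f z - g z) = norm (cl (B n f) - cl g)" for n
    using assms(3) by (simp add: cl_diff[symmetric] norm_cl L2_diff)
  then have "(\<lambda>n. cl (B n f)) \<longlonglongrightarrow> cl g" using g(2) by (simp add: tendsto_norm_zero_iff LIM_zero_iff)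
  then show ?thesis by (auto simp: convergent_def)
qed

context bzeros
begin

sublocale Kn: subsp "Kn n" "pr (Suc n)" for n
  by unfold_locales (simp_all add: Kn_iff pr_add pr_scaleC pr_pr norm_pr)

sublocale Ku: subsp Ku pu
  by unfold_locales (simp_all add: Ku_iff pu_add pu_scaleC pu_pu norm_pu)

definition bops :: "(nat \<Rightarrow> cop) \<Rightarrow> bool" where
  "bops A \<longleftrightarrow> (\<forall>n. bounded_op (Kn n) (A n))"

text \<open>The lift forgets the choice of representatives and all values off
  \<open>Kn n\<close>.\<close>

definition lift_seq :: "(nat \<Rightarrow> cop) \<Rightarrow> nat \<Rightarrow> hil \<Rightarrow>\<^sub>L hil" where
  "lift_seq A n = Kn.lift n (A n)"

lemma Kn_Ku: "f \<in> Kn n \<Longrightarrow> f \<in> Ku"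
  unfolding Kn_iff Ku_iff by (metis pu_pr)

lemma lift_seq_cl: "bops A \<Longrightarrow> f \<in> Kn n \<Longrightarrow> A n f \<in> Kn n \<and> cl (A n f) = lift_seq A n (cl f)"
  using Kn.lift_cl Kn.bounded_op_cl(1) by (auto simp: bops_def lift_seq_def)

lemma clin_lift_seq: "bops A \<Longrightarrow> clin (lift_seq A n)" by (simp add: bops_def lift_seq_def Kn.clin_lift)
lemma lift_seq_pr: "bops A \<Longrightarrow> lift_seq A n (pr (Suc n) x) = lift_seq A n x" by (simp add: bops_def lift_seq_def Kn.lift_q)
lemma pr_lift_seq: "bops A \<Longrightarrow> pr (Suc n) (lift_seq A n x) = lift_seq A n x" by (simp add: bops_def lift_seq_def Kn.q_lift)
lemma opnorm_lift_seq: "bops A \<Longrightarrow> opnorm (Kn n) (A n) = norm (lift_seq A n)" by (simp add: bops_def lift_seq_def Kn.opnorm_lift)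

lemma onV_lift_seq: "bops A \<Longrightarrow> onV (lift_seq A n)"
  unfolding onV_def using lift_seq_pr[of A n] pr_lift_seq[of A n]
  by (metis clin_lift_seq pr_pu pu_pr)

lemma bopsI:
  fixes X :: "nat \<Rightarrow> hil \<Rightarrow>\<^sub>L hil"
  assumes "\<And>n f. f \<in> Kn n \<Longrightarrow> A n f \<in> Kn n" "\<And>n f. f \<in> Kn n \<Longrightarrow> cl (A n f) = X n (cl f)" "\<And>n. clin (X n)"
    "\<And>n x. X n (pr (Suc n) x) = X n x"
  shows "bops A" "lift_seq A = X"
proof -
  show "bops A" unfolding bops_def
    by (intro allI, rule Kn.bounded_opI(1)[OF assms(1,2,3)])
  have "lift_seq A n x = X n x" for n x
    using Kn.bounded_opI(2)[OF assms(1,2,3), of n x] by (simp add: lift_seq_def assms(4))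
  then show "lift_seq A = X" by (intro ext blinfun_eqI)
qed

lemma bops_add:
  assumes "bops A" "bops B" shows "bops (seq_add A B)" "lift_seq (seq_add A B) = (\<lambda>n. lift_seq A n + lift_seq B n)"
proof -
  have 1: "seq_add A B n f \<in> Kn n" if "f \<in> Kn n" for n f
    using Kn.V_comb[of "A n f" n "B n f" 1] lift_seq_cl[OF assms(1) that] lift_seq_cl[OF assms(2) that] by (simp add: seq_add_def)
  have 2: "cl (seq_add A B n f) = (lift_seq A n + lift_seq B n) (cl f)" if "f \<in> Kn n" for n f
  proof -
    note P = lift_seq_cl[OF assms(1) that] lift_seq_cl[OF assms(2) that]
    have "A n f \<in> L2" "B n f \<in> L2" using P Kn.VL2 by auto
    then show ?thesis using P by (simp add: seq_add_def cl_add blinfun.add_left)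
  qed
  show "bops (seq_add A B)" "lift_seq (seq_add A B) = (\<lambda>n. lift_seq A n + lift_seq B n)"
    by (rule bopsI[OF 1 2 clin_add]; simp add: clin_lift_seq lift_seq_pr assms blinfun.add_left)+
qed

lemma bops_smult:
  assumes "bops A" shows "bops (seq_smult c A)" "lift_seq (seq_smult c A) = (\<lambda>n. cmul c (lift_seq A n))"
proof -
  have 0: "(\<lambda>z. 0) \<in> Kn n" for n using Kn.V_comb[OF Kn.V_rep Kn.V_rep, of n 0 "-1" 0] by simp
  have 1: "seq_smult c A n f \<in> Kn n" if "f \<in> Kn n" for n f
    using Kn.V_comb[OF 0, of "A n f" n c] lift_seq_cl[OF assms that] by (simp add: seq_smult_def)
  have 2: "cl (seq_smult c A n f) = cmul c (lift_seq A n) (cl f)" if "f \<in> Kn n" for n f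
  proof -
    note P = lift_seq_cl[OF assms that]
    have "A n f \<in> L2" using P Kn.VL2 by auto
    then show ?thesis using P by (simp add: seq_smult_def cl_scale)
  qed
  show "bops (seq_smult c A)" "lift_seq (seq_smult c A) = (\<lambda>n. cmul c (lift_seq A n))"
    by (rule bopsI[OF 1 2 clin_cmul]; simp add: clin_lift_seq lift_seq_pr assms)+
qed

lemma bops_mult:
  assumes "bops A" "bops B" shows "bops (seq_mult A B)" "lift_seq (seq_mult A B) = (\<lambda>n. lift_seq A n o\<^sub>L lift_seq B n)"
proof -
  have 1: "seq_mult A B n f \<in> Kn n" if "f \<in> Kn n" for n f
    using lift_seq_cl[OF assms(2) that] lift_seq_cl[OF assms(1)] by (simp add: seq_mult_def)
  have 2: "cl (seq_mult A B n f) = (lift_seq A n o\<^sub>L lift_seq B n) (cl f)" if "f \<in> Kn n" for n f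
    using lift_seq_cl[OF assms(2) that] lift_seq_cl[OF assms(1)] by (simp add: seq_mult_def)
  show "bops (seq_mult A B)" "lift_seq (seq_mult A B) = (\<lambda>n. lift_seq A n o\<^sub>L lift_seq B n)"
    by (rule bopsI[OF 1 2 clin_compose]; simp add: clin_lift_seq lift_seq_pr assms)+
qed

lemma bops_diff:
  assumes "bops A" "bops B"
  shows "bops (\<lambda>n f z. A n f z - B n f z)" "lift_seq (\<lambda>n f z. A n f z - B n f z) = (\<lambda>n. lift_seq A n - lift_seq B n)"
proof -
  have eq: "(\<lambda>n f z. A n f z - B n f z) = seq_add A (seq_smult (-1) B)"
    by (simp add: seq_add_def seq_smult_def fun_eq_iff)
  show "bops (\<lambda>n f z. A n f z - B n f z)" "lift_seq (\<lambda>n f z. A n f z - B n f z) = (\<lambda>n. lift_seq A n - lift_seq B n)"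
    unfolding eq using assms bops_smult[OF assms(2), of "-1"] by (simp_all add: bops_add cmul_minus_one)
qed

lemma comp_Pn:
  assumes A: "bops A" and f: "f \<in> Ku"
  shows "A n (Pn lam n f) \<in> Ku" "cl (A n (Pn lam n f)) = lift_seq A n (cl f)"
proof -
  have fL: "f \<in> L2" using f by (simp add: Ku_iff)
  have "Pn lam n f \<in> Kn n" by (rule Pn_Kn[OF fL])
  then show "A n (Pn lam n f) \<in> Ku" "cl (A n (Pn lam n f)) = lift_seq A n (cl f)"
    using lift_seq_cl[OF A, of "Pn lam n f" n] by (auto simp: cl_Pn[OF fL] lift_seq_pr[OF A] intro: Kn_Ku)
qed

text \<open>\<open>adj\<close> is a choice among functions; any adjoint \<open>Y\<close> of the
  class operator shows that the choice is possible and determines its class.\<close>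

lemma cl_adj:
  assumes BV: "\<And>f. f \<in> Ku \<Longrightarrow> B f \<in> Ku" and BX: "\<And>f. f \<in> Ku \<Longrightarrow> cl (B f) = X (cl f)"
    and XY: "\<And>x y. cip (X x) y = cip x (Y y)" and g: "g \<in> Ku"
  shows "adj Ku B g \<in> Ku" "cl (adj Ku B g) = pu (Y (cl g))"
proof -
  define R where "R h \<longleftrightarrow> h \<in> Ku \<and> (\<forall>f\<in>Ku. l2ip (B f) g = l2ip f h)" for h
  have ip: "l2ip (B f) g = cip (cl f) (pu (Y (cl g)))" if "f \<in> Ku" for f
  proof -
    have "l2ip (B f) g = cip (X (cl f)) (cl g)" using BV[OF that] BX[OF that] g by (simp add: cip_cl[symmetric] Ku.VL2)
    then show ?thesis using that by (simp add: XY pu_self_adjoint[symmetric] Ku_iff)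
  qed
  have "R (rep_hil (pu (Y (cl g))))"
    unfolding R_def
  proof (intro conjI ballI Ku.V_rep)
    fix f assume "f \<in> Ku"
    then show "l2ip (B f) g = l2ip f (rep_hil (pu (Y (cl g))))"
      by (simp add: ip cip_cl[symmetric] Ku.VL2)
  qed
  then have R: "R (adj Ku B g)"
    unfolding adj_def R_def by (rule someI[where P = "\<lambda>h. h \<in> Ku \<and> (\<forall>f\<in>Ku. l2ip (B f) g = l2ip f h)"])
  then show h: "adj Ku B g \<in> Ku" by (simp add: R_def)
  define d where "d = pu (Y (cl g)) - cl (adj Ku B g)"
  have pd: "pu d = d" using h by (simp add: d_def pu_diff pu_pu Ku_iff)
  have "rep_hil d \<in> Ku" using Ku.V_rep[of d] by (simp add: pd)
  then have "cip d (pu (Y (cl g))) = cip d (cl (adj Ku B g))"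
    using R ip[of "rep_hil d"] h cip_cl[of "rep_hil d" "adj Ku B g"] by (simp add: R_def Ku.VL2)
  then have "cip d d = 0" by (simp add: d_def cip_right_diff)
  then have "d = 0" by (simp add: cip_self)
  then show "cl (adj Ku B g) = pu (Y (cl g))" by (simp add: d_def)
qed

lemma FalgI:
  assumes A: "bops A" and cX: "\<And>x. convergent (\<lambda>n. lift_seq A n x)"
    and XY: "\<And>n x y. cip (lift_seq A n x) y = cip x (blinfun_apply (Y n) y)" and cY: "\<And>x. convergent (\<lambda>n. blinfun_apply (Y n) x)"
  shows "A \<in> Falg lam"
proof -
  have lim: "\<exists>g\<in>Ku. g \<in> L2 \<and> (\<lambda>n. pu (x n)) \<longlonglongrightarrow> cl g" if c: "convergent x" for x
  proof -
    obtain l where "x \<longlonglongrightarrow> l" using c by (auto simp: convergent_def)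
    then have "(\<lambda>n. pu (x n)) \<longlonglongrightarrow> pu l" by (rule bounded_linear.tendsto[OF bounded_linear_pu])
    then show ?thesis using Ku.V_rep[of l] by (intro bexI[of _ "rep_hil (pu l)"]) auto
  qed
  have "strong_conv Ku (\<lambda>n f. A n (Pn lam n f))"
  proof (rule strong_convI)
    fix f assume f: "f \<in> Ku"
    show "A n (Pn lam n f) \<in> L2" for n using comp_Pn(1)[OF A f] by (rule Ku.VL2)
    have "cl (A n (Pn lam n f)) = pu (lift_seq A n (cl f))" for n
      using onV_lift_seq[OF A] by (simp add: comp_Pn(2)[OF A f] onV_def)
    then show "\<exists>g\<in>Ku. g \<in> L2 \<and> (\<lambda>n. cl (A n (Pn lam n f))) \<longlonglongrightarrow> cl g"
      using lim[OF cX[of "cl f"]] by simp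
  qed
  moreover have "strong_conv Ku (\<lambda>n. adj Ku (\<lambda>f. A n (Pn lam n f)))"
  proof (rule strong_convI)
    fix f assume f: "f \<in> Ku"
    show "adj Ku (\<lambda>f. A n (Pn lam n f)) f \<in> L2" for n
      by (rule Ku.VL2[OF cl_adj(1)[OF comp_Pn[OF A] XY f]])
    have "cl (adj Ku (\<lambda>f. A n (Pn lam n f)) f) = pu (Y n (cl f))" for n
      by (rule cl_adj(2)[OF comp_Pn[OF A] XY f])
    then show "\<exists>g\<in>Ku. g \<in> L2 \<and> (\<lambda>n. cl (adj Ku (\<lambda>f. A n (Pn lam n f)) f)) \<longlonglongrightarrow> cl g"
      using lim[OF cY[of "cl f"]] by simp
  qed
  ultimately show ?thesis using A by (simp add: Falg_def star_strong_conv_def bops_def)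
qed

lemma FalgD:
  assumes "A \<in> Falg lam"
  shows "bops A" "convergent (\<lambda>n. lift_seq A n x)"
proof -
  show A: "bops A" using assms by (simp add: Falg_def bops_def)
  have s: "strong_conv Ku (\<lambda>n f. A n (Pn lam n f))" using assms by (simp add: Falg_def star_strong_conv_def)
  have f: "rep_hil (pu x) \<in> Ku" by (rule Ku.V_rep)
  have "convergent (\<lambda>n. cl (A n (Pn lam n (rep_hil (pu x)))))"
    by (rule strong_convD[OF s f]) (auto intro: Ku.VL2 comp_Pn(1)[OF A f])
  then show "convergent (\<lambda>n. lift_seq A n x)"
    using onV_lift_seq[OF A] by (simp add: comp_Pn(2)[OF A f] onV_def)
qed

text \<open>Sections converge strongly, and so do their adjoints, which are the sections of the
  adjoint. A null perturbation affects neither limit.\<close>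

lemma Falg_null_plus_sec:
  assumes A: "bops A" and X: "onV X" and lim: "(\<lambda>n. lift_seq A n - sec X n) \<longlonglongrightarrow> 0"
  shows "A \<in> Falg lam"
proof -
  obtain Z where Z: "onV Z" "\<And>x y. cip (X x) y = cip x (Z y)" using onV_adjoint[OF X] by blast
  have "\<exists>Y. onV Y \<and> (\<forall>x y. cip (lift_seq A n x) y = cip x (Y y))" for n
    using onV_adjoint[OF onV_lift_seq[OF A]] by metis
  then obtain Y where Y: "\<And>n x y. cip (lift_seq A n x) y = cip x (blinfun_apply (Y n) y)" by metis
  have "(\<lambda>n. lift_seq A n x) \<longlonglongrightarrow> X x" for x
  proof -
    have "(\<lambda>n. (lift_seq A n - sec X n) x + sec X n x) \<longlonglongrightarrow> blinfun_apply 0 x + X x"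
      by (intro tendsto_add sec_tendsto X blinfun.tendsto lim tendsto_const)
    then show ?thesis by (simp add: blinfun.diff_left)
  qed
  moreover have "(\<lambda>n. Y n y) \<longlonglongrightarrow> Z y" for y
  proof -
    have "norm (Y n y - sec Z n y) \<le> norm (lift_seq A n - sec X n) * norm y" for n
    proof -
      \<comment> \<open>Pairing with the error itself bounds it by the norm of the difference before
        taking adjoints.\<close>
      define d where "d = Y n y - sec Z n y"
      have "cip ((lift_seq A n - sec X n) d) y = cip d d"
        by (simp add: blinfun.diff_left cip_left_diff Y sec_apply pr_self_adjoint Z(2) d_def cip_right_diff)
      then have "norm d * norm d = cmod (cip ((lift_seq A n - sec X n) d) y)"
        by (simp only: cip_self norm_of_real) (simp add: power2_eq_square)
      also have "\<dots> \<le> norm ((lift_seq A n - sec X n) d) * norm y" by (rule cip_cauchy)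
      also have "\<dots> \<le> (norm (lift_seq A n - sec X n) * norm d) * norm y"
        by (intro mult_right_mono norm_blinfun) simp
      finally have "norm d * norm d \<le> (norm (lift_seq A n - sec X n) * norm y) * norm d" by (simp add: mult_ac)
      then have "norm d \<le> norm (lift_seq A n - sec X n) * norm y"
        by (metis mult_nonneg_nonneg mult_right_le_imp_le norm_ge_zero not_le order_le_less)
      then show ?thesis by (simp add: d_def)
    qed
    then have "(\<lambda>n. Y n y - sec Z n y) \<longlonglongrightarrow> 0"
      by (rule Lim_null_comparison[OF always_eventually[OF allI]
            tendsto_mult_left_zero[OF tendsto_norm_zero[OF lim]]])
    from tendsto_add[OF this sec_tendsto[OF Z(1), of y]] show ?thesis by simp
  qed
  ultimately show ?thesis
    by (intro FalgI[OF A _ Y]) (auto simp: convergent_def)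
qed

text \<open>Membership in \<open>Falg\<close> is automatic for null sequences, by
  \<open>Falg_null_plus_sec\<close> with the zero operator.\<close>

lemma Galg_iff: "G \<in> Galg lam \<longleftrightarrow> bops G \<and> lift_seq G \<longlonglongrightarrow> 0"
proof -
  have "G \<in> Falg lam" if "bops G" "lift_seq G \<longlonglongrightarrow> 0"
    by (rule Falg_null_plus_sec[OF that(1) onV_zero]) (use that in \<open>simp add: sec_zero\<close>)
  moreover have "(\<lambda>n. opnorm (Kn n) (G n)) \<longlonglongrightarrow> 0 \<longleftrightarrow> lift_seq G \<longlonglongrightarrow> 0" if "bops G"
    using that by (simp add: opnorm_lift_seq tendsto_norm_zero_iff)
  ultimately show ?thesis using FalgD(1) by (auto simp: Galg_def)
qed

lemma seqnorm_lift_seq: "bops A \<Longrightarrow> seqnorm lam A = (SUP n. norm (lift_seq A n))"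
  by (simp add: seqnorm_def opnorm_lift_seq)

lemma compact_lift:
  assumes K: "compact_op Ku K" shows "cptop (Ku.lift K)"
proof -
  have b: "bounded_op Ku K" using K by (simp add: compact_op_def)
  have "cpt (Ku.lift K)"
    unfolding cpt_def
  proof (intro allI impI)
    fix x :: "nat \<Rightarrow> hil" assume x: "\<forall>k. norm (x k) \<le> 1"
    define f where "f k = rep_hil (pu (x k))" for k
    have f: "f k \<in> Ku" "l2norm (f k) \<le> 1" for k
      using Ku.V_rep norm_cl[of "f k"] norm_pu[of "x k"] x[rule_format, of k] by (auto simp: f_def)
    then obtain \<sigma> g where s: "strict_mono \<sigma>" "g \<in> Ku" "(\<lambda>k. l2norm (\<lambda>z. K (f (\<sigma> k)) z - g z)) \<longlonglongrightarrow> 0"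
      using K unfolding compact_op_def by blast
    have "l2norm (\<lambda>z. K (f (\<sigma> k)) z - g z) = norm (Ku.lift K (x (\<sigma> k)) - cl g)" for k
      using Ku.bounded_op_cl(1)[OF b f(1)] s(2)
      by (simp add: Ku.lift_apply[OF b] f_def[symmetric] cl_diff[symmetric] norm_cl L2_diff Ku.VL2)
    then have "(\<lambda>k. Ku.lift K (x (\<sigma> k))) \<longlonglongrightarrow> cl g" using s(3) by (simp add: tendsto_norm_zero_iff LIM_zero_iff)
    then show "\<exists>\<sigma>. strict_mono \<sigma> \<and> convergent (\<lambda>k. Ku.lift K (x (\<sigma> k)))"
      using s(1) by (auto simp: convergent_def)
  qed
  moreover have "onV (Ku.lift K)" by (simp add: onV_def Ku.clin_lift Ku.lift_q Ku.q_lift b)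
  ultimately show ?thesis by (simp add: cptop_def)
qed

text \<open>Leads back from classes to maps of functions by choosing representatives, since compact
  operators in the generators are such maps.\<close>

definition unlift :: "(hil \<Rightarrow>\<^sub>L hil) \<Rightarrow> cop" where "unlift L f = rep_hil (L (cl f))"

lemma compact_unlift:
  assumes L: "cptop L" shows "compact_op Ku (unlift L)" "Ku.lift (unlift L) = L"
proof -
  have oL: "onV L" "cpt L" using L by (auto simp: cptop_def)
  have V: "unlift L f \<in> Ku" for f using oL by (simp add: unlift_def Ku_iff onV_def)
  have b: "bounded_op Ku (unlift L)" "\<And>x. Ku.lift (unlift L) x = L (pu x)"
    using Ku.bounded_opI[of "unlift L" L] V oL by (auto simp: unlift_def onV_def)
  show "Ku.lift (unlift L) = L" using b(2) oL by (intro blinfun_eqI) (simp add: onV_def)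
  show "compact_op Ku (unlift L)"
    unfolding compact_op_def
  proof (intro conjI b allI impI)
    fix f :: "nat \<Rightarrow> cfun" assume f: "\<forall>k. f k \<in> Ku \<and> l2norm (f k) \<le> 1"
    then have f1: "norm (cl (f k)) \<le> 1" for k by (simp add: norm_cl Ku.VL2)
    obtain \<sigma> where s: "strict_mono \<sigma>" "convergent (\<lambda>k. L (cl (f (\<sigma> k))))"
      by (rule cptD[OF oL(2) f1])
    then obtain l where l: "(\<lambda>k. L (cl (f (\<sigma> k)))) \<longlonglongrightarrow> l" by (auto simp: convergent_def)
    have "(\<lambda>k. pu (L (cl (f (\<sigma> k))))) \<longlonglongrightarrow> pu l" by (rule bounded_linear.tendsto[OF bounded_linear_pu l])
    then have l': "(\<lambda>k. L (cl (f (\<sigma> k)))) \<longlonglongrightarrow> pu l" using oL by (simp add: onV_def)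
    have "l2norm (\<lambda>z. unlift L (f (\<sigma> k)) z - rep_hil (pu l) z) = norm (L (cl (f (\<sigma> k))) - pu l)" for k
      by (simp add: unlift_def norm_cl[symmetric] L2_diff cl_diff)
    then show "\<exists>\<sigma> g. strict_mono \<sigma> \<and> g \<in> Ku \<and> (\<lambda>k. l2norm (\<lambda>z. unlift L (f (\<sigma> k)) z - g z)) \<longlonglongrightarrow> 0"
      using s(1) l' Ku.V_rep[of l]
      by (intro exI[of _ \<sigma>] exI[of _ "rep_hil (pu l)"]) (simp add: tendsto_norm_zero LIM_zero_iff)
  qed
qed

lemma bops_gen:
  assumes a: "cont_sym a" and K: "compact_op Ku K"
  shows "bops (gen_seq lam a K)" "lift_seq (gen_seq lam a K) = sec (T a + Ku.lift K)"
proof -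
  have bK: "bounded_op Ku K" using K by (simp add: compact_op_def)
  have inner: "(\<lambda>z. ttoep (blaschke lam) a (Pn lam n f) z + K (Pn lam n f) z) \<in> L2 \<and>
     cl (\<lambda>z. ttoep (blaschke lam) a (Pn lam n f) z + K (Pn lam n f) z) = (T a + Ku.lift K) (pr (Suc n) (cl f))"
    if "f \<in> Kn n" for n f
  proof -
    have fL: "f \<in> L2" using that by (rule Kn.VL2)
    define p where "p = Pn lam n f"
    have p: "p \<in> Ku" "cl p = pr (Suc n) (cl f)" "p \<in> L2"
      using Kn_Ku[OF Pn_Kn[OF fL]] cl_Pn[OF fL] Ku.VL2 by (auto simp: p_def)
    have t: "ttoep (blaschke lam) a p \<in> L2" "cl (ttoep (blaschke lam) a p) = T a (cl p)"
      using ttoep_Ku[OF cont_bdd_sym[OF a] p(3)] cl_ttoep[OF cont_bdd_sym[OF a] p(3)] p(1)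
      by (auto simp: T_apply Ku.VL2 Ku_iff)
    have k: "K p \<in> L2" "cl (K p) = Ku.lift K (cl p)"
      using Ku.bounded_op_cl(1)[OF bK p(1)] Ku.lift_cl[OF bK p(1)] by (auto simp: Ku.VL2)
    show ?thesis using t k p by (simp add: p_def[symmetric] L2_add cl_add blinfun.add_left)
  qed
  have 1: "gen_seq lam a K n f \<in> Kn n" if "f \<in> Kn n" for n f
    unfolding gen_seq_def by (rule Pn_Kn) (use inner[OF that] in simp)
  have 2: "cl (gen_seq lam a K n f) = sec (T a + Ku.lift K) n (cl f)" if "f \<in> Kn n" for n f
    unfolding gen_seq_def sec_apply using inner[OF that] by (simp add: cl_Pn)
  have oK: "onV (Ku.lift K)" using compact_lift[OF K] by (simp add: cptop_def)
  have 3: "clin (sec (T a + Ku.lift K) n)" for n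
    unfolding sec_def using onV_T[of a] oK by (intro clin_compose clin_P clin_add) (auto simp: onV_def)
  show "bops (gen_seq lam a K)" "lift_seq (gen_seq lam a K) = sec (T a + Ku.lift K)"
    by (rule bopsI[OF 1 2 3]; simp add: sec_apply pr_pr)+
qed

end

section \<open>The algebra generated by the sections\<close>

context bzeros
begin

definition section_alg :: "(nat \<Rightarrow> cop) set" where
  "section_alg = {(\<lambda>n f z. gen_seq lam a K n f z + G n f z) | a K G.
       continuous_on (sphere 0 1) a \<and> compact_op (K2 (blaschke lam)) K \<and> G \<in> Galg lam}"

text \<open>Splits membership into an action on each \<open>Kn n\<close> and a statement about lifts
  only, on which the ideal calculus operates.\<close>

lemma section_alg_iff: "A \<in> section_alg \<longleftrightarrow> bops A \<and> (\<exists>a. cont_sym a \<and> cpt_ideal (\<lambda>n. lift_seq A n - sec (T a) n))"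
proof
  assume "A \<in> section_alg"
  then obtain a K G where A: "A = seq_add (gen_seq lam a K) G" and a: "cont_sym a" and K: "compact_op Ku K"
    and G: "bops G" "lift_seq G \<longlonglongrightarrow> 0"
    by (auto simp: section_alg_def cont_sym_def Galg_iff seq_add_def)
  note g = bops_gen[OF a K]
  have "cpt_ideal (\<lambda>n. sec (Ku.lift K) n + lift_seq G n)"
    by (intro cpt_ideal_add cpt_ideal_sec compact_lift K cpt_ideal_null G(2))
  then have "cpt_ideal (\<lambda>n. lift_seq A n - sec (T a) n)"
    unfolding A bops_add(2)[OF g(1) G(1)] g(2) by (simp add: sec_add)
  then show "bops A \<and> (\<exists>a. cont_sym a \<and> cpt_ideal (\<lambda>n. lift_seq A n - sec (T a) n))"
    using a bops_add(1)[OF g(1) G(1)] unfolding A by blast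
next
  assume "bops A \<and> (\<exists>a. cont_sym a \<and> cpt_ideal (\<lambda>n. lift_seq A n - sec (T a) n))"
  then obtain a L where A: "bops A" and a: "cont_sym a" and L: "cptop L"
    and lim: "(\<lambda>n. (lift_seq A n - sec (T a) n) - sec L n) \<longlonglongrightarrow> 0" by (auto simp: cpt_ideal_def)
  define K where "K = unlift L"
  have K: "compact_op Ku K" "Ku.lift K = L" unfolding K_def using compact_unlift[OF L] by auto
  note g = bops_gen[OF a K(1)]
  \<comment> \<open>Taking the plain difference makes the decomposition an equality of functions
    everywhere; whatever \<open>A\<close> does off \<open>Kn n\<close> goes into \<open>G\<close>,
    whose membership in \<open>Galg\<close> depends on the lift alone.\<close>
  define G where "G = (\<lambda>n f z. A n f z - gen_seq lam a K n f z)"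
  have "bops G" "lift_seq G = (\<lambda>n. lift_seq A n - lift_seq (gen_seq lam a K) n)"
    unfolding G_def by (rule bops_diff[OF A g(1)])+
  then have "G \<in> Galg lam"
    using lim by (simp add: Galg_iff g(2) K(2) sec_add diff_diff_eq)
  moreover have "A = (\<lambda>n f z. gen_seq lam a K n f z + G n f z)" by (simp add: G_def)
  ultimately show "A \<in> section_alg" unfolding section_alg_def using a K(1) by (auto simp: cont_sym_def)
qed

lemma section_alg_Falg: "A \<in> section_alg \<Longrightarrow> A \<in> Falg lam"
proof -
  assume "A \<in> section_alg"
  then obtain a L where A: "bops A" and L: "cptop L"
    and lim: "(\<lambda>n. (lift_seq A n - sec (T a) n) - sec L n) \<longlonglongrightarrow> 0" by (auto simp: section_alg_iff cpt_ideal_def)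
  have "onV (T a + L)" using L by (intro onV_add onV_T) (simp add: cptop_def)
  then show ?thesis
    by (rule Falg_null_plus_sec[OF A]) (use lim in \<open>simp add: sec_add diff_diff_eq\<close>)
qed

lemma Falg_bounded:
  assumes "A \<in> Falg lam" obtains C where "\<And>n. norm (lift_seq A n) \<le> C"
  using uniform_boundedness[of "lift_seq A"] FalgD(2)[OF assms] by blast

lemma section_alg_closed_subalg: "closed_subalg lam section_alg"
  unfolding closed_subalg_def
proof (intro conjI ballI allI impI)
  show "section_alg \<subseteq> Falg lam" using section_alg_Falg by blast
next
  fix A B assume A: "A \<in> section_alg" and B: "B \<in> section_alg"
  obtain a where a: "bops A" "cont_sym a" "cpt_ideal (\<lambda>n. lift_seq A n - sec (T a) n)" using A by (auto simp: section_alg_iff)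
  obtain b where b: "bops B" "cont_sym b" "cpt_ideal (\<lambda>n. lift_seq B n - sec (T b) n)" using B by (auto simp: section_alg_iff)
  have "T (\<lambda>z. a z + b z) = T a + T b"
    by (intro T_add cont_bdd_sym cont_add a b)
  then have "(\<lambda>n. lift_seq (seq_add A B) n - sec (T (\<lambda>z. a z + b z)) n) = (\<lambda>n. (lift_seq A n - sec (T a) n) + (lift_seq B n - sec (T b) n))"
    by (simp add: bops_add(2)[OF a(1) b(1)] sec_add fun_eq_iff)
  then show "seq_add A B \<in> section_alg"
    unfolding section_alg_iff using cpt_ideal_add[OF a(3) b(3)] bops_add(1)[OF a(1) b(1)] cont_add[OF a(2) b(2)] by metis
  \<comment> \<open>The product of the lifts minus the section with symbol \<open>a * b\<close>,
    changed one factor at a time; what remains at the end is the semicommutator.\<close>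
  have "cpt_ideal (\<lambda>n. ((lift_seq A n - sec (T a) n) o\<^sub>L lift_seq B n) + (sec (T a) n o\<^sub>L (lift_seq B n - sec (T b) n)) + semicomm a b n)"
    by (intro cpt_ideal_add cpt_ideal_mult_left cpt_ideal_mult_right a(3) b(3) cpt_ideal_T_sec_like[OF b(3)] sec_like_sec onV_T cpt_ideal_semicomm a b)
  moreover have "(\<lambda>n. ((lift_seq A n - sec (T a) n) o\<^sub>L lift_seq B n) + (sec (T a) n o\<^sub>L (lift_seq B n - sec (T b) n)) + semicomm a b n)
     = (\<lambda>n. lift_seq (seq_mult A B) n - sec (T (\<lambda>z. a z * b z)) n)"
    by (rule ext) (simp add: semicomm_def compose_simps bops_mult(2)[OF a(1) b(1)])
  ultimately have "cpt_ideal (\<lambda>n. lift_seq (seq_mult A B) n - sec (T (\<lambda>z. a z * b z)) n)" by simp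
  then show "seq_mult A B \<in> section_alg"
    unfolding section_alg_iff using bops_mult(1)[OF a(1) b(1)] cont_mult[OF a(2) b(2)] by blast
next
  fix A c assume A: "A \<in> section_alg"
  obtain a where a: "bops A" "cont_sym a" "cpt_ideal (\<lambda>n. lift_seq A n - sec (T a) n)" using A by (auto simp: section_alg_iff)
  have "T (\<lambda>z. c * a z) = cmul c (T a)"
    by (intro T_scale cont_bdd_sym cont_scale a)
  then have "(\<lambda>n. lift_seq (seq_smult c A) n - sec (T (\<lambda>z. c * a z)) n) = (\<lambda>n. cmul c (lift_seq A n - sec (T a) n))"
    by (simp add: bops_smult(2)[OF a(1)] sec_cmul cmul_diff)
  then show "seq_smult c A \<in> section_alg"
    unfolding section_alg_iff using cpt_ideal_cmul[OF a(3), of c] bops_smult(1)[OF a(1)] cont_scale[OF a(2)] by metis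
next
  fix A assume A: "A \<in> Falg lam" and ap: "\<forall>e>0. \<exists>B\<in>section_alg. seqnorm lam (\<lambda>n f z. A n f z - B n f z) < e"
  have bA: "bops A" by (rule FalgD[OF A])
  have "\<exists>a. cont_sym a \<and> cpt_ideal (\<lambda>n. lift_seq A n - sec (T a) n)"
  proof (rule symbol_class_closed)
    fix eps :: real assume "eps > 0"
    then obtain B where B: "B \<in> section_alg" "seqnorm lam (\<lambda>n f z. A n f z - B n f z) < eps" using ap by blast
    have bB: "bops B" using B(1) by (simp add: section_alg_iff)
    note D = bops_diff[OF bA bB]
    obtain C1 where C1: "\<And>n. norm (lift_seq A n) \<le> C1" using Falg_bounded[OF A] by blast
    obtain C2 where C2: "\<And>n. norm (lift_seq B n) \<le> C2" using Falg_bounded[OF section_alg_Falg[OF B(1)]] by blast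
    \<comment> \<open>Needed to pass from the supremum in \<open>seqnorm\<close> to every single
      entry; membership in \<open>Falg\<close> bounds both sequences.\<close>
    have "bdd_above (range (\<lambda>n. norm (lift_seq A n - lift_seq B n)))"
      by (rule bdd_aboveI2[of _ _ "C1 + C2"]) (use C1 C2 in \<open>meson add_mono norm_triangle_ineq4 order_trans\<close>)
    then have "norm (lift_seq A n - lift_seq B n) \<le> seqnorm lam (\<lambda>n f z. A n f z - B n f z)" for n
      unfolding seqnorm_lift_seq[OF D(1)] D(2) by (intro cSUP_upper) auto
    then have "norm (lift_seq A n - lift_seq B n) \<le> eps" for n using B(2) by (meson less_imp_le order_trans)
    moreover obtain a where "cont_sym a" "cpt_ideal (\<lambda>n. lift_seq B n - sec (T a) n)" using B(1) by (auto simp: section_alg_iff)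
    ultimately show "\<exists>B a. cont_sym a \<and> cpt_ideal (\<lambda>n. B n - sec (T a) n) \<and> (\<forall>n. norm (lift_seq A n - B n) \<le> eps)" by blast
  qed
  then show "A \<in> section_alg" using bA by (simp add: section_alg_iff)
qed

lemma generators_section_alg: "generators lam \<subseteq> section_alg"
proof
  fix A assume "A \<in> generators lam"
  then obtain a K where A: "A = gen_seq lam a K" "cont_sym a" "compact_op Ku K"
    by (auto simp: generators_def cont_sym_def)
  note g = bops_gen[OF A(2,3)]
  have "(\<lambda>n. lift_seq A n - sec (T a) n) = sec (Ku.lift K)" by (simp add: A g sec_add fun_eq_iff)
  then show "A \<in> section_alg" unfolding section_alg_iff using cpt_ideal_sec[OF compact_lift[OF A(3)]] g(1) A by metis
qed

lemma T_zero: "T (\<lambda>z. 0) = 0"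
proof (rule blinfun_eqI)
  fix x
  have "mulop (\<lambda>z. 0 * 0) y = 0 *\<^sub>C mulop (\<lambda>z. 0) y" for y
    by (rule mulop_scale_symbol) (simp_all add: bdd_sym_const)
  then show "T (\<lambda>z. 0) x = (0 :: hil \<Rightarrow>\<^sub>L hil) x"
    using linear_0[OF bounded_linear.linear[OF bounded_linear_pu]] by (simp add: T_apply)
qed

lemma pr_e: "pr n (e k) = (if k < n then e k else 0)"
proof -
  have "pr n (e k) = (\<Sum>j<n. if j = k then e k else 0)"
    unfolding pr_def by (intro sum.cong) (auto simp: on)
  then show ?thesis by simp
qed

lemma pr_decomp:
  assumes "clin X" shows "X (pr n x) = (\<Sum>j<n. cip x (e j) *\<^sub>C X (e j))"
  using assms by (simp add: pr_def blinfun.sum_right clinD)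

end

section \<open>Null sequences in an arbitrary closed subalgebra containing the generators\<close>

locale bzeros_subalg = bzeros +
  fixes S assumes S: "closed_subalg lam S" and gS: "generators lam \<subseteq> S"
begin

text \<open>Lifts are enough: closedness of \<open>S\<close> is expressed by \<open>seqnorm\<close>,
  which on sequences satisfying \<open>bops\<close> depends only on the lift.\<close>

definition SX :: "(nat \<Rightarrow> hil \<Rightarrow>\<^sub>L hil) set" where "SX = lift_seq ` S"

lemma S_bops: "B \<in> S \<Longrightarrow> bops B"
  using S FalgD(1) by (auto simp: closed_subalg_def)

lemma SX_add: "X \<in> SX \<Longrightarrow> Y \<in> SX \<Longrightarrow> (\<lambda>n. X n + Y n) \<in> SX"
proof -
  assume "X \<in> SX" "Y \<in> SX"
  then obtain A B where "A \<in> S" "B \<in> S" "X = lift_seq A" "Y = lift_seq B" by (auto simp: SX_def)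
  then show ?thesis using bops_add(2)[of A B] S S_bops unfolding SX_def closed_subalg_def
    by (intro image_eqI[of _ _ "seq_add A B"]) auto
qed

lemma SX_cmul: "X \<in> SX \<Longrightarrow> (\<lambda>n. cmul c (X n)) \<in> SX"
proof -
  assume "X \<in> SX"
  then obtain A where "A \<in> S" "X = lift_seq A" by (auto simp: SX_def)
  then show ?thesis using bops_smult(2)[of A c] S S_bops unfolding SX_def closed_subalg_def
    by (intro image_eqI[of _ _ "seq_smult c A"]) auto
qed

lemma SX_mult: "X \<in> SX \<Longrightarrow> Y \<in> SX \<Longrightarrow> (\<lambda>n. X n o\<^sub>L Y n) \<in> SX"
proof -
  assume "X \<in> SX" "Y \<in> SX"
  then obtain A B where "A \<in> S" "B \<in> S" "X = lift_seq A" "Y = lift_seq B" by (auto simp: SX_def)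
  then show ?thesis using bops_mult(2)[of A B] S S_bops unfolding SX_def closed_subalg_def
    by (intro image_eqI[of _ _ "seq_mult A B"]) auto
qed

lemma SX_diff: "X \<in> SX \<Longrightarrow> Y \<in> SX \<Longrightarrow> (\<lambda>n. X n - Y n) \<in> SX"
  using SX_add[OF _ SX_cmul[of Y "-1"], of X] by (simp add: cmul_minus_one)

lemma SX_sec: "cptop L \<Longrightarrow> sec L \<in> SX"
proof -
  assume L: "cptop L"
  \<comment> \<open>The symbol 0 is allowed, so the generators include the plain sections of compact
    operators.\<close>
  have "gen_seq lam (\<lambda>z. 0) (unlift L) \<in> generators lam"
    unfolding generators_def using compact_unlift(1)[OF L] continuous_on_const by blast
  then have "gen_seq lam (\<lambda>z. 0) (unlift L) \<in> S" using gS by blast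
  moreover have "lift_seq (gen_seq lam (\<lambda>z. 0) (unlift L)) = sec L"
    using bops_gen(2)[OF cont_const compact_unlift(1)[OF L], of 0] by (simp add: T_zero compact_unlift(2)[OF L])
  ultimately show ?thesis unfolding SX_def by (metis imageI)
qed

lemma SX_zero: "(\<lambda>n. 0) \<in> SX"
  using SX_sec[OF cptop_zero] by (simp add: sec_zero[abs_def])

lemma SX_sum: "finite I \<Longrightarrow> (\<And>i. i \<in> I \<Longrightarrow> X i \<in> SX) \<Longrightarrow> (\<lambda>n. \<Sum>i\<in>I. X i n) \<in> SX"
proof (induction I rule: finite_induct)
  case empty then show ?case using SX_zero by simp
next
  case (insert i I)
  then have "(\<lambda>n. X i n + (\<Sum>j\<in>I. X j n)) \<in> SX" by (intro SX_add) auto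
  then show ?case using insert.hyps by simp
qed

text \<open>For \<open>n \<ge> k\<close> the vector \<open>e k\<close> is in the range of the projection, so the sections of the rank one operators
  \<open>x (e k)*\<close> and \<open>(e k) y*\<close> multiply to the section of \<open>x y*\<close>; for \<open>n < k\<close> they vanish.
  The defects for \<open>k = m + 1\<close> and \<open>k = m\<close> differ in the entry \<open>m\<close> only.\<close>

lemma SX_single_rk1: "(\<lambda>n. if n = m then sec (rk1 (pu x) (pu y)) m else 0) \<in> SX"
proof -
  have pe: "pu (e k) = e k" for k using pu_pr[of "Suc k" "e k"] by (simp add: pr_e)
  define D where "D k n = sec (rk1 (pu x) (pu y)) n - (sec (rk1 (pu x) (pu (e k))) n o\<^sub>L sec (rk1 (pu (e k)) (pu y)) n)" for k n
  have DS: "D k \<in> SX" for k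
    unfolding D_def[abs_def] by (intro SX_diff SX_mult SX_sec cptop_rk1_pu)
  have D: "D k n = (if k \<le> n then 0 else sec (rk1 (pu x) (pu y)) n)" for k n
    by (rule blinfun_eqI) (simp add: D_def sec_rk1 pr_e blinfun.diff_left on)
  have "(\<lambda>n. D (Suc m) n - D m n) \<in> SX" by (intro SX_diff DS)
  moreover have "(\<lambda>n. D (Suc m) n - D m n) = (\<lambda>n. if n = m then sec (rk1 (pu x) (pu y)) m else 0)"
    by (auto simp: D fun_eq_iff)
  ultimately show ?thesis by simp
qed

text \<open>An operator on the range of \<open>pr (Suc m)\<close> is a sum of \<open>Suc m\<close>
  rank one operators, one for each basis vector there, so \<open>SX_single_rk1\<close>
  suffices.\<close>

lemma SX_single:
  assumes X: "clin X" "\<And>x. X (pr (Suc m) x) = X x" "\<And>x. pr (Suc m) (X x) = X x"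
  shows "(\<lambda>n. if n = m then X else 0) \<in> SX"
proof -
  have "X = (\<Sum>j<Suc m. sec (rk1 (pu (X (e j))) (pu (e j))) m)"
  proof (rule blinfun_eqI)
    fix x
    have "X x = (\<Sum>j<Suc m. cip x (e j) *\<^sub>C X (e j))"
      using pr_decomp[OF X(1), of "Suc m" x] by (simp only: X(2))
    also have "\<dots> = (\<Sum>j<Suc m. sec (rk1 (pu (X (e j))) (pu (e j))) m x)"
      by (intro sum.cong) (auto simp: sec_rk1 X(3) pr_e)
    finally show "X x = (\<Sum>j<Suc m. sec (rk1 (pu (X (e j))) (pu (e j))) m) x"
      by (simp only: blinfun.sum_left)
  qed
  then have "(\<lambda>n. if n = m then X else 0) =
      (\<lambda>n. \<Sum>j<Suc m. (if n = m then sec (rk1 (pu (X (e j))) (pu (e j))) m else 0))"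
    by (intro ext) (simp only: if_distrib sum.neutral_const refl split: if_splits, simp)
  also have "\<dots> \<in> SX" by (rule SX_sum) (auto intro: SX_single_rk1)
  finally show ?thesis .
qed

lemma SX_truncated:
  assumes "bops G" shows "(\<lambda>n. if n < N then lift_seq G n else 0) \<in> SX"
proof -
  have "(\<lambda>n. \<Sum>m<N. (if n = m then lift_seq G m else 0)) \<in> SX"
    by (rule SX_sum) (simp_all add: SX_single clin_lift_seq lift_seq_pr pr_lift_seq assms)
  moreover have "(\<lambda>n. \<Sum>m<N. (if n = m then lift_seq G m else 0)) = (\<lambda>n. if n < N then lift_seq G n else 0)"
    by (simp add: fun_eq_iff)
  ultimately show ?thesis by simp
qed

lemma Galg_S: assumes G: "G \<in> Galg lam" shows "G \<in> S"
proof -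
  have bG: "bops G" "lift_seq G \<longlonglongrightarrow> 0" using G by (auto simp: Galg_iff)
  have "\<exists>B\<in>S. seqnorm lam (\<lambda>n f z. G n f z - B n f z) < r" if r: "r > 0" for r
  proof -
    have "\<forall>\<^sub>F n in sequentially. norm (lift_seq G n) < r/2"
      using r by (intro order_tendstoD(2)[OF tendsto_norm_zero[OF bG(2)]]) simp
    then obtain N where N: "\<And>n. n \<ge> N \<Longrightarrow> norm (lift_seq G n) < r/2" by (auto simp: eventually_sequentially)
    obtain B where B: "B \<in> S" "lift_seq B = (\<lambda>n. if n < N then lift_seq G n else 0)"
      using SX_truncated[OF bG(1), of N] by (auto simp: SX_def)
    have "seqnorm lam (\<lambda>n f z. G n f z - B n f z) = (SUP n. norm (lift_seq G n - lift_seq B n))"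
      using bops_diff[OF bG(1) S_bops[OF B(1)]] by (simp add: seqnorm_lift_seq)
    also have "\<dots> \<le> r/2"
      using N r by (intro cSUP_least) (auto simp: B(2) not_less intro: less_imp_le)
    also have "\<dots> < r" using r by simp
    finally show ?thesis using B(1) by blast
  qed
  then show ?thesis using S G unfolding closed_subalg_def by (auto simp: Galg_def)
qed

lemma section_alg_subset_S: "section_alg \<subseteq> S"
proof
  fix A assume "A \<in> section_alg"
  then obtain a K G where A: "A = seq_add (gen_seq lam a K) G" and a: "continuous_on (sphere 0 1) a"
    "compact_op Ku K" "G \<in> Galg lam"
    by (auto simp: section_alg_def seq_add_def)
  have "gen_seq lam a K \<in> S" using gS a by (auto simp: generators_def)
  moreover have "G \<in> S" by (rule Galg_S[OF a(3)])
  ultimately show "A \<in> S" using S unfolding A closed_subalg_def by blast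
qed

end

theorem theorem4p2:
  fixes lam :: "nat \<Rightarrow> complex"
  assumes "blaschke_seq lam"
  shows "S_TuC lam =
    {(\<lambda>n f z. gen_seq lam a K n f z + G n f z) | a K G.
       continuous_on (sphere 0 1) a \<and> compact_op (K2 (blaschke lam)) K \<and> G \<in> Galg lam}"
proof -
  interpret bzeros lam by unfold_locales (rule assms)
  have "S_TuC lam = section_alg"
  proof
    show "S_TuC lam \<subseteq> section_alg" unfolding S_TuC_def using section_alg_closed_subalg generators_section_alg by blast
    show "section_alg \<subseteq> S_TuC lam" unfolding S_TuC_def
    proof (rule Inter_greatest)
      fix S assume "S \<in> {S. closed_subalg lam S \<and> generators lam \<subseteq> S}"
      then interpret bzeros_subalg lam S by unfold_locales auto
      show "section_alg \<subseteq> S" by (rule section_alg_subset_S)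
    qed
  qed
  then show ?thesis by (simp only: section_alg_def)
qed

end
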